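(* Let $D$ be the unit disk in $\mathbb{R}^2$. Assume that $n$ and $\eta$ are positive constants with $n\ne1$. Then there exist infinitely many complex-valued (i.e. non-real) interior transmission eigenvalues for $D$, provided that $\eta$ is sufficiently small (depending on $n$).
   Context: For a domain $D$ with unit outward normal $\nu$ and constants $n,\eta$, a number $k\in\mathbb{C}$ is an interior transmission eigenvalue (with conductive boundary condition) if there is a nontrivial pair $(w,v)\in L^2(D)\times L^2(D)$ with $w-v\in H^2(D)\cap H^1_0(D)$ such that $$\Delta w+k^2nw=0,\quad \Delta v+k^2v=0\ \text{ in }D,\qquad w-v=0,\quad \partial_\nu w-\partial_\nu v=\eta v\ \text{ on }\partial D.$$ *)

theory Defs
  imports "HOL-Analysis.Analysis"
begin

definition partial_deriv :: "'a::euclidean_space \<Rightarrow> ('a \<Rightarrow> complex) \<Rightarrow> 'a \<Rightarrow> complex" where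
  "partial_deriv b f x = frechet_derivative f (at x) b"

definition laplacian :: "('a::euclidean_space \<Rightarrow> complex) \<Rightarrow> 'a \<Rightarrow> complex" where
  "laplacian f x = (\<Sum>b\<in>Basis. partial_deriv b (partial_deriv b f) x)"

fun C_diff :: "nat \<Rightarrow> ('a::euclidean_space \<Rightarrow> complex) \<Rightarrow> bool" where
  "C_diff 0 f \<longleftrightarrow> continuous_on UNIV f"
| "C_diff (Suc m) f \<longleftrightarrow>
     (\<forall>x. f differentiable (at x)) \<and> (\<forall>b\<in>Basis. C_diff m (partial_deriv b f))"

definition smooth_functions :: "('a::euclidean_space \<Rightarrow> complex) set" where
  "smooth_functions = {f. \<forall>m. C_diff m f}"

definition test_functions :: "'a::euclidean_space set \<Rightarrow> ('a \<Rightarrow> complex) set" where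
  "test_functions D =
     {\<phi> \<in> smooth_functions. compact (closure {x. \<phi> x \<noteq> 0}) \<and> closure {x. \<phi> x \<noteq> 0} \<subseteq> D}"

text \<open>Elements of \<open>L\<^sup>2\<close> and of Sobolev spaces are represented by functions, not by classes modulo
  null sets. Values outside the underlying domain are irrelevant.\<close>

definition L2_space :: "'a measure \<Rightarrow> ('a \<Rightarrow> complex) set" where
  "L2_space M = {f \<in> borel_measurable M. integrable M (\<lambda>x. (cmod (f x))\<^sup>2)}"

definition L2_tendsto ::
  "'a measure \<Rightarrow> (nat \<Rightarrow> 'a \<Rightarrow> complex) \<Rightarrow> ('a \<Rightarrow> complex) \<Rightarrow> bool" where
  "L2_tendsto M F f \<longleftrightarrow> (\<forall>j. F j \<in> L2_space M) \<and> f \<in> L2_space M \<and>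
     (\<lambda>j. \<integral>x. (cmod (F j x - f x))\<^sup>2 \<partial>M) \<longlonglongrightarrow> 0"

definition has_weak_partial ::
  "'a::euclidean_space set \<Rightarrow> 'a \<Rightarrow> ('a \<Rightarrow> complex) \<Rightarrow> ('a \<Rightarrow> complex) \<Rightarrow> bool" where
  "has_weak_partial D b f g \<longleftrightarrow>
     f \<in> L2_space (lebesgue_on D) \<and> g \<in> L2_space (lebesgue_on D) \<and>
     (\<forall>\<phi>\<in>test_functions D.
        (\<integral>x. f x * partial_deriv b \<phi> x \<partial>lebesgue_on D) = - (\<integral>x. g x * \<phi> x \<partial>lebesgue_on D))"

definition has_weak_laplacian ::
  "'a::euclidean_space set \<Rightarrow> ('a \<Rightarrow> complex) \<Rightarrow> ('a \<Rightarrow> complex) \<Rightarrow> bool" where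
  "has_weak_laplacian D f g \<longleftrightarrow>
     f \<in> L2_space (lebesgue_on D) \<and> g \<in> L2_space (lebesgue_on D) \<and>
     (\<forall>\<phi>\<in>test_functions D.
        (\<integral>x. f x * laplacian \<phi> x \<partial>lebesgue_on D) = (\<integral>x. g x * \<phi> x \<partial>lebesgue_on D))"

definition H1_space :: "'a::euclidean_space set \<Rightarrow> ('a \<Rightarrow> complex) set" where
  "H1_space D = {f \<in> L2_space (lebesgue_on D). \<forall>b\<in>Basis. \<exists>g. has_weak_partial D b f g}"

definition H2_space :: "'a::euclidean_space set \<Rightarrow> ('a \<Rightarrow> complex) set" where
  "H2_space D =
     {f \<in> H1_space D. \<forall>b\<in>Basis. \<exists>g. has_weak_partial D b f g \<and> g \<in> H1_space D}"

definition H1_tendsto ::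
  "'a::euclidean_space set \<Rightarrow> (nat \<Rightarrow> 'a \<Rightarrow> complex) \<Rightarrow> ('a \<Rightarrow> complex) \<Rightarrow> bool" where
  "H1_tendsto D F f \<longleftrightarrow> L2_tendsto (lebesgue_on D) F f \<and>
     (\<forall>b\<in>Basis. \<exists>g. has_weak_partial D b f g \<and>
        L2_tendsto (lebesgue_on D) (\<lambda>j. partial_deriv b (F j)) g)"

definition H10_space :: "'a::euclidean_space set \<Rightarrow> ('a \<Rightarrow> complex) set" where
  "H10_space D = {f. \<exists>F. (\<forall>j. F j \<in> test_functions D) \<and> H1_tendsto D F f}"

text \<open>In the following, \<open>\<sigma>\<close> is the surface measure on the boundary of \<open>D\<close> and \<open>\<nu>\<close> its unit outward
  normal field. The trace operator on \<open>H\<^sup>1(D)\<close> is the continuous extension of the restriction to the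
  boundary of functions that are smooth up to the boundary; for \<open>u \<in> H\<^sup>2(D)\<close> the normal derivative
  is \<open>\<nu>\<close> dotted with the trace of the gradient.\<close>

definition has_trace ::
  "'a::euclidean_space set \<Rightarrow> 'a measure \<Rightarrow> ('a \<Rightarrow> complex) \<Rightarrow> ('a \<Rightarrow> complex) \<Rightarrow> bool" where
  "has_trace D \<sigma> f g \<longleftrightarrow>
     (\<exists>F. (\<forall>j. F j \<in> smooth_functions) \<and> H1_tendsto D F f \<and> L2_tendsto \<sigma> F g)"

definition has_normal_derivative ::
  "'a::euclidean_space set \<Rightarrow> ('a \<Rightarrow> 'a) \<Rightarrow> 'a measure \<Rightarrow>
   ('a \<Rightarrow> complex) \<Rightarrow> ('a \<Rightarrow> complex) \<Rightarrow> bool" where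
  "has_normal_derivative D \<nu> \<sigma> u g \<longleftrightarrow> g \<in> L2_space \<sigma> \<and>
     (\<exists>G T. (\<forall>b\<in>Basis. has_weak_partial D b u (G b) \<and> has_trace D \<sigma> (G b) (T b)) \<and>
        (AE x in \<sigma>. g x = (\<Sum>b\<in>Basis. complex_of_real (\<nu> x \<bullet> b) * T b x)))"

text \<open>A function \<open>v \<in> L\<^sup>2(D)\<close> with \<open>\<Delta>v \<in> L\<^sup>2(D)\<close> has a boundary trace in \<open>H\<^bsup>-1/2\<^esup>\<close> only. It is defined
  by duality through Green's second identity: its pairing with the normal derivative of
  \<open>\<psi> \<in> H\<^sup>2(D) \<inter> H\<^sup>1\<^sub>0(D)\<close> is the integral of \<open>v \<Delta>\<psi> - \<psi> \<Delta>v\<close> over \<open>D\<close>. The predicate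
  says that this functional is represented by the boundary function \<open>g\<close>.\<close>

definition has_dual_trace ::
  "'a::euclidean_space set \<Rightarrow> ('a \<Rightarrow> 'a) \<Rightarrow> 'a measure \<Rightarrow>
   ('a \<Rightarrow> complex) \<Rightarrow> ('a \<Rightarrow> complex) \<Rightarrow> bool" where
  "has_dual_trace D \<nu> \<sigma> v g \<longleftrightarrow> g \<in> L2_space \<sigma> \<and>
     (\<exists>Lv. has_weak_laplacian D v Lv \<and>
        (\<forall>\<psi> \<in> H2_space D \<inter> H10_space D. \<forall>L\<psi> h.
           has_weak_laplacian D \<psi> L\<psi> \<longrightarrow> has_normal_derivative D \<nu> \<sigma> \<psi> h \<longrightarrow>
           (\<integral>x. v x * L\<psi> x - \<psi> x * Lv x \<partial>lebesgue_on D) = (\<integral>x. g x * h x \<partial>\<sigma>)))"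

text \<open>The condition \<open>w - v = 0\<close> on the boundary is \<open>w - v \<in> H\<^sup>1\<^sub>0(D)\<close>. Since \<open>w\<close> and \<open>v\<close> lie merely in
  \<open>L\<^sup>2(D)\<close>, the difference of their normal derivatives is that of \<open>w - v \<in> H\<^sup>2(D)\<close>.\<close>

definition transmission_eigenvalue ::
  "'a::euclidean_space set \<Rightarrow> ('a \<Rightarrow> 'a) \<Rightarrow> 'a measure \<Rightarrow> real \<Rightarrow> real \<Rightarrow> complex \<Rightarrow> bool" where
  "transmission_eigenvalue D \<nu> \<sigma> n \<eta> k \<longleftrightarrow>
     (\<exists>w v. w \<in> L2_space (lebesgue_on D) \<and> v \<in> L2_space (lebesgue_on D) \<and>
        \<not> (AE x in lebesgue_on D. w x = 0 \<and> v x = 0) \<and>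
        (\<lambda>x. w x - v x) \<in> H2_space D \<inter> H10_space D \<and>
        has_weak_laplacian D w (\<lambda>x. - (k\<^sup>2 * of_real n * w x)) \<and>
        has_weak_laplacian D v (\<lambda>x. - (k\<^sup>2 * v x)) \<and>
        (\<exists>g. has_normal_derivative D \<nu> \<sigma> (\<lambda>x. w x - v x) g \<and>
             has_dual_trace D \<nu> \<sigma> (\<lambda>x. of_real \<eta> * v x) g))"

definition unit_disk :: "(real^2) set" where
  "unit_disk = ball 0 1"

definition circle_normal :: "real^2 \<Rightarrow> real^2" where
  "circle_normal x = x"

definition circle_measure :: "(real^2) measure" where
  "circle_measure =
     distr (restrict_space lborel {0..2*pi}) borel (\<lambda>t. vector [cos t, sin t])"

end

theory Submission
  imports Defs "HOL-Computational_Algebra.Polynomial" "HOL-Complex_Analysis.Complex_Analysis"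
begin

text \<open>
  On the unit disk the radial pair \<open>v = \<alpha> J\<^sub>0(k|x|)\<close>, \<open>w = \<beta> J\<^sub>0(\<surd>n k|x|)\<close> is an eigenpair as
  soon as a \<open>2 \<times> 2\<close> determinant \<open>d(k)\<close> vanishes. With \<open>Y(z) = \<surd>z J\<^sub>0(z)\<close>, which on horizontal strips is
  \<open>A (cos (z - \<delta>) + sin (z - \<delta>) / (8z)) + O(z\<^sup>-\<^sup>2)\<close>, and \<open>a = \<surd>n < 1\<close> (the case \<open>n > 1\<close> reduces to this by
  \<open>k \<mapsto> \<surd>n k\<close>, \<open>\<eta> \<mapsto> -\<eta>\<close>), the leading part of \<open>d\<close> is
  \<open>F(k) = sin (k - \<delta>) cos (ak - \<delta>) - a cos (k - \<delta>) sin (ak - \<delta>)\<close>, while \<open>\<eta>\<close> only enters at lower order.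

  If some zero of \<open>cos (ak - \<delta>)\<close> is not a zero of \<open>cos (k - \<delta>)\<close>, then \<open>F\<close> has no real zero between the
  two zeros of \<open>cos (k - \<delta>)\<close> around it; deforming the phase to a symmetric position, where a zero can be
  written down, shows that \<open>F\<close> has a nonreal zero there. As \<open>F\<close> is almost periodic, Hurwitz's theorem yields
  nonreal zeros of \<open>d\<close> arbitrarily far to the right. Otherwise (this happens e.g. for \<open>n = 1/25\<close>) \<open>F\<close> has triple
  real zeros \<open>\<kappa> \<rightarrow> \<infinity>\<close>, and the \<open>1/k\<close> correction splits them: with \<open>k = \<kappa> + \<kappa>\<^sup>-\<^sup>1\<^sup>/\<^sup>3 \<zeta>\<close> the rescaled determinant
  tends to a real cubic \<open>c \<zeta>\<^sup>3 + e\<close> with \<open>c, e > 0\<close>, which has nonreal roots.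
\<close>

section \<open>Smooth functions\<close>

text \<open>Everything turns on F' = (1 - a^2) cos (k - \<delta>) cos (ak - \<delta>). All critical
  points of F are real, so nonreal zeros are simple and survive small perturbations. Between two
  neighbouring zeros of the first cosine, a zero of the second one is an extremum on the wrong side
  of the axis, say a negative maximum; a real entire function of exponential type with only real
  zeros has none. The deformation of the phase makes this concrete and locates the nonreal zero in a
  half strip. Without such an extremum this source dries up, hence the expansion is carried to the
  order 1/k. A perturbation of that size moves a triple zero by k^(-1/3), which dictates the scale.
  The \<eta> term is of order 1/k too, but its factor is the product of the cosines, both zero at
  the triple point, so it drops out of the limit. The notion of eigenvalue involves weak
  derivatives, traces and a boundary value defined by duality against all of H^2 and H^1_0. The
  radial pair is smooth on the whole plane; the first half of the development checks that for smooth
  functions on the disk the classical conditions imply the weak ones.\<close>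

lemma partial_deriv_eqI:
  "(f has_derivative f') (at x) \<Longrightarrow> partial_deriv b f x = f' b"
  unfolding partial_deriv_def using frechet_derivative_at by metis

lemma C_diff_SucD: "C_diff (Suc m) f \<Longrightarrow> C_diff m f"
proof (induction m arbitrary: f)
  case 0
  then show ?case by (auto simp: continuous_on_eq_continuous_within differentiable_imp_continuous_within)
qed simp

lemma C_diff_differentiable: "C_diff (Suc m) f \<Longrightarrow> f differentiable (at x)"
  by simp

lemma partial_deriv_add:
  assumes "f differentiable (at x)" "g differentiable (at x)"
  shows "partial_deriv b (\<lambda>x. f x + g x) x = partial_deriv b f x + partial_deriv b g x"
proof -
  have "((\<lambda>x. f x + g x) has_derivative
      (\<lambda>h. frechet_derivative f (at x) h + frechet_derivative g (at x) h)) (at x)"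
    by (intro has_derivative_add; use assms in \<open>simp add: frechet_derivative_works\<close>)
  from partial_deriv_eqI[OF this] show ?thesis by (simp add: partial_deriv_def)
qed

lemma partial_deriv_mult:
  assumes "f differentiable (at x)" "g differentiable (at x)"
  shows "partial_deriv b (\<lambda>x. f x * g x) x = f x * partial_deriv b g x + partial_deriv b f x * g x"
proof -
  have "((\<lambda>x. f x * g x) has_derivative
      (\<lambda>h. f x * frechet_derivative g (at x) h + frechet_derivative f (at x) h * g x)) (at x)"
    by (intro has_derivative_mult; use assms in \<open>simp add: frechet_derivative_works\<close>)
  from partial_deriv_eqI[OF this] show ?thesis by (simp add: partial_deriv_def)
qed

lemma C_diff_const: "C_diff m (\<lambda>x. c)"
proof (induction m arbitrary: c)
  case (Suc m)
  have "partial_deriv b (\<lambda>x. c) = (\<lambda>x. 0)" for b :: 'a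
    by (auto simp: fun_eq_iff intro: partial_deriv_eqI[OF has_derivative_const])
  with Suc show ?case by simp
qed simp

lemma C_diff_add: "C_diff m f \<Longrightarrow> C_diff m g \<Longrightarrow> C_diff m (\<lambda>x. f x + g x)"
proof (induction m arbitrary: f g)
  case 0
  then show ?case by (auto intro: continuous_intros)
next
  case (Suc m)
  have "partial_deriv b (\<lambda>x. f x + g x) = (\<lambda>x. partial_deriv b f x + partial_deriv b g x)" for b
    using Suc.prems by (intro ext partial_deriv_add) auto
  with Suc show ?case by (auto intro: differentiable_add)
qed

lemma C_diff_mult: "C_diff m f \<Longrightarrow> C_diff m g \<Longrightarrow> C_diff m (\<lambda>x. f x * g x)"
proof (induction m arbitrary: f g)
  case 0
  then show ?case by (auto intro: continuous_intros)
next
  case (Suc m)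
  have eq: "partial_deriv b (\<lambda>x. f x * g x) = (\<lambda>x. f x * partial_deriv b g x + partial_deriv b f x * g x)" for b
    using Suc.prems by (intro ext partial_deriv_mult) auto
  have "C_diff m f" "C_diff m g" using Suc.prems C_diff_SucD by blast+
  with Suc show ?case by (auto simp: eq intro!: differentiable_mult C_diff_add)
qed

lemma has_derivative_of_real_inner:
  "((\<lambda>x::'a::euclidean_space. complex_of_real (x \<bullet> b)) has_derivative (\<lambda>h. of_real (h \<bullet> b))) (at x)"
  by (auto intro!: derivative_eq_intros)

lemma C_diff_inner: "C_diff m (\<lambda>x::'a::euclidean_space. complex_of_real (x \<bullet> b))"
proof (cases m)
  case 0
  then show ?thesis by (auto intro!: continuous_intros)
next
  case (Suc k)
  have "partial_deriv c (\<lambda>x. complex_of_real (x \<bullet> b)) = (\<lambda>x. of_real (c \<bullet> b))" for c :: 'a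
    by (intro ext partial_deriv_eqI has_derivative_of_real_inner)
  then show ?thesis using Suc has_derivative_of_real_inner[of b]
    by (auto simp: C_diff_const differentiable_def)
qed

lemma has_derivative_radial:
  fixes x :: "'a::euclidean_space"
  assumes "(h has_vector_derivative h') (at (x \<bullet> x))"
  shows "((\<lambda>x. h (x \<bullet> x)) has_derivative (\<lambda>d. of_real (2 * (x \<bullet> d)) * (h' :: complex))) (at x)"
proof -
  have "((\<lambda>x. x \<bullet> x) has_derivative (\<lambda>d. 2 * (x \<bullet> d))) (at x)"
    by (rule derivative_eq_intros refl)+ (simp add: inner_commute)
  from diff_chain_at[OF this assms[unfolded has_vector_derivative_def]]
  show ?thesis by (simp add: o_def scaleR_conv_of_real)
qed

text \<open>Composing with |x|^2 instead of |x| keeps the origin regular. Each derivative multiplies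
  the next profile \<open>H (Suc i)\<close> by the linear function 2 x.b, so the induction closes
  under \<open>C_diff_mult\<close> once the whole sequence of derivatives is supplied and
  \<open>i\<close> is left free.\<close>

lemma C_diff_radial:
  fixes H :: "nat \<Rightarrow> real \<Rightarrow> complex"
  assumes "\<And>i t. (H i has_vector_derivative H (Suc i) t) (at t)"
  shows "C_diff m (\<lambda>x::'a::euclidean_space. H i (x \<bullet> x))"
proof (induction m arbitrary: i)
  case 0
  have "isCont (H i) t" for t
    using assms[of i t] has_vector_derivative_continuous by blast
  then have "continuous_on UNIV (H i)" by (simp add: continuous_on_eq_continuous_within)
  then show ?case
    by (auto intro!: continuous_intros continuous_on_compose2[of UNIV "H i"])
next
  case (Suc m)
  have eq: "partial_deriv b (\<lambda>x::'a. H i (x \<bullet> x)) =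
      (\<lambda>x. (2 * of_real (x \<bullet> b)) * H (Suc i) (x \<bullet> x))" for b
    by (rule ext, subst partial_deriv_eqI[OF has_derivative_radial[OF assms]]) (simp add: inner_commute)
  have "C_diff m (\<lambda>x::'a. (2 * of_real (x \<bullet> b)) * H (Suc i) (x \<bullet> x))" for b
    by (rule C_diff_mult[OF C_diff_mult[OF C_diff_const C_diff_inner] Suc.IH])
  moreover have "(\<lambda>x::'a. H i (x \<bullet> x)) differentiable (at x)" for x
    using has_derivative_radial[OF assms] differentiable_def by blast
  ultimately show ?case by (simp add: eq)
qed

lemma smooth_const: "(\<lambda>x. c) \<in> smooth_functions"
  and smooth_add: "f \<in> smooth_functions \<Longrightarrow> g \<in> smooth_functions \<Longrightarrow> (\<lambda>x. f x + g x) \<in> smooth_functions"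
  and smooth_mult: "f \<in> smooth_functions \<Longrightarrow> g \<in> smooth_functions \<Longrightarrow> (\<lambda>x. f x * g x) \<in> smooth_functions"
  by (auto simp: smooth_functions_def C_diff_const C_diff_add C_diff_mult)

lemma smooth_partial_deriv:
  "f \<in> smooth_functions \<Longrightarrow> b \<in> Basis \<Longrightarrow> partial_deriv b f \<in> smooth_functions"
proof -
  assume "f \<in> smooth_functions" "b \<in> Basis"
  then have "C_diff (Suc m) f" for m unfolding smooth_functions_def by blast
  then show ?thesis using \<open>b \<in> Basis\<close> by (simp add: smooth_functions_def)
qed

lemma smooth_differentiable: "f \<in> smooth_functions \<Longrightarrow> f differentiable (at x)"
  unfolding smooth_functions_def using C_diff_differentiable by blast

lemma smooth_continuous: "f \<in> smooth_functions \<Longrightarrow> continuous_on UNIV f"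
  unfolding smooth_functions_def using C_diff.simps(1) by blast

lemma smooth_radial:
  assumes "\<And>i t. (H i has_vector_derivative H (Suc i) t) (at t)"
  shows "(\<lambda>x::'a::euclidean_space. H i (x \<bullet> x) :: complex) \<in> smooth_functions"
  unfolding smooth_functions_def using C_diff_radial[of H, OF assms] by blast

text \<open>With s = 1 / t one has ds/dt = - s^2, hence p(s) exp (- s) has the t-derivative s^2
  (p(s) - p'(s)) exp (- s); the factor \<open>[:0, 0, 1:]\<close> is this s^2.\<close>

primrec exp_inv_poly :: "nat \<Rightarrow> real poly" where
  "exp_inv_poly 0 = 1"
| "exp_inv_poly (Suc i) = [:0, 0, 1:] * (exp_inv_poly i - pderiv (exp_inv_poly i))"

definition exp_inv_deriv :: "nat \<Rightarrow> real \<Rightarrow> real" where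
  "exp_inv_deriv i t = (if t > 0 then poly (exp_inv_poly i) (1 / t) * exp (- (1 / t)) else 0)"

lemma poly_times_exp_neg_tendsto_0: "((\<lambda>s::real. poly p s * exp (- s)) \<longlongrightarrow> 0) at_top"
proof -
  have "((\<lambda>s. \<Sum>i\<le>degree p. coeff p i * (s ^ i / exp s)) \<longlongrightarrow> (\<Sum>i\<le>degree p. coeff p i * 0)) at_top"
    by (intro tendsto_sum tendsto_mult tendsto_const tendsto_power_div_exp_0)
  moreover have "(\<Sum>i\<le>degree p. coeff p i * (s ^ i / exp s)) = poly p s * exp (- s)" for s
    by (simp add: poly_altdef sum_distrib_right exp_minus divide_inverse mult.assoc)
  ultimately show ?thesis by simp
qed

lemma exp_inv_poly_tendsto_0:
  "((\<lambda>t::real. poly p (1 / t) * exp (- (1 / t))) \<longlongrightarrow> 0) (at_right 0)"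
proof -
  have "filterlim (\<lambda>t::real. 1 / t) at_top (at_right 0)"
    using filterlim_inverse_at_top_right by (simp add: inverse_eq_divide)
  from filterlim_compose[OF poly_times_exp_neg_tendsto_0 this] show ?thesis .
qed

lemma exp_inv_deriv_has_derivative:
  "(exp_inv_deriv i has_real_derivative exp_inv_deriv (Suc i) t) (at t)"
proof (cases t "0::real" rule: linorder_cases)
  case less
  have "((\<lambda>t. 0) has_real_derivative 0) (at t)" by simp
  then show ?thesis
    by (rule DERIV_cong_ev[THEN iffD1, rotated -1])
      (use less eventually_nhds_in_open[of "{..<0}" t] in
        \<open>auto simp: exp_inv_deriv_def elim!: eventually_mono\<close>)
next
  case greater
  have "((\<lambda>t. poly (exp_inv_poly i) (1 / t) * exp (- (1 / t))) has_real_derivative exp_inv_deriv (Suc i) t) (at t)"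
    using greater
    by (auto intro!: derivative_eq_intros poly_DERIV[THEN DERIV_chain2]
        simp: exp_inv_deriv_def field_simps power2_eq_square)
  then show ?thesis
    by (rule DERIV_cong_ev[THEN iffD1, rotated -1])
      (use greater eventually_nhds_in_open[of "{0<..}" t] in
        \<open>auto simp: exp_inv_deriv_def elim!: eventually_mono\<close>)
next
  case equal
  \<comment> \<open>To the right of the origin the difference quotient is the function itself times
    1 / h, which only replaces the polynomial p by X p, so the same flatness statement covers
    it.\<close>
  have "((\<lambda>h. exp_inv_deriv i h / h) \<longlongrightarrow> 0) (at_right 0)"
  proof (rule Lim_transform_eventually)
    show "((\<lambda>t::real. poly ([:0,1:] * exp_inv_poly i) (1 / t) * exp (- (1 / t))) \<longlongrightarrow> 0) (at_right 0)"
      by (rule exp_inv_poly_tendsto_0)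
    show "\<forall>\<^sub>F h in at_right 0. poly ([:0,1:] * exp_inv_poly i) (1 / h) * exp (- (1 / h)) = exp_inv_deriv i h / h"
      by (auto simp: exp_inv_deriv_def eventually_at_filter)
  qed
  moreover have "((\<lambda>h. exp_inv_deriv i h / h) \<longlongrightarrow> 0) (at_left 0)"
    by (rule Lim_transform_eventually[OF tendsto_const])
      (auto simp: exp_inv_deriv_def eventually_at_filter)
  ultimately have "((\<lambda>h. exp_inv_deriv i h / h) \<longlongrightarrow> 0) (at 0)"
    by (simp add: filterlim_split_at)
  then show ?thesis unfolding equal by (simp add: DERIV_def exp_inv_deriv_def)
qed

section \<open>Cutoff functions\<close>

text \<open>With \<open>N = j + 2\<close> and \<open>s = N (1 - |x|\<^sup>2) - 1\<close> this is \<open>exp (- 1 / s)\<close> for \<open>s > 0\<close>. It vanishes near the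
  sphere and tends to \<open>1\<close> inside, and its gradient times \<open>1 - |x|\<^sup>2\<close> is bounded uniformly in \<open>j\<close>: this replaces
  the usual plateau function when truncating functions that vanish on the sphere.\<close>

definition cutoff :: "nat \<Rightarrow> 'a::euclidean_space \<Rightarrow> complex" where
  "cutoff j x = of_real (exp_inv_deriv 0 ((real j + 2) * (1 - x \<bullet> x) - 1))"

lemma cutoff_profile_has_derivative:
  "((\<lambda>t. complex_of_real ((- (real j + 2)) ^ i * exp_inv_deriv i ((real j + 2) * (1 - t) - 1)))
     has_vector_derivative
     of_real ((- (real j + 2)) ^ Suc i * exp_inv_deriv (Suc i) ((real j + 2) * (1 - t) - 1))) (at t)"
  by (rule has_vector_derivative_of_real[THEN has_vector_derivative_eq_rhs])
    (auto intro!: derivative_eq_intros DERIV_chain2[OF exp_inv_deriv_has_derivative]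
      simp: has_real_derivative_iff_has_vector_derivative[symmetric])

lemma cutoff_smooth: "cutoff j \<in> smooth_functions"
proof -
  have "cutoff j = (\<lambda>x::'a. of_real ((- (real j + 2)) ^ 0 * exp_inv_deriv 0 ((real j + 2) * (1 - x \<bullet> x) - 1)))"
    by (simp add: cutoff_def fun_eq_iff)
  then show ?thesis
    using smooth_radial[of "\<lambda>i t. of_real ((- (real j + 2)) ^ i * exp_inv_deriv i ((real j + 2) * (1 - t) - 1))" 0,
        OF cutoff_profile_has_derivative] by simp
qed

lemma partial_deriv_cutoff:
  "partial_deriv b (cutoff j) x =
     of_real (- 2 * (real j + 2) * (x \<bullet> b) * exp_inv_deriv 1 ((real j + 2) * (1 - x \<bullet> x) - 1))"
proof -
  have "((\<lambda>x. complex_of_real ((- (real j + 2)) ^ 0 * exp_inv_deriv 0 ((real j + 2) * (1 - x \<bullet> x) - 1)))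
      has_derivative (\<lambda>d. of_real (2 * (x \<bullet> d)) *
        of_real ((- (real j + 2)) ^ Suc 0 * exp_inv_deriv (Suc 0) ((real j + 2) * (1 - x \<bullet> x) - 1)))) (at x)"
    by (rule has_derivative_radial[OF cutoff_profile_has_derivative])
  moreover have "cutoff j = (\<lambda>x::'a. of_real ((- (real j + 2)) ^ 0 * exp_inv_deriv 0 ((real j + 2) * (1 - x \<bullet> x) - 1)))"
    by (simp add: cutoff_def fun_eq_iff)
  ultimately have "partial_deriv b (cutoff j) x = of_real (2 * (x \<bullet> b)) *
        of_real ((- (real j + 2)) ^ Suc 0 * exp_inv_deriv (Suc 0) ((real j + 2) * (1 - x \<bullet> x) - 1))"
    by (metis (no_types, lifting) partial_deriv_eqI)
  then show ?thesis unfolding of_real_mult[symmetric] by (simp del: of_real_mult)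
qed

lemma exp_inv_deriv_0_bounds: "0 \<le> exp_inv_deriv 0 s" "exp_inv_deriv 0 s \<le> 1"
  by (auto simp: exp_inv_deriv_def)

lemma exp_inv_deriv_1: "s > 0 \<Longrightarrow> exp_inv_deriv 1 s = exp (- (1 / s)) / s\<^sup>2"
  by (simp add: exp_inv_deriv_def power2_eq_square field_simps)

lemma exp_inv_deriv_1_nonneg: "0 \<le> exp_inv_deriv 1 s"
  by (simp add: exp_inv_deriv_def)

text \<open>For s = N (1 - |x|^2) - 1 the weight s + 1 is N (1 - |x|^2): the factor N comes from the
  chain rule in the gradient of the cutoff, and 1 - |x|^2 is the available decay at the sphere. In u
  = 1 / s the product is (u + u^2) exp (- u), which the quadratic Taylor bound for exp
  controls.\<close>

lemma exp_inv_deriv_1_bound: "(s + 1) * exp_inv_deriv 1 s \<le> 3"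
proof (cases "s > 0")
  case True
  define u where "u = 1 / s"
  have u: "u > 0" using True by (simp add: u_def)
  have "1 + u + u\<^sup>2 / 2 \<le> exp u" using exp_lower_Taylor_quadratic[of u] u by simp
  then have "u + u\<^sup>2 \<le> 3 * exp u" using u zero_le_power2[of u] by linarith
  then have "(u + u\<^sup>2) * exp (- u) \<le> 3" by (simp add: exp_minus field_simps)
  moreover have "(s + 1) * exp_inv_deriv 1 s = (u + u\<^sup>2) * exp (- u)"
    unfolding exp_inv_deriv_1[OF True] using True by (simp add: u_def field_simps power2_eq_square)
  ultimately show ?thesis by simp
qed (simp add: exp_inv_deriv_def)

lemma norm_cutoff_le_1: "norm (cutoff j x) \<le> 1"
  using exp_inv_deriv_0_bounds by (simp add: cutoff_def)

lemma cutoff_support: "cutoff j x \<noteq> 0 \<Longrightarrow> x \<in> cball 0 (sqrt (1 - 1 / (real j + 2)))"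
proof -
  assume "cutoff j x \<noteq> 0"
  then have "(real j + 2) * (1 - x \<bullet> x) - 1 > 0"
    by (auto simp: cutoff_def exp_inv_deriv_def split: if_splits)
  then have "x \<bullet> x \<le> 1 - 1 / (real j + 2)" by (simp add: field_simps)
  then show ?thesis by (simp add: norm_eq_sqrt_inner real_sqrt_le_iff)
qed

lemma scaled_gap_at_top:
  fixes t :: real assumes "t > 0"
  shows "filterlim (\<lambda>j. (real j + 2) * t - 1) at_top sequentially"
proof -
  have "filterlim (\<lambda>j. (2 * t - 1) + t * real j) at_top sequentially"
    by (rule filterlim_tendsto_add_at_top[OF tendsto_const
          filterlim_tendsto_pos_mult_at_top[OF tendsto_const assms filterlim_real_sequentially]])
  then show ?thesis by (simp add: algebra_simps)
qed

lemma cutoff_tendsto_1: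
  assumes "norm x < 1" shows "(\<lambda>j. cutoff j x) \<longlonglongrightarrow> 1"
proof -
  have t: "1 - x \<bullet> x > 0" using assms by (simp add: norm_lt_square)
  have "filterlim (\<lambda>j. (real j + 2) * (1 - x \<bullet> x) - 1) at_top sequentially"
    using scaled_gap_at_top[OF t] .
  then have *: "(\<lambda>j. exp (- (1 / ((real j + 2) * (1 - x \<bullet> x) - 1)))) \<longlonglongrightarrow> exp (- 0)"
    by (intro tendsto_exp tendsto_minus tendsto_divide_0[OF tendsto_const]) (rule filterlim_at_top_imp_at_infinity)
  have "\<forall>\<^sub>F j in sequentially. (real j + 2) * (1 - x \<bullet> x) - 1 > 0"
    using scaled_gap_at_top[OF t] unfolding filterlim_at_top_dense by blast
  then have "(\<lambda>j. exp_inv_deriv 0 ((real j + 2) * (1 - x \<bullet> x) - 1)) \<longlonglongrightarrow> 1"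
    by (intro Lim_transform_eventually[OF *[simplified]]) (auto simp: exp_inv_deriv_def elim!: eventually_mono)
  then show ?thesis unfolding cutoff_def using tendsto_of_real by fastforce
qed

lemma partial_deriv_cutoff_bound:
  assumes "norm x < 1" "b \<in> Basis"
  shows "norm (partial_deriv b (cutoff j) x) * (1 - x \<bullet> x) \<le> 6"
proof -
  let ?s = "(real j + 2) * (1 - x \<bullet> x) - 1"
  have t: "1 - x \<bullet> x > 0" using assms by (simp add: norm_lt_square)
  have "\<bar>x \<bullet> b\<bar> \<le> 1" using Basis_le_norm[OF assms(2), of x] assms(1) by simp
  have "norm (partial_deriv b (cutoff j) x) * (1 - x \<bullet> x) = 2 * \<bar>x \<bullet> b\<bar> * ((?s + 1) * exp_inv_deriv 1 ?s)"
    unfolding partial_deriv_cutoff norm_of_real using exp_inv_deriv_1_nonneg[of ?s] t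
    by (simp add: abs_mult)
  also have "\<dots> \<le> 2 * 1 * 3"
    using \<open>\<bar>x \<bullet> b\<bar> \<le> 1\<close> exp_inv_deriv_1_bound[of ?s] exp_inv_deriv_1_nonneg[of ?s] t
    by (intro mult_mono) auto
  finally show ?thesis by simp
qed

text \<open>For fixed x the argument s grows like N, so N exp (- 1 / s) / s^2 decays like 1 / N.
  This pointwise limit and the weighted bound before it are the two inputs of dominated
  convergence.\<close>

lemma partial_deriv_cutoff_tendsto_0:
  assumes "norm x < 1" shows "(\<lambda>j. partial_deriv b (cutoff j) x) \<longlonglongrightarrow> 0"
proof -
  let ?t = "1 - x \<bullet> x" let ?s = "\<lambda>j. (real j + 2) * ?t - 1"
  have t: "?t > 0" using assms by (simp add: norm_lt_square)
  have lim: "filterlim ?s at_top sequentially" using scaled_gap_at_top[OF t] .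
  then have "filterlim ?s at_infinity sequentially" by (rule filterlim_at_top_imp_at_infinity)
  then have inv: "(\<lambda>j. 1 / ?s j) \<longlonglongrightarrow> 0" by (intro tendsto_divide_0[OF tendsto_const])
  \<comment> \<open>Since N t = s + 1, the quotient N / s^2 equals (1 / s + 1 / s^2) / t, an
    expression in 1 / s alone.\<close>
  have "(\<lambda>j. (- 2 * (x \<bullet> b) / ?t) * ((1 / ?s j + (1 / ?s j)\<^sup>2) * exp (- (1 / ?s j)))) \<longlonglongrightarrow>
      (- 2 * (x \<bullet> b) / ?t) * ((0 + 0\<^sup>2) * exp (- 0))"
    by (intro tendsto_intros inv)
  then have *: "(\<lambda>j. (- 2 * (x \<bullet> b) / ?t) * ((1 / ?s j + (1 / ?s j)\<^sup>2) * exp (- (1 / ?s j)))) \<longlonglongrightarrow> 0" by simp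
  have "\<forall>\<^sub>F j in sequentially. ?s j > 0" using lim unfolding filterlim_at_top_dense by blast
  then have "(\<lambda>j. - 2 * (real j + 2) * (x \<bullet> b) * exp_inv_deriv 1 (?s j)) \<longlonglongrightarrow> 0"
  proof (intro Lim_transform_eventually[OF *], elim eventually_mono)
    fix j assume s: "?s j > 0"
    have "(- 2 * c / t) * ((1 / s + (1 / s)\<^sup>2) * e) = - 2 * N * c * (e / s\<^sup>2)"
      if "s > 0" "t > 0" "N * t = s + 1" for c t s e N :: real
    proof -
      have "1 / s + (1 / s)\<^sup>2 = N * t / s\<^sup>2"
        using that by (simp add: field_simps power2_eq_square)
      then have "(- 2 * c / t) * ((1 / s + (1 / s)\<^sup>2) * e) = (- 2 * c / t) * (N * t / s\<^sup>2 * e)" by simp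
      then show ?thesis using \<open>t > 0\<close> by simp
    qed
    note scaled = this[OF s t]
    show "(- 2 * (x \<bullet> b) / ?t) * ((1 / ?s j + (1 / ?s j)\<^sup>2) * exp (- (1 / ?s j))) =
        - 2 * (real j + 2) * (x \<bullet> b) * exp_inv_deriv 1 (?s j)"
      unfolding exp_inv_deriv_1[OF s] by (rule scaled) simp
  qed
  then show ?thesis unfolding partial_deriv_cutoff using tendsto_of_real by fastforce
qed

section \<open>Test functions and the integrals of their derivatives\<close>

lemma test_functions_smooth: "\<phi> \<in> test_functions D \<Longrightarrow> \<phi> \<in> smooth_functions"
  by (simp add: test_functions_def)

lemma test_function_mult:
  assumes "f \<in> smooth_functions" "\<phi> \<in> test_functions D"
  shows "(\<lambda>x. f x * \<phi> x) \<in> test_functions D"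
proof -
  have "closure {x. f x * \<phi> x \<noteq> 0} \<subseteq> closure {x. \<phi> x \<noteq> 0}" by (intro closure_mono) auto
  moreover from this have "compact (closure {x. f x * \<phi> x \<noteq> 0})"
    using assms(2) unfolding test_functions_def
    by (metis (no_types, lifting) closed_closure closed_Int_compact inf.absorb1 mem_Collect_eq)
  ultimately show ?thesis using assms by (auto simp: test_functions_def intro: smooth_mult)
qed

lemma partial_deriv_outside_support:
  assumes "x \<notin> closure {x. \<phi> x \<noteq> 0}" shows "partial_deriv b \<phi> x = 0"
proof -
  have "(\<phi> has_derivative (\<lambda>h. 0)) (at x)"
    by (rule has_derivative_transform_within_open[of "\<lambda>x. 0" _ x UNIV "- closure {x. \<phi> x \<noteq> 0}"])
      (use assms closure_subset[of "{x. \<phi> x \<noteq> 0}"] in \<open>auto\<close>)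
  from partial_deriv_eqI[OF this] show ?thesis .
qed

lemma test_function_partial_deriv:
  assumes "\<phi> \<in> test_functions D" "b \<in> Basis"
  shows "partial_deriv b \<phi> \<in> test_functions D"
proof -
  have "closure {x. partial_deriv b \<phi> x \<noteq> 0} \<subseteq> closure {x. \<phi> x \<noteq> 0}"
    using partial_deriv_outside_support by (intro closure_minimal) auto
  moreover from this have "compact (closure {x. partial_deriv b \<phi> x \<noteq> 0})"
    using assms(1) unfolding test_functions_def
    by (metis (no_types, lifting) closed_closure closed_Int_compact inf.absorb1 mem_Collect_eq)
  ultimately show ?thesis using assms by (auto simp: test_functions_def intro: smooth_partial_deriv)
qed

lemma cutoff_test_function: "cutoff j \<in> test_functions (ball 0 1)"
proof -
  let ?r = "sqrt (1 - 1 / (real j + 2))"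
  have "closure {x::'a. cutoff j x \<noteq> 0} \<subseteq> cball 0 ?r"
    using cutoff_support by (intro closure_minimal) auto
  moreover have "cball 0 ?r \<subseteq> ball (0::'a) 1"
  proof
    fix x :: 'a assume "x \<in> cball 0 ?r"
    moreover have "?r < 1" by simp
    ultimately have "norm x < 1" by (simp only: mem_cball dist_0_norm)
    then show "x \<in> ball 0 1" by simp
  qed
  moreover have "compact (closure {x::'a. cutoff j x \<noteq> 0})"
    using calculation(1) by (metis closed_closure closed_Int_compact compact_cball inf.absorb1)
  ultimately show ?thesis by (auto simp: test_functions_def cutoff_smooth)
qed

lemma has_vector_derivative_partial:
  assumes "f differentiable (at (x + s *\<^sub>R b))"
  shows "((\<lambda>s. f (x + s *\<^sub>R b)) has_vector_derivative partial_deriv b f (x + s *\<^sub>R b)) (at s)"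
proof -
  have "((\<lambda>s. x + s *\<^sub>R b) has_derivative (\<lambda>s. s *\<^sub>R b)) (at s)"
    by (auto intro!: derivative_eq_intros)
  from diff_chain_at[OF this, of f "frechet_derivative f (at (x + s *\<^sub>R b))"] assms
  have "((\<lambda>s. f (x + s *\<^sub>R b)) has_derivative (\<lambda>s'. frechet_derivative f (at (x + s *\<^sub>R b)) (s' *\<^sub>R b))) (at s)"
    by (simp add: frechet_derivative_works o_def)
  then show ?thesis unfolding has_vector_derivative_def partial_deriv_def
    using linear_frechet_derivative[OF assms] by (simp add: linear_cmul)
qed

lemma integrable_lborel_compact_support:
  fixes f :: "'a::euclidean_space \<Rightarrow> complex"
  assumes "continuous_on UNIV f" "compact K" "\<And>x. x \<notin> K \<Longrightarrow> f x = 0"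
  shows "integrable lborel f"
proof -
  have "integrable lborel (\<lambda>x. indicator K x *\<^sub>R f x)"
    using assms by (intro borel_integrable_compact continuous_on_subset[OF assms(1)]) auto
  moreover have "(\<lambda>x. indicator K x *\<^sub>R f x) = f" using assms(3) by (auto simp: indicator_def fun_eq_iff)
  ultimately show ?thesis by simp
qed

lemma bounded_compact_support:
  fixes f :: "'a::euclidean_space \<Rightarrow> complex"
  assumes "continuous_on UNIV f" "compact K" "\<And>x. x \<notin> K \<Longrightarrow> f x = 0"
  obtains B where "B \<ge> 0" "\<And>x. norm (f x) \<le> B"
proof -
  have "bounded (f ` K)"
    by (intro compact_imp_bounded compact_continuous_image continuous_on_subset[OF assms(1)] assms) auto
  then obtain B where "B > 0" "\<forall>x\<in>K. norm (f x) \<le> B" unfolding bounded_pos by auto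
  then have "norm (f x) \<le> B" for x using assms(3)[of x] by (cases "x \<in> K") auto
  then show thesis using that[of B] \<open>B > 0\<close> by simp
qed

lemma has_vector_derivative_imp_quotient_tendsto:
  fixes f :: "real \<Rightarrow> 'a::real_normed_vector"
  assumes "(f has_vector_derivative D) (at x)"
  shows "((\<lambda>h. (f (x + h) - f x) /\<^sub>R h) \<longlongrightarrow> D) (at 0)"
proof -
  have "((\<lambda>h. norm (f (x + h) - f x - h *\<^sub>R D) / norm h) \<longlongrightarrow> 0) (at 0)"
    using assms unfolding has_vector_derivative_def has_derivative_at by blast
  moreover have "\<forall>\<^sub>F h in at 0. norm (f (x + h) - f x - h *\<^sub>R D) / norm h = norm ((f (x + h) - f x) /\<^sub>R h - D)"
    unfolding eventually_at_filter
  proof (intro always_eventually allI impI)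
    fix h :: real assume "h \<noteq> 0"
    then have "(f (x + h) - f x) /\<^sub>R h - D = (f (x + h) - f x - h *\<^sub>R D) /\<^sub>R h"
      by (simp add: scaleR_diff_right)
    then show "norm (f (x + h) - f x - h *\<^sub>R D) / norm h = norm ((f (x + h) - f x) /\<^sub>R h - D)"
      by (simp add: divide_inverse mult.commute)
  qed
  ultimately have "((\<lambda>h. norm ((f (x + h) - f x) /\<^sub>R h - D)) \<longlongrightarrow> 0) (at 0)"
    by (rule Lim_transform_eventually)
  then show ?thesis by (simp add: Lim_null[of _ D] tendsto_norm_zero_iff)
qed

text \<open>The integral of a translate does not depend on the translation; differentiate under the integral sign.\<close>

lemma integral_partial_deriv_compact_support:
  fixes \<phi> :: "'a::euclidean_space \<Rightarrow> complex"
  assumes \<phi>: "\<phi> \<in> test_functions D" and b: "b \<in> Basis"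
  shows "(\<integral>x. partial_deriv b \<phi> x \<partial>lborel) = 0"
proof -
  define K where "K = closure {x. \<phi> x \<noteq> 0}"
  have K: "compact K" "\<And>x. x \<notin> K \<Longrightarrow> \<phi> x = 0"
    using \<phi> closure_subset[of "{x. \<phi> x \<noteq> 0}"] by (auto simp: test_functions_def K_def)
  have sm: "\<phi> \<in> smooth_functions" using \<phi> by (rule test_functions_smooth)
  have cont: "continuous_on UNIV \<phi>" using sm by (rule smooth_continuous)
  have cont': "continuous_on UNIV (partial_deriv b \<phi>)"
    by (intro smooth_continuous smooth_partial_deriv sm b)
  obtain B where B: "B \<ge> 0" "\<And>x. norm (partial_deriv b \<phi> x) \<le> B"
    using bounded_compact_support[OF cont' K(1)] partial_deriv_outside_support unfolding K_def by metis
  \<comment> \<open>Difference quotients with step at most 1 vanish outside this neighbourhood of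
    the support, so B times its indicator dominates all of them.\<close>
  define K' where "K' = {x + y |x y. x \<in> K \<and> y \<in> cball 0 1}"
  have K': "compact K'" unfolding K'_def using compact_sums[OF K(1) compact_cball[of 0 1]] by simp
  define t where "t j = 1 / real (Suc j)" for j
  have t: "t j > 0" "t j \<le> 1" for j by (auto simp: t_def)
  have tlim: "t \<longlonglongrightarrow> 0" unfolding t_def using LIMSEQ_Suc[OF lim_1_over_n] by simp
  define q where "q j x = (\<phi> (x + t j *\<^sub>R b) - \<phi> x) /\<^sub>R t j" for j x
  have int\<phi>: "integrable lborel \<phi>" by (rule integrable_lborel_compact_support[OF cont K])
  have shift: "integrable lborel (\<lambda>x. \<phi> (x + c))" "(\<integral>x. \<phi> (x + c) \<partial>lborel) = (\<integral>x. \<phi> x \<partial>lborel)" for c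
  proof -
    have [measurable]: "\<phi> \<in> borel_measurable borel" using cont by (rule borel_measurable_continuous_onI)
    have d: "distr lborel borel ((+) c) = lborel" by (rule lborel_distr_plus)
    have "integrable (distr lborel borel ((+) c)) \<phi>" using int\<phi> d by simp
    then have "integrable lborel (\<lambda>x. \<phi> (c + x))" by (subst (asm) integrable_distr_eq) auto
    then show "integrable lborel (\<lambda>x. \<phi> (x + c))" by (simp add: add.commute)
    have "(\<integral>x. \<phi> x \<partial>distr lborel borel ((+) c)) = (\<integral>x. \<phi> (c + x) \<partial>lborel)"
      by (subst integral_distr) auto
    then show "(\<integral>x. \<phi> (x + c) \<partial>lborel) = (\<integral>x. \<phi> x \<partial>lborel)" using d by (simp add: add.commute)
  qed
  have q0: "(\<integral>x. q j x \<partial>lborel) = 0" for j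
    unfolding q_def using shift[of "t j *\<^sub>R b"] int\<phi> by simp
  have vd: "((\<lambda>s. \<phi> (x + s *\<^sub>R b)) has_vector_derivative partial_deriv b \<phi> (x + s *\<^sub>R b)) (at s)" for x s
    by (intro has_vector_derivative_partial smooth_differentiable sm)
  have dom: "norm (q j x) \<le> B * indicator K' x" for j x
  proof (cases "x \<in> K'")
    case True
    have "norm (\<phi> (x + t j *\<^sub>R b) - \<phi> (x + 0 *\<^sub>R b)) \<le> B * t j - B * 0"
    proof (rule differentiable_bound_general[where f'="\<lambda>s. partial_deriv b \<phi> (x + s *\<^sub>R b)" and \<phi>'="\<lambda>s. B"])
      show "continuous_on {0..t j} (\<lambda>s. \<phi> (x + s *\<^sub>R b))"
        by (intro continuous_on_compose2[OF cont] continuous_intros) auto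
      show "((*) B has_vector_derivative B) (at s)" for s
        by (auto intro!: derivative_eq_intros simp: has_real_derivative_iff_has_vector_derivative[symmetric])
    qed (use t B vd in \<open>auto intro!: continuous_intros\<close>)
    then show ?thesis using True t[of j] by (simp add: q_def divide_simps)
  next
    case False
    have "x \<notin> K"
    proof
      assume "x \<in> K"
      then have "x + 0 \<in> K'" unfolding K'_def by fastforce
      with False show False by simp
    qed
    moreover have "x + t j *\<^sub>R b \<notin> K"
    proof
      assume a: "x + t j *\<^sub>R b \<in> K"
      have "- t j *\<^sub>R b \<in> cball 0 1" using t[of j] b by simp
      with a have "(x + t j *\<^sub>R b) + (- t j *\<^sub>R b) \<in> K'" unfolding K'_def by blast
      with False show False by simp
    qed
    ultimately show ?thesis using False K by (simp add: q_def)
  qed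
  have lim: "(\<lambda>j. q j x) \<longlonglongrightarrow> partial_deriv b \<phi> x" for x
  proof -
    have "((\<lambda>h. (\<phi> (x + (0 + h) *\<^sub>R b) - \<phi> (x + 0 *\<^sub>R b)) /\<^sub>R h) \<longlongrightarrow> partial_deriv b \<phi> (x + 0 *\<^sub>R b)) (at 0)"
      by (rule has_vector_derivative_imp_quotient_tendsto[OF vd])
    moreover have "filterlim t (at 0) sequentially"
      unfolding filterlim_at using tlim t by (auto simp: less_imp_neq[symmetric])
    ultimately show ?thesis unfolding q_def using filterlim_compose by force
  qed
  have "(\<lambda>j. \<integral>x. q j x \<partial>lborel) \<longlonglongrightarrow> (\<integral>x. partial_deriv b \<phi> x \<partial>lborel)"
  proof (rule integral_dominated_convergence[where w="\<lambda>x. B * indicator K' x"])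
    show "partial_deriv b \<phi> \<in> borel_measurable lborel"
      using borel_measurable_continuous_onI[OF cont'] by simp
    show "q j \<in> borel_measurable lborel" for j
      unfolding q_def using shift(1)[THEN borel_measurable_integrable] int\<phi>[THEN borel_measurable_integrable]
      by (intro borel_measurable_scaleR borel_measurable_diff) auto
    show "integrable lborel (\<lambda>x. B * indicator K' x)"
      using K' by (intro integrable_mult_right integrable_real_indicator)
        (use emeasure_bounded_finite[OF compact_imp_bounded[OF K']] in \<open>auto simp: compact_imp_closed\<close>)
  qed (use lim dom in auto)
  then show ?thesis using q0 LIMSEQ_unique[OF _ tendsto_const] by fastforce
qed

lemma integral_lebesgue_on_eq_lborel:
  fixes f :: "'a::euclidean_space \<Rightarrow> complex"
  assumes "f \<in> borel_measurable borel" "D \<in> sets lebesgue" "\<And>x. x \<notin> D \<Longrightarrow> f x = 0"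
  shows "(\<integral>x. f x \<partial>lebesgue_on D) = (\<integral>x. f x \<partial>lborel)"
proof -
  have "(\<integral>x. f x \<partial>lebesgue_on D) = (\<integral>x. indicator D x *\<^sub>R f x \<partial>lebesgue)"
    using assms by (subst integral_restrict_space) auto
  also have "(\<lambda>x. indicator D x *\<^sub>R f x) = f" using assms(3) by (auto simp: indicator_def fun_eq_iff)
  also have "(\<integral>x. f x \<partial>lebesgue) = (\<integral>x. f x \<partial>lborel)"
    using assms by (intro integral_completion) auto
  finally show ?thesis .
qed

lemma integral_partial_deriv_test_function:
  fixes \<phi> :: "'a::euclidean_space \<Rightarrow> complex"
  assumes \<phi>: "\<phi> \<in> test_functions D" and b: "b \<in> Basis" and D: "D \<in> sets lebesgue"
  shows "(\<integral>x. partial_deriv b \<phi> x \<partial>lebesgue_on D) = 0"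
proof -
  have "partial_deriv b \<phi> \<in> borel_measurable borel"
    using test_function_partial_deriv[OF \<phi> b] test_functions_smooth smooth_continuous
    by (blast intro: borel_measurable_continuous_onI)
  moreover have "partial_deriv b \<phi> x = 0" if "x \<notin> D" for x
    using partial_deriv_outside_support[of x \<phi> b] \<phi> that by (auto simp: test_functions_def)
  ultimately show ?thesis
    using integral_lebesgue_on_eq_lborel[of "partial_deriv b \<phi>" D] D
      integral_partial_deriv_compact_support[OF \<phi> b] by simp
qed

section \<open>Weak derivatives on the unit ball\<close>

lemma L2_space_bounded:
  assumes "finite_measure M" "f \<in> borel_measurable M" "AE x in M. norm (f x) \<le> B"
  shows "f \<in> L2_space M"
proof -
  interpret finite_measure M by fact
  have [measurable]: "f \<in> borel_measurable M" by fact
  have "integrable M (\<lambda>x. (cmod (f x))\<^sup>2)"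
    by (rule integrable_const_bound[where B="B\<^sup>2"])
      (use assms(3) in \<open>auto elim!: eventually_mono intro!: power_mono\<close>)
  then show ?thesis using assms by (simp add: L2_space_def)
qed

lemma L2_space_mult_integrable:
  assumes "f \<in> L2_space M" "g \<in> L2_space M"
  shows "integrable M (\<lambda>x. f x * g x)"
proof (rule Bochner_Integration.integrable_bound[where f="\<lambda>x. (cmod (f x))\<^sup>2 + (cmod (g x))\<^sup>2"])
  show "AE x in M. norm (f x * g x) \<le> norm ((cmod (f x))\<^sup>2 + (cmod (g x))\<^sup>2)"
  proof (rule AE_I2)
    fix x
    have "0 \<le> (cmod (f x) - cmod (g x))\<^sup>2" "0 \<le> cmod (f x) * cmod (g x)" by auto
    then have "cmod (f x) * cmod (g x) \<le> (cmod (f x))\<^sup>2 + (cmod (g x))\<^sup>2"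
      unfolding power2_diff by linarith
    then show "norm (f x * g x) \<le> norm ((cmod (f x))\<^sup>2 + (cmod (g x))\<^sup>2)"
      by (simp add: norm_mult)
  qed
qed (use assms in \<open>auto simp: L2_space_def\<close>)

lemma L2_space_diff:
  assumes "f \<in> L2_space M" "g \<in> L2_space M"
  shows "(\<lambda>x. f x - g x) \<in> L2_space M"
proof -
  have "integrable M (\<lambda>x. (cmod (f x - g x))\<^sup>2)"
  proof (rule Bochner_Integration.integrable_bound[where f="\<lambda>x. 2 * (cmod (f x))\<^sup>2 + 2 * (cmod (g x))\<^sup>2"])
    show "AE x in M. norm ((cmod (f x - g x))\<^sup>2) \<le> norm (2 * (cmod (f x))\<^sup>2 + 2 * (cmod (g x))\<^sup>2)"
    proof (rule AE_I2)
      fix x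
      have "(cmod (f x - g x))\<^sup>2 \<le> (cmod (f x) + cmod (g x))\<^sup>2"
        by (intro power_mono norm_triangle_ineq4) auto
      also have "\<dots> \<le> 2 * (cmod (f x))\<^sup>2 + 2 * (cmod (g x))\<^sup>2"
        using zero_le_power2[of "cmod (f x) - cmod (g x)"] unfolding power2_diff power2_sum by linarith
      finally show "norm ((cmod (f x - g x))\<^sup>2) \<le> norm (2 * (cmod (f x))\<^sup>2 + 2 * (cmod (g x))\<^sup>2)" by simp
    qed
  qed (use assms in \<open>auto simp: L2_space_def\<close>)
  then show ?thesis using assms by (auto simp: L2_space_def)
qed

text \<open>Weak convergence from strong convergence. In place of Cauchy-Schwarz, the pointwise
  inequality |W| |F - f| \<le> d |W|^2 + |F - f|^2 / d is integrated: a small d handles the first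
  term for all j at once, and then a large j handles the second.\<close>

lemma L2_tendsto_integral_mult:
  assumes F: "L2_tendsto M F f" and W: "W \<in> L2_space M"
  shows "(\<lambda>j. \<integral>x. W x * F j x \<partial>M) \<longlonglongrightarrow> (\<integral>x. W x * f x \<partial>M)"
proof (rule tendstoI)
  fix e :: real assume e: "e > 0"
  define S where "S = (\<integral>x. (cmod (W x))\<^sup>2 \<partial>M)"
  \<comment> \<open>Chosen so that d S < e / 2; the added 1 guards against S = 0.\<close>
  define d where "d = e / (2 * (S + 1))"
  have S: "S \<ge> 0" unfolding S_def by simp
  have d: "d > 0" using e S by (simp add: d_def)
  have dS: "d * S < e / 2" using e S by (simp add: d_def field_simps)
  have L2: "F j \<in> L2_space M" "f \<in> L2_space M" for j using F by (auto simp: L2_tendsto_def)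
  have "\<forall>\<^sub>F j in sequentially. (\<integral>x. (cmod (F j x - f x))\<^sup>2 \<partial>M) < d * (e / 2)"
    using F d e by (intro order_tendstoD(2)[where y=0]) (auto simp: L2_tendsto_def)
  then show "\<forall>\<^sub>F j in sequentially. dist (\<integral>x. W x * F j x \<partial>M) (\<integral>x. W x * f x \<partial>M) < e"
  proof (rule eventually_mono)
    fix j assume j: "(\<integral>x. (cmod (F j x - f x))\<^sup>2 \<partial>M) < d * (e / 2)"
    have g: "(\<lambda>x. F j x - f x) \<in> L2_space M" using L2 by (intro L2_space_diff) auto
    have i1: "integrable M (\<lambda>x. (cmod (W x))\<^sup>2)" "integrable M (\<lambda>x. (cmod (F j x - f x))\<^sup>2)"
      using W g by (auto simp: L2_space_def)
    have "(\<integral>x. W x * F j x \<partial>M) - (\<integral>x. W x * f x \<partial>M) = (\<integral>x. W x * (F j x - f x) \<partial>M)"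
      using L2_space_mult_integrable[OF W L2(1)] L2_space_mult_integrable[OF W L2(2)]
      by (simp add: right_diff_distrib)
    also have "cmod \<dots> \<le> (\<integral>x. cmod (W x * (F j x - f x)) \<partial>M)" by (rule integral_norm_bound)
    also have "\<dots> \<le> (\<integral>x. d * (cmod (W x))\<^sup>2 + (cmod (F j x - f x))\<^sup>2 / d \<partial>M)"
    proof (rule integral_mono)
      show "integrable M (\<lambda>x. cmod (W x * (F j x - f x)))"
        using L2_space_mult_integrable[OF W g] by (rule integrable_norm)
      show "integrable M (\<lambda>x. d * (cmod (W x))\<^sup>2 + (cmod (F j x - f x))\<^sup>2 / d)" using i1 by auto
      fix x
      have "a * c \<le> d * a\<^sup>2 + c\<^sup>2 / d" if "a \<ge> 0" "c \<ge> 0" for a c :: real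
      proof -
        have "0 \<le> (d * a - c)\<^sup>2 + d * a * c" using that d by auto
        then have "d * (a * c) \<le> d * (d * a\<^sup>2 + c\<^sup>2 / d)"
          using d by (simp add: power2_eq_square algebra_simps)
        then show ?thesis using d by simp
      qed
      then show "cmod (W x * (F j x - f x)) \<le> d * (cmod (W x))\<^sup>2 + (cmod (F j x - f x))\<^sup>2 / d"
        by (simp add: norm_mult)
    qed
    also have "\<dots> = d * S + (\<integral>x. (cmod (F j x - f x))\<^sup>2 \<partial>M) / d" using i1 by (simp add: S_def)
    also have "\<dots> < e / 2 + e / 2"
      using j d by (intro add_strict_mono dS) (simp add: pos_divide_less_eq mult.commute)
    finally show "dist (\<integral>x. W x * F j x \<partial>M) (\<integral>x. W x * f x \<partial>M) < e" by (simp add: dist_norm)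
  qed
qed

lemma L2_tendsto_dominated:
  assumes M: "finite_measure M" and meas: "\<And>j. F j \<in> borel_measurable M" "f \<in> borel_measurable M"
    and bound: "\<And>j x. x \<in> space M \<Longrightarrow> norm (F j x) \<le> B"
    and lim: "\<And>x. x \<in> space M \<Longrightarrow> (\<lambda>j. F j x) \<longlonglongrightarrow> f x"
  shows "L2_tendsto M F f"
proof -
  interpret finite_measure M by fact
  have fB: "norm (f x) \<le> B" if "x \<in> space M" for x
    using Lim_bounded[OF tendsto_norm[OF lim[OF that]], of 0 B] bound[OF that] by blast
  have "(\<lambda>j. \<integral>x. (cmod (F j x - f x))\<^sup>2 \<partial>M) \<longlonglongrightarrow> (\<integral>x. 0 \<partial>M)"
  proof (rule integral_dominated_convergence[where w="\<lambda>x. (2 * B)\<^sup>2"])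
    show "AE x in M. (\<lambda>j. (cmod (F j x - f x))\<^sup>2) \<longlonglongrightarrow> 0"
    proof (rule AE_I2)
      fix x assume "x \<in> space M"
      then have "(\<lambda>j. (cmod (F j x - f x))\<^sup>2) \<longlonglongrightarrow> (cmod (f x - f x))\<^sup>2"
        by (intro tendsto_intros lim)
      then show "(\<lambda>j. (cmod (F j x - f x))\<^sup>2) \<longlonglongrightarrow> 0" by simp
    qed
    show "AE x in M. norm ((cmod (F j x - f x))\<^sup>2) \<le> (2 * B)\<^sup>2" for j
    proof (rule AE_I2)
      fix x assume x: "x \<in> space M"
      have "cmod (F j x - f x) \<le> 2 * B"
        using norm_triangle_ineq4[of "F j x" "f x"] bound[OF x, of j] fB[OF x] by linarith
      then show "norm ((cmod (F j x - f x))\<^sup>2) \<le> (2 * B)\<^sup>2" using power_mono[of _ "2 * B" 2] by simp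
    qed
  qed (use meas in auto)
  moreover have "F j \<in> L2_space M" for j
    using bound by (intro L2_space_bounded[OF M, where B=B] meas AE_I2)
  moreover have "f \<in> L2_space M"
    using fB by (intro L2_space_bounded[OF M, where B=B] meas AE_I2)
  ultimately show ?thesis by (simp add: L2_tendsto_def)
qed

lemma L2_tendsto_const: "f \<in> L2_space M \<Longrightarrow> L2_tendsto M (\<lambda>j. f) f"
  by (simp add: L2_tendsto_def)

section \<open>Smooth functions on the unit ball\<close>

abbreviation ball_measure :: "'a::euclidean_space measure" where
  "ball_measure \<equiv> lebesgue_on (ball 0 1)"

lemma finite_measure_ball: "finite_measure (ball_measure :: 'a::euclidean_space measure)"
  by (rule finite_measure_lebesgue_on) simp

lemma continuous_measurable_ball:
  fixes f :: "'a::euclidean_space \<Rightarrow> complex"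
  assumes "continuous_on UNIV f" shows "f \<in> borel_measurable ball_measure"
  by (rule continuous_imp_measurable_on_sets_lebesgue) (auto intro: continuous_on_subset[OF assms])

lemma continuous_bounded_ball:
  fixes f :: "'a::euclidean_space \<Rightarrow> complex"
  assumes "continuous_on UNIV f"
  obtains B where "B \<ge> 0" "\<And>x. norm x \<le> 1 \<Longrightarrow> norm (f x) \<le> B"
proof -
  have "bounded (f ` cball 0 1)"
    by (intro compact_imp_bounded compact_continuous_image continuous_on_subset[OF assms]) auto
  then obtain B where "B > 0" "\<forall>x\<in>cball 0 1. norm (f x) \<le> B" unfolding bounded_pos by auto
  then show thesis using that[of B] by simp
qed

lemma continuous_L2_ball:
  fixes f :: "'a::euclidean_space \<Rightarrow> complex"
  assumes "continuous_on UNIV f" shows "f \<in> L2_space ball_measure"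
proof -
  obtain B where "\<And>x. norm x \<le> 1 \<Longrightarrow> norm (f x) \<le> B" using continuous_bounded_ball[OF assms] by metis
  then show ?thesis
    by (intro L2_space_bounded[where B=B] finite_measure_ball continuous_measurable_ball assms) auto
qed

lemma smooth_L2_ball: "f \<in> smooth_functions \<Longrightarrow> f \<in> L2_space ball_measure"
  by (intro continuous_L2_ball smooth_continuous)

lemma integral_by_parts_test_function:
  fixes f :: "'a::euclidean_space \<Rightarrow> complex"
  assumes f: "f \<in> smooth_functions" and \<phi>: "\<phi> \<in> test_functions (ball 0 1)" and b: "b \<in> Basis"
  shows "(\<integral>x. f x * partial_deriv b \<phi> x \<partial>ball_measure) = - (\<integral>x. partial_deriv b f x * \<phi> x \<partial>ball_measure)"
proof -
  have \<phi>': "\<phi> \<in> smooth_functions" using \<phi> by (rule test_functions_smooth)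
  have eq: "partial_deriv b (\<lambda>x. f x * \<phi> x) = (\<lambda>x. f x * partial_deriv b \<phi> x + partial_deriv b f x * \<phi> x)"
    using f \<phi>' by (intro ext partial_deriv_mult smooth_differentiable)
  have "integrable ball_measure (\<lambda>x. f x * partial_deriv b \<phi> x)"
    "integrable ball_measure (\<lambda>x. partial_deriv b f x * \<phi> x)"
    using L2_space_mult_integrable smooth_L2_ball smooth_partial_deriv f \<phi>' b by blast+
  moreover have "(\<integral>x. partial_deriv b (\<lambda>x. f x * \<phi> x) x \<partial>ball_measure) = 0"
    by (intro integral_partial_deriv_test_function test_function_mult f \<phi> b) simp
  ultimately show ?thesis by (simp add: eq eq_neg_iff_add_eq_0)
qed

lemma has_weak_partial_smooth:
  "f \<in> smooth_functions \<Longrightarrow> b \<in> Basis \<Longrightarrow> has_weak_partial (ball 0 1) b f (partial_deriv b f)"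
  by (auto simp: has_weak_partial_def intro: smooth_L2_ball smooth_partial_deriv integral_by_parts_test_function)

lemma smooth_sum: "(\<And>i. i \<in> I \<Longrightarrow> f i \<in> smooth_functions) \<Longrightarrow> (\<lambda>x. \<Sum>i\<in>I. f i x) \<in> smooth_functions"
  by (induction I rule: infinite_finite_induct) (auto intro: smooth_const smooth_add)

lemma smooth_laplacian: "f \<in> smooth_functions \<Longrightarrow> laplacian f \<in> smooth_functions"
  unfolding laplacian_def[abs_def] by (intro smooth_sum smooth_partial_deriv)

lemma has_weak_laplacian_smooth:
  fixes f :: "'a::euclidean_space \<Rightarrow> complex"
  assumes f: "f \<in> smooth_functions"
  shows "has_weak_laplacian (ball 0 1) f (laplacian f)"
  unfolding has_weak_laplacian_def
proof (intro conjI ballI smooth_L2_ball smooth_laplacian f)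
  fix \<phi> :: "'a \<Rightarrow> complex" assume \<phi>: "\<phi> \<in> test_functions (ball 0 1)"
  have \<phi>': "\<phi> \<in> smooth_functions" using \<phi> by (rule test_functions_smooth)
  have "(\<integral>x. f x * laplacian \<phi> x \<partial>ball_measure) =
      (\<Sum>b\<in>Basis. \<integral>x. f x * partial_deriv b (partial_deriv b \<phi>) x \<partial>ball_measure)"
    unfolding laplacian_def sum_distrib_left
    by (intro Bochner_Integration.integral_sum L2_space_mult_integrable smooth_L2_ball smooth_partial_deriv f \<phi>')
  also have "\<dots> = (\<Sum>b\<in>Basis. \<integral>x. partial_deriv b (partial_deriv b f) x * \<phi> x \<partial>ball_measure)"
    using f \<phi> by (intro sum.cong refl)
      (simp add: integral_by_parts_test_function test_function_partial_deriv smooth_partial_deriv)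
  also have "\<dots> = (\<integral>x. laplacian f x * \<phi> x \<partial>ball_measure)"
    unfolding laplacian_def sum_distrib_right
    by (intro Bochner_Integration.integral_sum[symmetric] L2_space_mult_integrable smooth_L2_ball smooth_partial_deriv f \<phi>')
  finally show "(\<integral>x. f x * laplacian \<phi> x \<partial>ball_measure) = (\<integral>x. laplacian f x * \<phi> x \<partial>ball_measure)" .
qed

lemma L2_tendsto_cutoff:
  fixes W :: "'a::euclidean_space \<Rightarrow> complex"
  assumes W: "W \<in> smooth_functions"
  shows "L2_tendsto ball_measure (\<lambda>j x. W x * cutoff j x) W"
proof -
  obtain B where B: "B \<ge> 0" "\<And>x. norm x \<le> 1 \<Longrightarrow> norm (W x) \<le> B"
    using continuous_bounded_ball[OF smooth_continuous[OF W]] by metis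
  show ?thesis
  proof (rule L2_tendsto_dominated[where B=B])
    show "norm (W x * cutoff j x) \<le> B" if "x \<in> space ball_measure" for j and x :: 'a
      using mult_mono[of "norm (W x)" B "norm (cutoff j x)" 1] B that norm_cutoff_le_1[of j x]
      by (simp add: norm_mult)
    show "(\<lambda>j. W x * cutoff j x) \<longlonglongrightarrow> W x" if "x \<in> space ball_measure" for x :: 'a
      using tendsto_mult[OF tendsto_const cutoff_tendsto_1[of x], of "W x"] that by simp
  qed (intro finite_measure_ball continuous_measurable_ball smooth_continuous smooth_mult W cutoff_smooth)+
qed

text \<open>This stands in for the uniqueness of weak derivatives. Two of them are never shown to
  agree almost everywhere, only to have the same integral against any smooth W; the truncations W
  \<open>cutoff j\<close> are test functions and converge to W in \<open>L2_space\<close>.\<close>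

lemma test_function_eq_imp_smooth_eq:
  fixes p q W :: "'a::euclidean_space \<Rightarrow> complex"
  assumes "p \<in> L2_space ball_measure" "q \<in> L2_space ball_measure"
    and eq: "\<And>\<phi>. \<phi> \<in> test_functions (ball 0 1) \<Longrightarrow>
      (\<integral>x. p x * \<phi> x \<partial>ball_measure) = (\<integral>x. q x * \<phi> x \<partial>ball_measure)"
    and W: "W \<in> smooth_functions"
  shows "(\<integral>x. p x * W x \<partial>ball_measure) = (\<integral>x. q x * W x \<partial>ball_measure)"
proof -
  have "(\<lambda>j. \<integral>x. p x * (W x * cutoff j x) \<partial>ball_measure) \<longlonglongrightarrow> (\<integral>x. p x * W x \<partial>ball_measure)"
    "(\<lambda>j. \<integral>x. q x * (W x * cutoff j x) \<partial>ball_measure) \<longlonglongrightarrow> (\<integral>x. q x * W x \<partial>ball_measure)"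
    by (intro L2_tendsto_integral_mult L2_tendsto_cutoff W assms)+
  moreover have "(\<integral>x. p x * (W x * cutoff j x) \<partial>ball_measure) = (\<integral>x. q x * (W x * cutoff j x) \<partial>ball_measure)" for j
    by (intro eq test_function_mult W cutoff_test_function)
  ultimately show ?thesis using LIMSEQ_unique by simp
qed

lemma smooth_H2: "f \<in> smooth_functions \<Longrightarrow> f \<in> H2_space (ball 0 1)"
  unfolding H2_space_def H1_space_def
  using has_weak_partial_smooth smooth_partial_deriv smooth_L2_ball by blast

text \<open>The truncations u \<open>cutoff j\<close> serve as approximating test functions. The
  dangerous part of their gradient is u times the gradient of the cutoff, which blows up near the
  sphere; the linear vanishing of u compensates this exactly, leaving the bound 6 C, and the term
  tends to 0 pointwise.\<close>

lemma smooth_H10: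
  fixes u :: "'a::euclidean_space \<Rightarrow> complex"
  assumes u: "u \<in> smooth_functions" and C: "\<And>x. norm x < 1 \<Longrightarrow> norm (u x) \<le> C * (1 - x \<bullet> x)"
  shows "u \<in> H10_space (ball 0 1)"
proof -
  have "L2_tendsto ball_measure (\<lambda>j. partial_deriv b (\<lambda>x. u x * cutoff j x)) (partial_deriv b u)"
    if b: "b \<in> Basis" for b
  proof -
    have eq: "partial_deriv b (\<lambda>x. u x * cutoff j x) =
        (\<lambda>x. u x * partial_deriv b (cutoff j) x + partial_deriv b u x * cutoff j x)" for j
      using u by (intro ext partial_deriv_mult smooth_differentiable cutoff_smooth)
    obtain B where B: "B \<ge> 0" "\<And>x. norm x \<le> 1 \<Longrightarrow> norm (partial_deriv b u x) \<le> B"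
      using continuous_bounded_ball[OF smooth_continuous[OF smooth_partial_deriv[OF u b]]] by metis
    have C0: "C \<ge> 0" using C[of 0] norm_ge_zero[of "u 0"] by (simp del: norm_ge_zero)
    show ?thesis unfolding eq
    proof (rule L2_tendsto_dominated[where B="C * 6 + B"])
      fix j and x :: 'a assume "x \<in> space ball_measure"
      then have x: "norm x < 1" by simp
      have "norm (u x * partial_deriv b (cutoff j) x) \<le> C * (1 - x \<bullet> x) * norm (partial_deriv b (cutoff j) x)"
        unfolding norm_mult by (intro mult_right_mono C x) simp
      also have "\<dots> \<le> C * 6"
        using mult_left_mono[OF partial_deriv_cutoff_bound[OF x b, of j] C0] by (simp add: mult_ac)
      finally have "norm (u x * partial_deriv b (cutoff j) x) \<le> C * 6" .
      moreover have "norm (partial_deriv b u x * cutoff j x) \<le> B"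
        using mult_mono[of "norm (partial_deriv b u x)" B "norm (cutoff j x)" 1] B x norm_cutoff_le_1[of j x]
        by (simp add: norm_mult)
      ultimately show "norm (u x * partial_deriv b (cutoff j) x + partial_deriv b u x * cutoff j x) \<le> C * 6 + B"
        by (rule norm_triangle_mono)
    next
      fix x :: 'a assume "x \<in> space ball_measure"
      then have x: "norm x < 1" by simp
      have "(\<lambda>j. u x * partial_deriv b (cutoff j) x + partial_deriv b u x * cutoff j x) \<longlonglongrightarrow>
          u x * 0 + partial_deriv b u x * 1"
        by (intro tendsto_intros partial_deriv_cutoff_tendsto_0 cutoff_tendsto_1 x)
      then show "(\<lambda>j. u x * partial_deriv b (cutoff j) x + partial_deriv b u x * cutoff j x) \<longlonglongrightarrow>
          partial_deriv b u x" by simp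
    qed (intro finite_measure_ball continuous_measurable_ball smooth_continuous smooth_add smooth_mult
        smooth_partial_deriv u cutoff_smooth b)+
  qed
  then have "H1_tendsto (ball 0 1) (\<lambda>j x. u x * cutoff j x) u"
    unfolding H1_tendsto_def using has_weak_partial_smooth[OF u] L2_tendsto_cutoff[OF u] by blast
  moreover have "(\<lambda>x. u x * cutoff j x) \<in> test_functions (ball 0 1)" for j
    by (intro test_function_mult u cutoff_test_function)
  ultimately show ?thesis
    unfolding H10_space_def by (intro CollectI exI[of _ "\<lambda>j x. u x * cutoff j x"]) auto
qed

section \<open>The divergence theorem on the unit disk\<close>

lemma vector_2_eq_axis: "vector [a, b] = (a *\<^sub>R axis 1 1 + b *\<^sub>R axis 2 1 :: real^2)"
  by (simp add: vec_eq_iff forall_2 axis_def)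

lemma Basis_real_2: "(Basis :: (real^2) set) = {axis 1 1, axis 2 1}"
  by (auto simp: Basis_vec_def UNIV_2)

text \<open>Leaving the order of the coordinates open lets a single slicing argument treat both
  partial derivatives.\<close>

lemma lborel_real_2:
  fixes i j :: 2 assumes ij: "i \<noteq> j"
  shows "(lborel :: (real^2) measure) = distr lborel borel (\<lambda>p::real\<times>real. fst p *\<^sub>R axis i 1 + snd p *\<^sub>R axis j 1)"
    (is "_ = distr _ _ ?v")
proof (rule lborel_eqI)
  have [measurable]: "?v \<in> borel_measurable borel"
    by (intro borel_measurable_continuous_onI continuous_intros)
  have univ: "k = i \<or> k = j" for k :: 2 using ij exhaust_2[of i] exhaust_2[of j] exhaust_2[of k] by auto
  have B: "Basis = {axis i 1, axis j 1 :: real^2}"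
    using univ unfolding Basis_vec_def by (auto, metis)
  have ne: "axis i 1 \<noteq> (axis j 1 :: real^2)" using ij by (simp add: axis_eq_axis)
  fix l u :: "real^2" assume "\<And>b. b \<in> Basis \<Longrightarrow> l \<bullet> b \<le> u \<bullet> b"
  from this[of "axis i 1"] this[of "axis j 1"]
  have le: "l $ i \<le> u $ i" "l $ j \<le> u $ j" by (simp_all add: inner_axis)
  have "?v -` box l u = box (l $ i, l $ j) (u $ i, u $ j)"
    using ij by (auto simp: box_def B Basis_prod_def inner_axis[of l] inner_axis[of u] inner_axis_axis inner_add_left)
  then have "emeasure (distr lborel borel ?v) (box l u) = emeasure lborel (box (l $ i, l $ j) (u $ i, u $ j))"
    by (subst emeasure_distr) auto
  also have "\<dots> = (\<Prod>b\<in>Basis. ((u $ i, u $ j) - (l $ i, l $ j)) \<bullet> b)"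
    using le by (intro emeasure_lborel_box) (auto simp: Basis_prod_def)
  also have "(\<Prod>b\<in>Basis. ((u $ i, u $ j) - (l $ i, l $ j)) \<bullet> b) = (u $ i - l $ i) * (u $ j - l $ j)"
    by (simp add: Basis_prod_def)
  also have "\<dots> = (\<Prod>b\<in>Basis. (u - l) \<bullet> b)" using ne by (simp add: B inner_axis)
  finally show "emeasure (distr lborel borel ?v) (box l u) = (\<Prod>b\<in>Basis. (u - l) \<bullet> b)" .
qed simp

text \<open>Fubini with the chords of the disk as inner domains: each inner integral is a difference
  of boundary values by the fundamental theorem, and y = sin t turns the remaining integral over y
  into one over the half circle, with cos t as the component of the normal.\<close>

lemma integral_disk_slices:
  fixes P Q :: "real \<Rightarrow> real \<Rightarrow> complex"
  assumes P: "continuous_on UNIV (\<lambda>p. P (fst p) (snd p))"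
    and Q: "continuous_on UNIV (\<lambda>p. Q (fst p) (snd p))"
    and deriv: "\<And>x y. ((\<lambda>x. P x y) has_vector_derivative Q x y) (at x)"
  shows "(\<integral>p. indicator {p. (fst p)\<^sup>2 + (snd p)\<^sup>2 < 1} p *\<^sub>R Q (fst p) (snd p) \<partial>lborel) =
    integral {-(pi/2)..pi/2} (\<lambda>t. cos t *\<^sub>R (P (cos t) (sin t) - P (- cos t) (sin t)))"
proof -
  define D :: "(real \<times> real) set" where "D = {p. (fst p)\<^sup>2 + (snd p)\<^sup>2 < 1}"
  have "open D" unfolding D_def by (intro open_Collect_less continuous_intros)
  then have [measurable]: "D \<in> sets borel" by simp
  \<comment> \<open>Integrability over the open disk is inherited from this compact square, on which
    Q is continuous.\<close>
  define K :: "(real \<times> real) set" where "K = cbox (-1,-1) (1,1)"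
  have "p \<in> K" if "p \<in> D" for p
  proof -
    have "(fst p)\<^sup>2 \<le> 1 \<and> (snd p)\<^sup>2 \<le> 1"
      using that zero_le_power2[of "fst p"] zero_le_power2[of "snd p"] unfolding D_def mem_Collect_eq by linarith
    then have "\<bar>fst p\<bar> \<le> 1" "\<bar>snd p\<bar> \<le> 1" by (simp_all add: abs_square_le_1)
    then show ?thesis unfolding K_def cbox_Pair_eq by (cases p) auto
  qed
  then have ind: "indicator D p *\<^sub>R (indicator K p *\<^sub>R Q (fst p) (snd p)) = indicator D p *\<^sub>R Q (fst p) (snd p)" for p
    by (auto simp: indicator_def)
  have "integrable lborel (\<lambda>p. indicator K p *\<^sub>R Q (fst p) (snd p))"
    unfolding K_def by (intro borel_integrable_compact compact_cbox continuous_on_subset[OF Q]) auto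
  then have int: "integrable lborel (\<lambda>p. indicator D p *\<^sub>R Q (fst p) (snd p))"
    using integrable_mult_indicator[of D lborel "\<lambda>p. indicator K p *\<^sub>R Q (fst p) (snd p)"]
    unfolding ind by simp
  have comp: "continuous_on UNIV (\<lambda>x. R (g x) (h x))"
    if "continuous_on UNIV (\<lambda>p. R (fst p) (snd p))" "continuous_on UNIV g" "continuous_on UNIV h"
    for R :: "real \<Rightarrow> real \<Rightarrow> complex" and g h :: "real \<Rightarrow> real"
    using continuous_on_compose2[OF that(1) continuous_on_Pair[OF that(2,3)]] by simp
  \<comment> \<open>As \<open>sqrt\<close> is defined and continuous on all reals, f is continuous
    everywhere; its values for |y| > 1 are cut off by the indicator.\<close>
  define f where "f y = P (sqrt (1 - y\<^sup>2)) y - P (- sqrt (1 - y\<^sup>2)) y" for y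
  have contf: "continuous_on UNIV f"
    unfolding f_def by (intro continuous_intros comp[OF P])
  have inner: "(\<integral>x. indicator D (x, y) *\<^sub>R Q x y \<partial>lborel) = indicator {-1..1} y *\<^sub>R f y" for y
  proof (cases "\<bar>y\<bar> \<le> 1")
    case True
    define s where "s = sqrt (1 - y\<^sup>2)"
    have y2: "y\<^sup>2 \<le> 1" using True by (simp add: abs_square_le_1)
    then have s: "s \<ge> 0" "s\<^sup>2 = 1 - y\<^sup>2" by (auto simp: s_def)
    have contQ: "continuous_on UNIV (\<lambda>x. Q x y)"
      by (intro comp[OF Q] continuous_intros)
    have ftc: "(\<integral>x. indicator {-s..s} x *\<^sub>R Q x y \<partial>lborel) = P s y - P (- s) y"
    proof (rule integral_FTC_Icc)
      show "((\<lambda>x. P x y) has_vector_derivative Q x y) (at x within {-s..s})" for x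
        by (rule has_vector_derivative_at_within[OF deriv])
      show "continuous_on {-s..s} (\<lambda>x. Q x y)" by (rule continuous_on_subset[OF contQ]) simp
    qed (use s(1) in simp)
    have [measurable]: "(\<lambda>x. Q x y) \<in> borel_measurable borel"
      using contQ by (rule borel_measurable_continuous_onI)
    have [measurable]: "(\<lambda>x. (x, y)) \<in> borel_measurable borel"
      by (intro borel_measurable_continuous_onI continuous_intros)
    have "(\<integral>x. indicator D (x, y) *\<^sub>R Q x y \<partial>lborel) = (\<integral>x. indicator {-s..s} x *\<^sub>R Q x y \<partial>lborel)"
    proof (rule integral_cong_AE)
      have "AE x in lborel. x \<noteq> s \<and> x \<noteq> - s"
        using AE_lborel_singleton[of s] AE_lborel_singleton[of "-s"] by (auto elim: eventually_elim2)
      then show "AE x in lborel. indicator D (x, y) *\<^sub>R Q x y = indicator {-s..s} x *\<^sub>R Q x y"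
      proof (rule eventually_mono)
        fix x assume x: "x \<noteq> s \<and> x \<noteq> - s"
        have "(x, y) \<in> D \<longleftrightarrow> x\<^sup>2 < s\<^sup>2" by (auto simp: D_def s)
        also have "\<dots> \<longleftrightarrow> \<bar>x\<bar> < s"
          using s(1) abs_le_square_iff[of s x] by (simp add: linorder_not_le[symmetric])
        finally have "(x, y) \<in> D \<longleftrightarrow> x \<in> {-s..s}" using x by auto
        then show "indicator D (x, y) *\<^sub>R Q x y = indicator {-s..s} x *\<^sub>R Q x y" by (simp add: indicator_def)
      qed
    qed simp_all
    then show ?thesis using True ftc by (auto simp: f_def s_def indicator_def abs_le_iff)
  next
    case False
    then have "1 < y\<^sup>2" using abs_square_le_1[of y] by linarith
    then have "(x, y) \<notin> D" for x
      using add_strict_increasing2[of "x\<^sup>2" 1 "y\<^sup>2"] by (simp add: D_def)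
    then show ?thesis using False by (auto simp: indicator_def)
  qed
  have "(\<integral>p. indicator D p *\<^sub>R Q (fst p) (snd p) \<partial>lborel) =
      (\<integral>p. (case p of (x, y) \<Rightarrow> indicator D (x, y) *\<^sub>R Q x y) \<partial>(lborel \<Otimes>\<^sub>M lborel))"
    unfolding lborel_prod by (simp add: case_prod_beta)
  also have "\<dots> = (\<integral>y. (\<integral>x. indicator D (x, y) *\<^sub>R Q x y \<partial>lborel) \<partial>lborel)"
    using int unfolding lborel_prod[symmetric]
    by (intro lborel_pair.integral_snd[symmetric]) (simp only: case_prod_beta' prod.collapse)
  also have "\<dots> = (\<integral>y. indicator {-1..1} y *\<^sub>R f y \<partial>lborel)" unfolding inner ..
  also have "\<dots> = integral {-1..1} f"
    using set_borel_integral_eq_integral(2)[OF borel_integrable_atLeastAtMost'[OF continuous_on_subset[OF contf]]]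
    by (auto simp: set_lebesgue_integral_def)
  also have "\<dots> = integral {sin (-(pi/2))..sin (pi/2)} f" by simp
  also have "\<dots> = integral {-(pi/2)..pi/2} (\<lambda>t. cos t *\<^sub>R f (sin t))"
    by (rule integral_unique[symmetric], rule has_integral_substitution[where c="-1" and d=1])
      (auto intro!: derivative_eq_intros continuous_on_subset[OF contf])
  also have "\<dots> = integral {-(pi/2)..pi/2} (\<lambda>t. cos t *\<^sub>R (P (cos t) (sin t) - P (- cos t) (sin t)))"
  proof (rule Henstock_Kurzweil_Integration.integral_cong)
    fix t assume t: "t \<in> {-(pi/2)..pi/2}"
    then have "cos t \<ge> 0" by (intro cos_ge_zero) auto
    then have "sqrt (1 - (sin t)\<^sup>2) = cos t" by (simp add: cos_squared_eq[symmetric] )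
    then show "cos t *\<^sub>R f (sin t) = cos t *\<^sub>R (P (cos t) (sin t) - P (- cos t) (sin t))" by (simp add: f_def)
  qed
  finally show ?thesis by (simp add: D_def)
qed

lemma integral_periodic_shift:
  fixes G :: "real \<Rightarrow> complex"
  assumes G: "continuous_on UNIV G" and per: "\<And>t. G (t + 2 * pi) = G t" and a: "0 \<le> a" "a \<le> 2 * pi"
  shows "integral {-a..2 * pi - a} G = integral {0..2 * pi} G"
proof -
  have int: "G integrable_on {c..d}" for c d
    by (intro integrable_continuous_real continuous_on_subset[OF G]) auto
  have "integral {-a..0} G = integral {2 * pi - a..2 * pi} G"
    using integral_shift_real_ivl[of "2 * pi - a" "2 * pi" "2 * pi" G] per by simp
  moreover have "integral {-a..0} G + integral {0..2 * pi - a} G = integral {-a..2 * pi - a} G"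
    using a by (intro Henstock_Kurzweil_Integration.integral_combine int) auto
  moreover have "integral {0..2 * pi - a} G + integral {2 * pi - a..2 * pi} G = integral {0..2 * pi} G"
    using a by (intro Henstock_Kurzweil_Integration.integral_combine int) auto
  ultimately show ?thesis by (simp add: add.commute)
qed

lemma integral_reflect_shift:
  fixes G :: "real \<Rightarrow> complex"
  shows "integral {a..b} (\<lambda>t. G (c - t)) = integral {c - b..c - a} G"
proof -
  have "integral {a..b} (\<lambda>t. G (c - t)) = integral {-b..-a} (\<lambda>t. G (t + c))"
    using Henstock_Kurzweil_Integration.integral_reflect_real[of "-a" "-b" "\<lambda>t. G (t + c)"] by simp
  also have "\<dots> = integral {c - b..c - a} G"
    using integral_shift_real_ivl[of "c - b" c "c - a" G] by simp
  finally show ?thesis .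
qed

abbreviation circle_point :: "real \<Rightarrow> real^2" where
  "circle_point t \<equiv> vector [cos t, sin t]"

lemma continuous_circle_point: "continuous_on S circle_point"
  unfolding vector_2_eq_axis by (intro continuous_intros)

lemma circle_point_measurable [measurable]:
  "circle_point \<in> borel_measurable (restrict_space lborel {0..2*pi})"
  by (intro measurable_restrict_space1) (simp add: borel_measurable_continuous_onI continuous_circle_point)

lemma norm_circle_point: "norm (circle_point t) = 1"
  by (simp add: norm_vec_def L2_set_def sum_2)

lemma integral_circle_measure:
  fixes f :: "real^2 \<Rightarrow> complex"
  assumes f: "continuous_on UNIV f"
  shows "(\<integral>x. f x \<partial>circle_measure) = integral {0..2*pi} (\<lambda>t. f (circle_point t))"
proof -
  have [measurable]: "f \<in> borel_measurable borel" using f by (rule borel_measurable_continuous_onI)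
  have c: "continuous_on {0..2*pi} (\<lambda>t. f (circle_point t))"
    by (rule continuous_on_compose2[OF f continuous_circle_point]) auto
  have "(\<integral>x. f x \<partial>circle_measure) = (\<integral>t. f (circle_point t) \<partial>restrict_space lborel {0..2*pi})"
    unfolding circle_measure_def by (rule integral_distr) auto
  also have "\<dots> = (\<integral>t. indicator {0..2*pi} t *\<^sub>R f (circle_point t) \<partial>lborel)"
    by (rule integral_restrict_space) auto
  also have "\<dots> = integral {0..2*pi} (\<lambda>t. f (circle_point t))"
    using set_borel_integral_eq_integral(2)[OF borel_integrable_atLeastAtMost'[OF c]]
    by (simp add: set_lebesgue_integral_def)
  finally show ?thesis .
qed

lemma divergence_theorem_axis:
  fixes F :: "real^2 \<Rightarrow> complex" and i j :: 2
  assumes F: "F \<in> smooth_functions" and ij: "i \<noteq> j"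
  shows "(\<integral>x. partial_deriv (axis i 1) F x \<partial>ball_measure) =
    integral {-(pi/2)..pi/2} (\<lambda>t. cos t *\<^sub>R (F (cos t *\<^sub>R axis i 1 + sin t *\<^sub>R axis j 1) -
       F (- cos t *\<^sub>R axis i 1 + sin t *\<^sub>R axis j 1)))"
proof -
  let ?v = "\<lambda>p::real\<times>real. fst p *\<^sub>R axis i 1 + snd p *\<^sub>R axis j 1 :: real^2"
  let ?g = "partial_deriv (axis i 1) F"
  have contg: "continuous_on UNIV ?g" by (intro smooth_continuous smooth_partial_deriv F) simp
  have contF: "continuous_on UNIV F" by (intro smooth_continuous F)
  have [measurable]: "?g \<in> borel_measurable borel" using contg by (rule borel_measurable_continuous_onI)
  have [measurable]: "?v \<in> borel_measurable borel"
    by (intro borel_measurable_continuous_onI continuous_intros)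
  have nv: "?v p \<in> ball 0 1 \<longleftrightarrow> (fst p)\<^sup>2 + (snd p)\<^sup>2 < 1" for p
    using ij by (simp add: norm_eq_sqrt_inner inner_add_left inner_add_right inner_axis_axis power2_eq_square)
  have meas: "(\<lambda>x. indicator (ball 0 1) x *\<^sub>R ?g x) \<in> borel_measurable borel"
    by (intro borel_measurable_scaleR borel_measurable_indicator) simp_all
  have "(\<integral>x. ?g x \<partial>ball_measure) = (\<integral>x. indicator (ball 0 1) x *\<^sub>R ?g x \<partial>lebesgue)"
    by (rule integral_restrict_space) simp
  also have "\<dots> = (\<integral>x. indicator (ball 0 1) x *\<^sub>R ?g x \<partial>lborel)"
    using meas by (intro integral_completion) simp
  also have "\<dots> = (\<integral>p. indicator (ball 0 1) (?v p) *\<^sub>R ?g (?v p) \<partial>lborel)"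
    unfolding lborel_real_2[OF ij] using meas by (intro integral_distr) simp_all
  also have "\<dots> = (\<integral>p. indicator {p. (fst p)\<^sup>2 + (snd p)\<^sup>2 < 1} p *\<^sub>R
      (\<lambda>x y. ?g (x *\<^sub>R axis i 1 + y *\<^sub>R axis j 1)) (fst p) (snd p) \<partial>lborel)"
    using nv by (intro Bochner_Integration.integral_cong) (auto simp: indicator_def)
  also have "\<dots> = integral {-(pi/2)..pi/2} (\<lambda>t. cos t *\<^sub>R
      ((\<lambda>x y. F (x *\<^sub>R axis i 1 + y *\<^sub>R axis j 1)) (cos t) (sin t) -
       (\<lambda>x y. F (x *\<^sub>R axis i 1 + y *\<^sub>R axis j 1)) (- cos t) (sin t)))"
  proof (rule integral_disk_slices)
    show "continuous_on UNIV (\<lambda>p. F (fst p *\<^sub>R axis i 1 + snd p *\<^sub>R axis j 1))"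
      by (rule continuous_on_compose2[OF contF]) (auto intro!: continuous_intros)
    show "continuous_on UNIV (\<lambda>p. ?g (fst p *\<^sub>R axis i 1 + snd p *\<^sub>R axis j 1))"
      by (rule continuous_on_compose2[OF contg]) (auto intro!: continuous_intros)
    show "((\<lambda>x. F (x *\<^sub>R axis i 1 + y *\<^sub>R axis j 1)) has_vector_derivative
        ?g (x *\<^sub>R axis i 1 + y *\<^sub>R axis j 1)) (at x)" for x y
      using has_vector_derivative_partial[OF smooth_differentiable[OF F], of "y *\<^sub>R axis j 1" "axis i 1" x]
      by (simp add: add.commute)
  qed
  finally show ?thesis by simp
qed

text \<open>The slice formula visits two opposite half circles, and the minus sign of the second is
  absorbed by its normal component. In terms of the angle they are t and \<pi> - t for the first
  axis, \<pi> / 2 - t and t - \<pi> / 2 for the second; each pair covers the circle once, up to a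
  shift by the period.\<close>

lemma divergence_theorem_disk:
  fixes F :: "real^2 \<Rightarrow> complex"
  assumes F: "F \<in> smooth_functions" and b: "b \<in> Basis"
  shows "(\<integral>x. partial_deriv b F x \<partial>ball_measure) = (\<integral>x. of_real (x \<bullet> b) * F x \<partial>circle_measure)"
proof -
  define G where "G t = of_real (circle_point t \<bullet> b) * F (circle_point t)" for t
  have contF: "continuous_on UNIV F" by (intro smooth_continuous F)
  have contG: "continuous_on S G" for S
    unfolding G_def
    by (intro continuous_intros continuous_circle_point continuous_on_compose2[OF contF continuous_circle_point]) auto
  have int: "G integrable_on {c..d}" for c d by (intro integrable_continuous_real contG)
  have per: "G (t + 2 * pi) = G t" for t by (simp add: G_def)
  have rhs: "(\<integral>x. of_real (x \<bullet> b) * F x \<partial>circle_measure) = integral {0..2*pi} G"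
    unfolding G_def by (intro integral_circle_measure continuous_intros contF)
  have contGr: "continuous_on S (\<lambda>t. G (c - t))" "continuous_on S (\<lambda>t. G (t + c))" for S c
    by (intro continuous_on_compose2[OF contG[of UNIV]] continuous_intros; simp)+
  have one_neq_two: "(1::2) \<noteq> 2" by simp
  have split: "c *\<^sub>R (A - B) = of_real c * A + of_real (- c) * B" for c :: real and A B :: complex
    by (simp add: scaleR_conv_of_real algebra_simps)
  consider "b = axis 1 1" | "b = axis 2 1" using b by (auto simp: Basis_real_2)
  then show ?thesis
  proof cases
    case 1
    have "(\<integral>x. partial_deriv b F x \<partial>ball_measure) = integral {-(pi/2)..pi/2} (\<lambda>t. G t + G (pi - t))"
      unfolding 1 divergence_theorem_axis[OF F one_neq_two]
    proof (intro Henstock_Kurzweil_Integration.integral_cong)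
      fix t
      have "circle_point t = cos t *\<^sub>R axis 1 1 + sin t *\<^sub>R axis 2 1"
        "circle_point (pi - t) = - cos t *\<^sub>R axis 1 1 + sin t *\<^sub>R axis 2 1"
        by (simp_all add: vector_2_eq_axis)
      moreover have "(cos t *\<^sub>R axis 1 1 + sin t *\<^sub>R axis 2 1 :: real^2) \<bullet> b = cos t"
        "(- cos t *\<^sub>R axis 1 1 + sin t *\<^sub>R axis 2 1 :: real^2) \<bullet> b = - cos t"
        by (simp_all add: 1 inner_axis_axis inner_add_left inner_diff_left)
      ultimately show "cos t *\<^sub>R (F (cos t *\<^sub>R axis 1 1 + sin t *\<^sub>R axis 2 1) - F (- cos t *\<^sub>R axis 1 1 + sin t *\<^sub>R axis 2 1))
          = G t + G (pi - t)"
        unfolding G_def split by (simp only:)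
    qed
    also have "\<dots> = integral {-(pi/2)..pi/2} G + integral {-(pi/2)..pi/2} (\<lambda>t. G (pi - t))"
      by (intro Henstock_Kurzweil_Integration.integral_add integrable_continuous_real contG contGr)
    also have "integral {-(pi/2)..pi/2} (\<lambda>t. G (pi - t)) = integral {pi/2..2*pi - pi/2} G"
      unfolding integral_reflect_shift by (simp add: field_simps)
    also have "integral {-(pi/2)..pi/2} G + integral {pi/2..2*pi - pi/2} G = integral {-(pi/2)..2*pi - pi/2} G"
      by (intro Henstock_Kurzweil_Integration.integral_combine int) (auto simp: field_simps)
    also have "\<dots> = integral {0..2*pi} G"
      by (intro integral_periodic_shift contG per) auto
    finally show ?thesis using rhs by simp
  next
    case 2
    have "(\<integral>x. partial_deriv b F x \<partial>ball_measure) = integral {-(pi/2)..pi/2} (\<lambda>t. G (pi/2 - t) + G (t + -(pi/2)))"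
      unfolding 2 divergence_theorem_axis[OF F one_neq_two[symmetric]]
    proof (intro Henstock_Kurzweil_Integration.integral_cong)
      fix t
      have "circle_point (pi/2 - t) = cos t *\<^sub>R axis 2 1 + sin t *\<^sub>R axis 1 1"
        "circle_point (t + -(pi/2)) = - cos t *\<^sub>R axis 2 1 + sin t *\<^sub>R axis 1 1"
        by (simp_all add: vector_2_eq_axis sin_diff cos_diff)
      moreover have "(cos t *\<^sub>R axis 2 1 + sin t *\<^sub>R axis 1 1 :: real^2) \<bullet> b = cos t"
        "(- cos t *\<^sub>R axis 2 1 + sin t *\<^sub>R axis 1 1 :: real^2) \<bullet> b = - cos t"
        by (simp_all add: 2 inner_axis_axis inner_add_left inner_diff_left)
      ultimately show "cos t *\<^sub>R (F (cos t *\<^sub>R axis 2 1 + sin t *\<^sub>R axis 1 1) - F (- cos t *\<^sub>R axis 2 1 + sin t *\<^sub>R axis 1 1))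
          = G (pi/2 - t) + G (t + -(pi/2))"
        unfolding G_def split by (simp only:)
    qed
    also have "\<dots> = integral {-(pi/2)..pi/2} (\<lambda>t. G (pi/2 - t)) + integral {-(pi/2)..pi/2} (\<lambda>t. G (t + -(pi/2)))"
      by (intro Henstock_Kurzweil_Integration.integral_add integrable_continuous_real contG contGr)
    also have "integral {-(pi/2)..pi/2} (\<lambda>t. G (pi/2 - t)) = integral {0..2*pi - pi} G"
      unfolding integral_reflect_shift by (simp add: field_simps)
    also have "integral {-(pi/2)..pi/2} (\<lambda>t. G (t + -(pi/2))) = integral {-pi..0} G"
      using integral_shift_real_ivl[of "-pi" "-(pi/2)" 0 G] by (simp add: field_simps)
    also have "integral {0..2*pi - pi} G + integral {-pi..0} G = integral {-pi..2*pi - pi} G"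
      using Henstock_Kurzweil_Integration.integral_combine[OF _ _ int, of "-pi" 0 "2*pi - pi"]
      by (simp add: add.commute)
    also have "\<dots> = integral {0..2*pi} G"
      by (intro integral_periodic_shift contG per) auto
    finally show ?thesis using rhs by simp
  qed
qed

section \<open>Traces and Green identities\<close>

lemma circle_measure_AE: "(AE x in circle_measure. norm x = 1)"
  unfolding circle_measure_def
  by (subst AE_distr_iff) (auto simp: norm_circle_point)

lemma finite_circle_measure: "finite_measure circle_measure"
proof -
  have "finite_measure (restrict_space lborel {0..2*pi})"
    by (rule finite_measureI) (simp add: emeasure_restrict_space space_restrict_space)
  then show ?thesis unfolding circle_measure_def
    by (rule finite_measure.finite_measure_distr) simp
qed

lemma sets_circle_measure [measurable_cong, simp]: "sets circle_measure = sets borel"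
  by (simp add: circle_measure_def)

lemma continuous_L2_circle:
  fixes f :: "real^2 \<Rightarrow> complex"
  assumes "continuous_on UNIV f" shows "f \<in> L2_space circle_measure"
proof -
  obtain B where B: "\<And>x. norm x \<le> 1 \<Longrightarrow> norm (f x) \<le> B" using continuous_bounded_ball[OF assms] by metis
  have "f \<in> borel_measurable circle_measure"
    using borel_measurable_continuous_onI[OF assms] by (simp cong: measurable_cong_sets)
  then show ?thesis
    using circle_measure_AE B
    by (intro L2_space_bounded[where B=B] finite_circle_measure) (auto elim!: eventually_mono)
qed

lemma smooth_L2_circle: "f \<in> smooth_functions \<Longrightarrow> f \<in> L2_space circle_measure"
  by (intro continuous_L2_circle smooth_continuous)

lemma smooth_has_trace:
  assumes "f \<in> smooth_functions"
  shows "has_trace (ball 0 1) circle_measure f f"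
proof -
  have "has_weak_partial (ball 0 1) b f (partial_deriv b f) \<and>
      L2_tendsto ball_measure (\<lambda>j. partial_deriv b f) (partial_deriv b f)" if "b \<in> Basis" for b
    using that assms by (intro conjI L2_tendsto_const smooth_L2_ball has_weak_partial_smooth smooth_partial_deriv)
  then show ?thesis
    unfolding has_trace_def H1_tendsto_def
    using L2_tendsto_const[OF smooth_L2_circle[OF assms]] L2_tendsto_const[OF smooth_L2_ball[OF assms]] assms
    by (intro exI[of _ "\<lambda>j. f"]) blast
qed

lemma smooth_has_normal_derivative:
  assumes u: "u \<in> smooth_functions" and g: "g \<in> L2_space circle_measure"
    and eq: "\<And>x. norm x = 1 \<Longrightarrow> g x = (\<Sum>b\<in>Basis. of_real (x \<bullet> b) * partial_deriv b u x)"
  shows "has_normal_derivative (ball 0 1) circle_normal circle_measure u g"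
  unfolding has_normal_derivative_def circle_normal_def
  using circle_measure_AE
  by (intro conjI g exI[of _ "\<lambda>b. partial_deriv b u"] ballI has_weak_partial_smooth u smooth_has_trace
      smooth_partial_deriv) (auto simp: eq elim!: eventually_mono)

lemma L2_space_sum:
  assumes "\<And>i. i \<in> I \<Longrightarrow> f i \<in> L2_space M"
  shows "(\<lambda>x. \<Sum>i\<in>I. f i x) \<in> L2_space M"
proof -
  have zero: "(\<lambda>x. 0) \<in> L2_space M" by (simp add: L2_space_def)
  have add: "(\<lambda>x. p x + q x) \<in> L2_space M" if "p \<in> L2_space M" "q \<in> L2_space M" for p q
    using L2_space_diff[OF that(1) L2_space_diff[OF zero that(2)]] by simp
  show ?thesis using assms
    by (induction I rule: infinite_finite_induct) (auto intro: zero add)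
qed

lemma has_weak_partial_L2:
  "has_weak_partial D b f g \<Longrightarrow> f \<in> L2_space (lebesgue_on D) \<and> g \<in> L2_space (lebesgue_on D)"
  by (simp add: has_weak_partial_def)

text \<open>No boundary term arises although W need not vanish on the sphere: \<psi> is a limit of
  test functions in the norm of H^1, and for these the identity is
  \<open>integral_by_parts_test_function\<close>.\<close>

lemma H10_integral_by_parts:
  fixes \<psi> :: "'a::euclidean_space \<Rightarrow> complex"
  assumes \<psi>: "\<psi> \<in> H10_space (ball 0 1)" and G: "has_weak_partial (ball 0 1) b \<psi> G"
    and b: "b \<in> Basis" and W: "W \<in> smooth_functions"
  shows "(\<integral>x. W x * G x \<partial>ball_measure) = - (\<integral>x. partial_deriv b W x * \<psi> x \<partial>ball_measure)"
proof -
  obtain \<Phi> g where \<Phi>: "\<And>j. \<Phi> j \<in> test_functions (ball 0 1)" "L2_tendsto ball_measure \<Phi> \<psi>"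
    and g: "has_weak_partial (ball 0 1) b \<psi> g" "L2_tendsto ball_measure (\<lambda>j. partial_deriv b (\<Phi> j)) g"
    using \<psi> b unfolding H10_space_def H1_tendsto_def by blast
  \<comment> \<open>The approximating sequence brings its own weak derivative g, which has to be
    exchanged for the prescribed G.\<close>
  have "(\<integral>x. G x * W x \<partial>ball_measure) = (\<integral>x. g x * W x \<partial>ball_measure)"
  proof (rule test_function_eq_imp_smooth_eq[OF _ _ _ W])
    show "(\<integral>x. G x * \<phi> x \<partial>ball_measure) = (\<integral>x. g x * \<phi> x \<partial>ball_measure)"
      if "\<phi> \<in> test_functions (ball 0 1)" for \<phi>
      using G g(1) that unfolding has_weak_partial_def by (metis add.inverse_inverse)
  qed (use has_weak_partial_L2[OF G] has_weak_partial_L2[OF g(1)] in auto)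
  then have eq: "(\<integral>x. W x * G x \<partial>ball_measure) = (\<integral>x. W x * g x \<partial>ball_measure)" by (simp add: mult.commute)
  have "(\<lambda>j. \<integral>x. W x * partial_deriv b (\<Phi> j) x \<partial>ball_measure) \<longlonglongrightarrow> (\<integral>x. W x * g x \<partial>ball_measure)"
    by (intro L2_tendsto_integral_mult g smooth_L2_ball W)
  moreover have "(\<integral>x. W x * partial_deriv b (\<Phi> j) x \<partial>ball_measure) =
      - (\<integral>x. partial_deriv b W x * \<Phi> j x \<partial>ball_measure)" for j
    by (intro integral_by_parts_test_function W \<Phi> b)
  moreover have "(\<lambda>j. - (\<integral>x. partial_deriv b W x * \<Phi> j x \<partial>ball_measure)) \<longlonglongrightarrow>
      - (\<integral>x. partial_deriv b W x * \<psi> x \<partial>ball_measure)"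
    by (intro tendsto_minus L2_tendsto_integral_mult \<Phi> smooth_L2_ball smooth_partial_deriv W b)
  ultimately show ?thesis using LIMSEQ_unique eq by simp
qed

text \<open>Both sides have the same integrals against test functions, by moving two derivatives
  onto them one at a time. Passing to W, which does not vanish on the sphere, needs
  \<open>test_function_eq_imp_smooth_eq\<close>.\<close>

lemma has_weak_laplacian_eq_sum:
  fixes \<psi> :: "'a::euclidean_space \<Rightarrow> complex"
  assumes L: "has_weak_laplacian (ball 0 1) \<psi> L"
    and G: "\<And>b. b \<in> Basis \<Longrightarrow> has_weak_partial (ball 0 1) b \<psi> (G b)"
    and GG: "\<And>b. b \<in> Basis \<Longrightarrow> has_weak_partial (ball 0 1) b (G b) (GG b)"
    and W: "W \<in> smooth_functions"
  shows "(\<integral>x. W x * L x \<partial>ball_measure) = (\<Sum>b\<in>Basis. \<integral>x. W x * GG b x \<partial>ball_measure)"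
proof -
  have L2: "\<psi> \<in> L2_space ball_measure" "L \<in> L2_space ball_measure" using L by (auto simp: has_weak_laplacian_def)
  have GG2: "GG b \<in> L2_space ball_measure" if "b \<in> Basis" for b using has_weak_partial_L2[OF GG[OF that]] by simp
  have "(\<integral>x. L x * W x \<partial>ball_measure) = (\<integral>x. (\<Sum>b\<in>Basis. GG b x) * W x \<partial>ball_measure)"
  proof (rule test_function_eq_imp_smooth_eq[OF L2(2) L2_space_sum[OF GG2] _ W])
    fix \<phi> :: "'a \<Rightarrow> complex" assume \<phi>: "\<phi> \<in> test_functions (ball 0 1)"
    have \<phi>': "\<phi> \<in> smooth_functions" using \<phi> by (rule test_functions_smooth)
    have "(\<integral>x. L x * \<phi> x \<partial>ball_measure) = (\<integral>x. \<psi> x * laplacian \<phi> x \<partial>ball_measure)"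
      using L \<phi> by (simp add: has_weak_laplacian_def)
    also have "\<dots> = (\<Sum>b\<in>Basis. \<integral>x. \<psi> x * partial_deriv b (partial_deriv b \<phi>) x \<partial>ball_measure)"
      unfolding laplacian_def sum_distrib_left
      by (intro Bochner_Integration.integral_sum L2_space_mult_integrable L2 smooth_L2_ball smooth_partial_deriv \<phi>')
    also have "\<dots> = (\<Sum>b\<in>Basis. \<integral>x. GG b x * \<phi> x \<partial>ball_measure)"
    proof (rule sum.cong[OF refl])
      fix b :: 'a assume b: "b \<in> Basis"
      show "(\<integral>x. \<psi> x * partial_deriv b (partial_deriv b \<phi>) x \<partial>ball_measure) = (\<integral>x. GG b x * \<phi> x \<partial>ball_measure)"
        using G[OF b] GG[OF b] \<phi> test_function_partial_deriv[OF \<phi> b] by (simp add: has_weak_partial_def)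
    qed
    also have "\<dots> = (\<integral>x. (\<Sum>b\<in>Basis. GG b x) * \<phi> x \<partial>ball_measure)"
      unfolding sum_distrib_right
      by (intro Bochner_Integration.integral_sum[symmetric] L2_space_mult_integrable smooth_L2_ball \<phi>' GG2)
    finally show "(\<integral>x. L x * \<phi> x \<partial>ball_measure) = (\<integral>x. (\<Sum>b\<in>Basis. GG b x) * \<phi> x \<partial>ball_measure)" .
  qed
  also have "\<dots> = (\<Sum>b\<in>Basis. \<integral>x. GG b x * W x \<partial>ball_measure)"
    unfolding sum_distrib_right
    by (intro Bochner_Integration.integral_sum L2_space_mult_integrable smooth_L2_ball W GG2)
  finally show ?thesis by (simp add: mult.commute)
qed

text \<open>For smooth approximants F of G this is the divergence theorem for V F. Convergence of F
  in H^1 handles the two interior integrals and convergence on the circle the boundary integral; GG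
  is the weak derivative that comes with the approximation.\<close>

lemma has_trace_green:
  fixes V :: "real^2 \<Rightarrow> complex"
  assumes T: "has_trace (ball 0 1) circle_measure G T" and b: "b \<in> Basis" and V: "V \<in> smooth_functions"
  obtains GG where "has_weak_partial (ball 0 1) b G GG" "T \<in> L2_space circle_measure"
    "(\<integral>x. V x * GG x \<partial>ball_measure) + (\<integral>x. partial_deriv b V x * G x \<partial>ball_measure) =
      (\<integral>x. of_real (x \<bullet> b) * V x * T x \<partial>circle_measure)"
proof -
  obtain F GG where F: "\<And>j. F j \<in> smooth_functions" "L2_tendsto ball_measure F G"
    and GG: "has_weak_partial (ball 0 1) b G GG" "L2_tendsto ball_measure (\<lambda>j. partial_deriv b (F j)) GG"
    and FT: "L2_tendsto circle_measure F T"
    using T b unfolding has_trace_def H1_tendsto_def by blast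
  have nu: "(\<lambda>x. of_real (x \<bullet> b) * V x) \<in> L2_space circle_measure"
    by (intro continuous_L2_circle continuous_intros smooth_continuous V)
  have "(\<lambda>j. (\<integral>x. V x * partial_deriv b (F j) x \<partial>ball_measure) + (\<integral>x. partial_deriv b V x * F j x \<partial>ball_measure)) \<longlonglongrightarrow>
      (\<integral>x. V x * GG x \<partial>ball_measure) + (\<integral>x. partial_deriv b V x * G x \<partial>ball_measure)"
    by (intro tendsto_add L2_tendsto_integral_mult GG F smooth_L2_ball smooth_partial_deriv V b)
  moreover have "(\<integral>x. V x * partial_deriv b (F j) x \<partial>ball_measure) + (\<integral>x. partial_deriv b V x * F j x \<partial>ball_measure)
      = (\<integral>x. of_real (x \<bullet> b) * V x * F j x \<partial>circle_measure)" for j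
  proof -
    have "(\<integral>x. V x * partial_deriv b (F j) x \<partial>ball_measure) + (\<integral>x. partial_deriv b V x * F j x \<partial>ball_measure)
        = (\<integral>x. V x * partial_deriv b (F j) x + partial_deriv b V x * F j x \<partial>ball_measure)"
      by (intro Bochner_Integration.integral_add[symmetric] L2_space_mult_integrable smooth_L2_ball
          smooth_partial_deriv V F b)
    also have "\<dots> = (\<integral>x. partial_deriv b (\<lambda>x. V x * F j x) x \<partial>ball_measure)"
      using V F by (simp add: partial_deriv_mult smooth_differentiable)
    also have "\<dots> = (\<integral>x. of_real (x \<bullet> b) * (V x * F j x) \<partial>circle_measure)"
      by (intro divergence_theorem_disk smooth_mult V F b)
    finally show ?thesis by (simp add: mult.assoc)
  qed
  moreover have "(\<lambda>j. \<integral>x. of_real (x \<bullet> b) * V x * F j x \<partial>circle_measure) \<longlonglongrightarrow>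
      (\<integral>x. of_real (x \<bullet> b) * V x * T x \<partial>circle_measure)"
    by (intro L2_tendsto_integral_mult FT nu)
  ultimately have "(\<integral>x. V x * GG x \<partial>ball_measure) + (\<integral>x. partial_deriv b V x * G x \<partial>ball_measure) =
      (\<integral>x. of_real (x \<bullet> b) * V x * T x \<partial>circle_measure)"
    using LIMSEQ_unique by simp
  moreover have "T \<in> L2_space circle_measure" using FT by (simp add: L2_tendsto_def)
  ultimately show thesis using that GG(1) by blast
qed

text \<open>Green's second identity with \<psi> merely in H^2 and H^1_0. Of the two boundary terms,
  the one with V and the normal derivative of \<psi> comes from \<open>has_trace_green\<close>
  applied to the components of the gradient of \<psi>; the one with \<psi> itself is absent by
  \<open>H10_integral_by_parts\<close>. The interior integrals of the products of gradients
  cancel.\<close>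

lemma smooth_has_dual_trace:
  fixes V :: "real^2 \<Rightarrow> complex"
  assumes V: "V \<in> smooth_functions"
  shows "has_dual_trace (ball 0 1) circle_normal circle_measure V V"
  unfolding has_dual_trace_def
proof (intro conjI exI[of _ "laplacian V"] ballI allI impI smooth_L2_circle has_weak_laplacian_smooth V)
  fix \<psi> L\<psi> h :: "real^2 \<Rightarrow> complex"
  assume \<psi>: "\<psi> \<in> H2_space (ball 0 1) \<inter> H10_space (ball 0 1)"
    and L: "has_weak_laplacian (ball 0 1) \<psi> L\<psi>"
    and h: "has_normal_derivative (ball 0 1) circle_normal circle_measure \<psi> h"
  obtain G T where G: "\<And>b. b \<in> Basis \<Longrightarrow> has_weak_partial (ball 0 1) b \<psi> (G b)"
    and T: "\<And>b. b \<in> Basis \<Longrightarrow> has_trace (ball 0 1) circle_measure (G b) (T b)"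
    and hT: "AE x in circle_measure. h x = (\<Sum>b\<in>Basis. of_real (x \<bullet> b) * T b x)"
    and h2: "h \<in> L2_space circle_measure"
    using h unfolding has_normal_derivative_def circle_normal_def by auto
  have "\<forall>b\<in>Basis. \<exists>GG. has_weak_partial (ball 0 1) b (G b) GG \<and> T b \<in> L2_space circle_measure \<and>
    (\<integral>x. V x * GG x \<partial>ball_measure) + (\<integral>x. partial_deriv b V x * G b x \<partial>ball_measure) =
      (\<integral>x. of_real (x \<bullet> b) * V x * T b x \<partial>circle_measure)"
  proof
    fix b :: "real^2" assume b: "b \<in> Basis"
    show "\<exists>GG. has_weak_partial (ball 0 1) b (G b) GG \<and> T b \<in> L2_space circle_measure \<and>
      (\<integral>x. V x * GG x \<partial>ball_measure) + (\<integral>x. partial_deriv b V x * G b x \<partial>ball_measure) =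
        (\<integral>x. of_real (x \<bullet> b) * V x * T b x \<partial>circle_measure)"
      by (rule has_trace_green[OF T[OF b] b V]) blast
  qed
  from bchoice[OF this] obtain GG where GG: "\<And>b. b \<in> Basis \<Longrightarrow> has_weak_partial (ball 0 1) b (G b) (GG b)"
    and T2: "\<And>b. b \<in> Basis \<Longrightarrow> T b \<in> L2_space circle_measure"
    and green: "\<And>b. b \<in> Basis \<Longrightarrow>
      (\<integral>x. V x * GG b x \<partial>ball_measure) + (\<integral>x. partial_deriv b V x * G b x \<partial>ball_measure) =
      (\<integral>x. of_real (x \<bullet> b) * V x * T b x \<partial>circle_measure)"
    by blast
  have L2: "\<psi> \<in> L2_space ball_measure" "L\<psi> \<in> L2_space ball_measure" using L by (auto simp: has_weak_laplacian_def)
  have "(\<integral>x. V x * L\<psi> x - \<psi> x * laplacian V x \<partial>ball_measure) =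
      (\<integral>x. V x * L\<psi> x \<partial>ball_measure) - (\<integral>x. \<psi> x * laplacian V x \<partial>ball_measure)"
    by (intro Bochner_Integration.integral_diff L2_space_mult_integrable smooth_L2_ball smooth_laplacian V L2)
  also have "(\<integral>x. \<psi> x * laplacian V x \<partial>ball_measure) =
      (\<Sum>b\<in>Basis. \<integral>x. \<psi> x * partial_deriv b (partial_deriv b V) x \<partial>ball_measure)"
    unfolding laplacian_def sum_distrib_left
    by (intro Bochner_Integration.integral_sum L2_space_mult_integrable L2 smooth_L2_ball smooth_partial_deriv V)
  also have "\<dots> = (\<Sum>b\<in>Basis. - (\<integral>x. partial_deriv b V x * G b x \<partial>ball_measure))"
  proof (rule sum.cong[OF refl])
    fix b :: "real^2" assume b: "b \<in> Basis"
    show "(\<integral>x. \<psi> x * partial_deriv b (partial_deriv b V) x \<partial>ball_measure) = - (\<integral>x. partial_deriv b V x * G b x \<partial>ball_measure)"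
      using H10_integral_by_parts[OF _ G[OF b] b smooth_partial_deriv[OF V b]] \<psi> by (simp add: mult.commute)
  qed
  also have "(\<integral>x. V x * L\<psi> x \<partial>ball_measure) = (\<Sum>b\<in>Basis. \<integral>x. V x * GG b x \<partial>ball_measure)"
    by (rule has_weak_laplacian_eq_sum[OF L G GG V])
  also have "(\<Sum>b\<in>Basis. \<integral>x. V x * GG b x \<partial>ball_measure) -
      (\<Sum>b\<in>Basis. - (\<integral>x. partial_deriv b V x * G b x \<partial>ball_measure)) =
      (\<Sum>b\<in>Basis. \<integral>x. of_real (x \<bullet> b) * V x * T b x \<partial>circle_measure)"
    by (simp add: green sum_subtractf[symmetric])
  also have "\<dots> = (\<integral>x. (\<Sum>b\<in>Basis. of_real (x \<bullet> b) * V x * T b x) \<partial>circle_measure)"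
    by (intro Bochner_Integration.integral_sum[symmetric] L2_space_mult_integrable T2 continuous_L2_circle
        continuous_intros smooth_continuous V)
  also have "\<dots> = (\<integral>x. V x * h x \<partial>circle_measure)"
  proof (rule integral_cong_AE)
    have Vm: "(\<lambda>x. of_real (x \<bullet> b) * V x) \<in> borel_measurable circle_measure" for b
      using continuous_L2_circle[of "\<lambda>x. of_real (x \<bullet> b) * V x"] smooth_continuous[OF V]
      by (simp add: L2_space_def continuous_intros)
    show "(\<lambda>x. \<Sum>b\<in>Basis. of_real (x \<bullet> b) * V x * T b x) \<in> borel_measurable circle_measure"
      using T2 by (intro borel_measurable_sum borel_measurable_times Vm) (auto simp: L2_space_def)
    show "(\<lambda>x. V x * h x) \<in> borel_measurable circle_measure"
      using h2 smooth_L2_circle[OF V] by (intro borel_measurable_times) (auto simp: L2_space_def)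
    show "AE x in circle_measure. (\<Sum>b\<in>Basis. of_real (x \<bullet> b) * V x * T b x) = V x * h x"
      using hT by (rule eventually_mono) (simp add: sum_distrib_left mult_ac)
  qed
  finally show "(\<integral>x. V x * L\<psi> x - \<psi> x * laplacian V x \<partial>ball_measure) = (\<integral>x. V x * h x \<partial>circle_measure)" .
qed

section \<open>The Bessel function of order zero\<close>

text \<open>\<open>J\<^sub>0(z) = bessel_E (z\<^sup>2)\<close>, so that \<open>bessel_E (k\<^sup>2 |x|\<^sup>2)\<close> is visibly smooth at the origin.\<close>

definition bessel_coeff :: "nat \<Rightarrow> real" where
  "bessel_coeff i = (- 1 / 4) ^ i / (fact i)\<^sup>2"

definition bessel_E :: "complex \<Rightarrow> complex" where
  "bessel_E z = (\<Sum>i. of_real (bessel_coeff i) * z ^ i)"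

definition bessel_E' :: "complex \<Rightarrow> complex" where
  "bessel_E' z = (\<Sum>i. of_real (diffs bessel_coeff i) * z ^ i)"

definition bessel_E'' :: "complex \<Rightarrow> complex" where
  "bessel_E'' z = (\<Sum>i. of_real (diffs (diffs bessel_coeff) i) * z ^ i)"

lemma summable_bessel: "summable (\<lambda>i. complex_of_real (bessel_coeff i) * z ^ i)"
proof (rule summable_comparison_test'[where N=0])
  show "summable (\<lambda>i. norm z ^ i / fact i)"
    using summable_exp[of "norm z"] by (simp add: divide_inverse mult.commute)
  fix i :: nat
  have "\<bar>bessel_coeff i\<bar> = (1 / 4) ^ i / (fact i)\<^sup>2"
    by (simp add: bessel_coeff_def power_abs abs_divide)
  also have "\<dots> \<le> 1 / (fact i)\<^sup>2"
    by (intro divide_right_mono power_le_one) auto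
  also have "\<dots> \<le> 1 / fact i"
    using self_le_power[of "fact i :: real" 2] fact_ge_1[of i] by (intro divide_left_mono) auto
  finally have "\<bar>bessel_coeff i\<bar> * norm z ^ i \<le> 1 / fact i * norm z ^ i"
    by (intro mult_right_mono) auto
  then show "norm (complex_of_real (bessel_coeff i) * z ^ i) \<le> norm z ^ i / fact i"
    by (simp add: norm_mult norm_power)
qed

lemma bessel_E_deriv: "(bessel_E has_field_derivative bessel_E' z) (at z)"
proof -
  have "((\<lambda>z. \<Sum>i. complex_of_real (bessel_coeff i) * z ^ i) has_field_derivative
      (\<Sum>i. diffs (\<lambda>i. complex_of_real (bessel_coeff i)) i * z ^ i)) (at z)"
    by (rule termdiffs_strong_converges_everywhere[OF summable_bessel])
  then show ?thesis by (simp add: bessel_E_def[abs_def] bessel_E'_def diffs_of_real)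
qed

lemma summable_bessel': "summable (\<lambda>i. complex_of_real (diffs bessel_coeff i) * z ^ i)"
  using termdiff_converges_all[OF summable_bessel, of z] by (simp add: diffs_of_real)

lemma summable_bessel'': "summable (\<lambda>i. complex_of_real (diffs (diffs bessel_coeff) i) * z ^ i)"
  using termdiff_converges_all[OF summable_bessel', of z] by (simp add: diffs_of_real)

lemma bessel_E'_deriv: "(bessel_E' has_field_derivative bessel_E'' z) (at z)"
proof -
  have "((\<lambda>z. \<Sum>i. complex_of_real (diffs bessel_coeff i) * z ^ i) has_field_derivative
      (\<Sum>i. diffs (\<lambda>i. complex_of_real (diffs bessel_coeff i)) i * z ^ i)) (at z)"
    by (rule termdiffs_strong_converges_everywhere[OF summable_bessel'])
  then show ?thesis by (simp add: bessel_E'_def[abs_def] bessel_E''_def diffs_of_real)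
qed

lemma bessel_coeff_Suc: "bessel_coeff (Suc i) * (real (Suc i))\<^sup>2 = - bessel_coeff i / 4"
proof -
  have "bessel_coeff (Suc i) = (- 1 / 4) * (- 1 / 4) ^ i / ((real (Suc i))\<^sup>2 * (fact i)\<^sup>2)"
    by (simp add: bessel_coeff_def power_mult_distrib)
  then show ?thesis by (simp add: bessel_coeff_def)
qed

text \<open>Bessel's equation of order zero in the variable z^2. On coefficients it is the two-term
  recursion \<open>bessel_coeff_Suc\<close>.\<close>

lemma bessel_E_ode: "z * bessel_E'' z + bessel_E' z + bessel_E z / 4 = 0"
proof -
  let ?A = "\<lambda>i. real i * diffs bessel_coeff i"
  let ?f = "\<lambda>i. complex_of_real (?A i) * z ^ i"
  have shift: "complex_of_real (diffs (diffs bessel_coeff) i) * z ^ i * z = ?f (Suc i)" for i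
    by (simp add: diffs_def)
  have "(\<lambda>i. complex_of_real (diffs (diffs bessel_coeff) i) * z ^ i * z) sums (bessel_E'' z * z)"
    unfolding bessel_E''_def by (intro sums_mult2 summable_sums summable_bessel'')
  then have "(\<lambda>i. ?f (Suc i)) sums (bessel_E'' z * z)" by (simp only: shift)
  then have "?f sums (bessel_E'' z * z)" by (subst (asm) sums_Suc_iff) simp
  moreover have "(\<lambda>i. complex_of_real (diffs bessel_coeff i) * z ^ i) sums bessel_E' z"
    unfolding bessel_E'_def by (intro summable_sums summable_bessel')
  moreover have "(\<lambda>i. complex_of_real (bessel_coeff i) * z ^ i / 4) sums (bessel_E z / 4)"
    unfolding bessel_E_def by (intro sums_divide summable_sums summable_bessel)
  ultimately have "(\<lambda>i. ?f i + complex_of_real (diffs bessel_coeff i) * z ^ i +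
      complex_of_real (bessel_coeff i) * z ^ i / 4) sums (bessel_E'' z * z + bessel_E' z + bessel_E z / 4)"
    by (intro sums_add)
  moreover have "?f i + complex_of_real (diffs bessel_coeff i) * z ^ i +
      complex_of_real (bessel_coeff i) * z ^ i / 4 = 0" for i
  proof -
    have "?A i + diffs bessel_coeff i + bessel_coeff i / 4 = 0"
      using bessel_coeff_Suc[of i] by (simp add: diffs_def power2_eq_square algebra_simps)
    then have "complex_of_real (?A i + diffs bessel_coeff i + bessel_coeff i / 4) * z ^ i = 0" by simp
    then show ?thesis by (simp add: algebra_simps)
  qed
  ultimately have "bessel_E'' z * z + bessel_E' z + bessel_E z / 4 = 0"
    using sums_unique2[OF _ sums_zero] by simp
  then show ?thesis by (simp add: mult.commute)
qed

lemma bessel_E_0: "bessel_E 0 = 1"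
  unfolding bessel_E_def by (subst powser_zero) (simp add: bessel_coeff_def)

lemma bessel_E_Reals: "bessel_E (of_real x) \<in> \<real>" "bessel_E' (of_real x) \<in> \<real>"
proof -
  have real: "(\<Sum>i. complex_of_real (c i) * of_real x ^ i) \<in> \<real>"
    if "summable (\<lambda>i. complex_of_real (c i) * of_real x ^ i)" for c :: "nat \<Rightarrow> real"
  proof -
    have "(\<lambda>i. complex_of_real (c i * x ^ i)) sums (\<Sum>i. complex_of_real (c i) * of_real x ^ i)"
      using summable_sums[OF that] by simp
    then show ?thesis
      by (metis Reals_of_real sums_iff summable_of_real_iff suminf_of_real)
  qed
  show "bessel_E (of_real x) \<in> \<real>" "bessel_E' (of_real x) \<in> \<real>"
    unfolding bessel_E_def bessel_E'_def by (intro real summable_bessel summable_bessel')+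
qed

lemma bessel_E_holomorphic: "bessel_E holomorphic_on S"
  unfolding holomorphic_on_def field_differentiable_def
  using has_field_derivative_at_within[OF bessel_E_deriv] by blast

text \<open>Liouville's substitution \<open>Y(z) = \<surd>z J\<^sub>0(z)\<close> removes the first-order term of Bessel's equation.\<close>

definition liouville_Y :: "complex \<Rightarrow> complex" where
  "liouville_Y z = csqrt z * bessel_E (z\<^sup>2)"

definition liouville_Y' :: "complex \<Rightarrow> complex" where
  "liouville_Y' z = bessel_E (z\<^sup>2) / (2 * csqrt z) + 2 * csqrt z * z * bessel_E' (z\<^sup>2)"

lemma liouville_Y_deriv:
  assumes "Re z > 0" shows "(liouville_Y has_field_derivative liouville_Y' z) (at z)"
proof -
  have nz: "z \<notin> \<real>\<^sub>\<le>\<^sub>0" "csqrt z \<noteq> 0" using assms by (auto simp: complex_nonpos_Reals_iff)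
  show ?thesis unfolding liouville_Y_def[abs_def] liouville_Y'_def
    using nz
    by (auto intro!: derivative_eq_intros DERIV_chain2[OF bessel_E_deriv] has_field_derivative_csqrt'
        simp: field_simps)
qed

text \<open>Writing z = s^2 with s = \<open>csqrt z\<close> makes the computation rational in s; the
  equation for \<open>bessel_E\<close> at z^2, in the form z^2 E'' + E' = - E / 4, then eliminates
  both derivatives of E.\<close>

lemma liouville_Y'_deriv:
  assumes "Re z > 0"
  shows "(liouville_Y' has_field_derivative - (1 + 1 / (4 * z\<^sup>2)) * liouville_Y z) (at z)"
proof -
  define s where "s = csqrt z"
  have nz: "z \<notin> \<real>\<^sub>\<le>\<^sub>0" "csqrt z \<noteq> 0" "z \<noteq> 0" using assms by (auto simp: complex_nonpos_Reals_iff)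
  have z: "z = s\<^sup>2" and s0: "s \<noteq> 0" using nz by (simp_all add: s_def)
  define e where "e = bessel_E (z\<^sup>2)" define e1 where "e1 = bessel_E' (z\<^sup>2)"
  define e2 where "e2 = bessel_E'' (z\<^sup>2)"
  have ode: "z\<^sup>2 * e2 + e1 = - e / 4"
    using bessel_E_ode[of "z\<^sup>2"] unfolding e_def e1_def e2_def minus_divide_left[symmetric]
    by (simp only: eq_neg_iff_add_eq_0)
  have ds: "(csqrt has_field_derivative 1 / (2 * s)) (at z)"
    using has_field_derivative_csqrt[OF nz(1)] by (simp add: s_def inverse_eq_divide)
  have dsq: "((\<lambda>z. z\<^sup>2) has_field_derivative 2 * z) (at z)" by (auto intro!: derivative_eq_intros)
  have de: "((\<lambda>z. bessel_E (z\<^sup>2)) has_field_derivative e1 * (2 * z)) (at z)"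
    unfolding e1_def by (rule DERIV_chain2[OF bessel_E_deriv dsq])
  have de1: "((\<lambda>z. bessel_E' (z\<^sup>2)) has_field_derivative e2 * (2 * z)) (at z)"
    unfolding e2_def by (rule DERIV_chain2[OF bessel_E'_deriv dsq])
  have "(liouville_Y' has_field_derivative
      (e1 * (2 * z) * (2 * s) - e * (2 * (1 / (2 * s)))) / ((2 * s) * (2 * s)) +
      ((2 * (1 / (2 * s)) * z + 1 * (2 * s)) * e1 + e2 * (2 * z) * (2 * s * z))) (at z)"
    unfolding liouville_Y'_def[abs_def]
    using DERIV_add[OF DERIV_divide[OF de DERIV_cmult[OF ds, of 2]]
        DERIV_mult[OF DERIV_mult[OF DERIV_cmult[OF ds, of 2] DERIV_ident] de1]] s0
    unfolding e_def e1_def s_def by simp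
  moreover have "(e1 * (2 * z) * (2 * s) - e * (2 * (1 / (2 * s)))) / ((2 * s) * (2 * s)) +
      ((2 * (1 / (2 * s)) * z + 1 * (2 * s)) * e1 + e2 * (2 * z) * (2 * s * z)) =
      4 * s * (z\<^sup>2 * e2 + e1) - e / (4 * (s * z))"
    unfolding z using s0 by (simp add: field_simps power2_eq_square)
  moreover have "\<dots> = - (1 + 1 / (4 * z\<^sup>2)) * liouville_Y z"
    unfolding ode liouville_Y_def e_def[symmetric] s_def[symmetric] unfolding z using s0
    by (simp add: field_simps power2_eq_square)
  ultimately show ?thesis by simp
qed

section \<open>Radial eigenfunctions\<close>

text \<open>All derivatives of t |-> E(c t) at once, the form that \<open>smooth_radial\<close>
  consumes. For c = k^2 and t = |x|^2 the profile with i = 0 is J0(k|x|).\<close>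

definition bessel_profile :: "complex \<Rightarrow> nat \<Rightarrow> real \<Rightarrow> complex" where
  "bessel_profile c i t = c ^ i * (deriv ^^ i) bessel_E (c * of_real t)"

lemma bessel_profile_deriv:
  "(bessel_profile c i has_vector_derivative bessel_profile c (Suc i) t) (at t)"
proof -
  have hol: "(deriv ^^ i) bessel_E holomorphic_on UNIV"
    by (rule holomorphic_higher_deriv[OF bessel_E_holomorphic open_UNIV])
  have "((deriv ^^ i) bessel_E has_field_derivative (deriv ^^ Suc i) bessel_E (c * of_real t)) (at (c * of_real t))"
    using holomorphic_derivI[OF hol open_UNIV] by simp
  then have "((\<lambda>z. c ^ i * (deriv ^^ i) bessel_E z) has_field_derivative
      c ^ i * (deriv ^^ Suc i) bessel_E (c * of_real t)) (at (c * of_real t))"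
    by (rule DERIV_cmult)
  moreover have "((\<lambda>t. c * of_real t) has_vector_derivative c) (at t)"
    by (auto intro!: derivative_eq_intros)
  ultimately show ?thesis
    using field_vector_diff_chain_at[of "\<lambda>t. c * of_real t" c t]
    by (fastforce simp: bessel_profile_def[abs_def] o_def mult_ac)
qed

lemma bessel_profile_0: "bessel_profile c 0 t = bessel_E (c * of_real t)"
  and bessel_profile_1: "bessel_profile c (Suc 0) t = c * bessel_E' (c * of_real t)"
  and bessel_profile_2: "bessel_profile c (Suc (Suc 0)) t = c\<^sup>2 * bessel_E'' (c * of_real t)"
proof -
  have d1: "deriv bessel_E = bessel_E'" using DERIV_imp_deriv[OF bessel_E_deriv] by auto
  have d2: "deriv bessel_E' = bessel_E''" using DERIV_imp_deriv[OF bessel_E'_deriv] by auto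
  show "bessel_profile c 0 t = bessel_E (c * of_real t)"
    "bessel_profile c (Suc 0) t = c * bessel_E' (c * of_real t)"
    "bessel_profile c (Suc (Suc 0)) t = c\<^sup>2 * bessel_E'' (c * of_real t)"
    by (simp_all add: bessel_profile_def d1 d2 power2_eq_square)
qed

definition radial_wave :: "complex \<Rightarrow> 'a::euclidean_space \<Rightarrow> complex" where
  "radial_wave c x = bessel_profile c 0 (x \<bullet> x)"

lemma radial_wave_smooth: "radial_wave c \<in> smooth_functions"
  using smooth_radial[of "bessel_profile c" 0, OF bessel_profile_deriv] by (simp add: radial_wave_def[abs_def])

lemma partial_deriv_profile:
  "partial_deriv b (\<lambda>x. bessel_profile c i (x \<bullet> x)) x = of_real (2 * (x \<bullet> b)) * bessel_profile c (Suc i) (x \<bullet> x)"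
  using partial_deriv_eqI[OF has_derivative_radial[OF bessel_profile_deriv]] .

lemma partial_deriv_radial_wave:
  "partial_deriv b (radial_wave c) = (\<lambda>x. of_real (2 * (x \<bullet> b)) * bessel_profile c (Suc 0) (x \<bullet> x))"
  unfolding radial_wave_def[abs_def] by (rule ext) (rule partial_deriv_profile)

lemma sum_Basis_inner_square: "(\<Sum>b\<in>Basis. (x \<bullet> b)\<^sup>2) = x \<bullet> (x::'a::euclidean_space)"
  by (simp add: euclidean_inner[of x x] power2_eq_square)

text \<open>In dimension d a profile p(|x|^2) has Laplacian 2 d p' + 4 |x|^2 p''. Only for d = 2 is
  this four times the left part of \<open>bessel_E_ode\<close>, scaled by c.\<close>

lemma laplacian_radial_wave: "laplacian (radial_wave c) x = - (c * radial_wave c (x :: real^2))"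
proof -
  let ?p = "bessel_profile c"
  have "partial_deriv b (partial_deriv b (radial_wave c)) x =
      2 * ?p (Suc 0) (x \<bullet> x) + 4 * (of_real (x \<bullet> b))\<^sup>2 * ?p (Suc (Suc 0)) (x \<bullet> x)" if b: "b \<in> Basis" for b
  proof -
    have "((\<lambda>x. complex_of_real (2 * (x \<bullet> b))) has_derivative (\<lambda>h. of_real (2 * (h \<bullet> b)))) (at x)"
      by (auto intro!: derivative_eq_intros)
    from partial_deriv_eqI[OF this, of b]
    have 1: "partial_deriv b (\<lambda>x. complex_of_real (2 * (x \<bullet> b))) x = 2" using b by simp
    have 2: "(\<lambda>x. complex_of_real (2 * (x \<bullet> b))) differentiable (at x)"
      using \<open>(_ has_derivative _) (at x)\<close> by (auto simp: differentiable_def)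
    have 3: "(\<lambda>x. ?p (Suc 0) (x \<bullet> x)) differentiable (at x)"
      using has_derivative_radial[OF bessel_profile_deriv] differentiable_def by blast
    show ?thesis
      unfolding partial_deriv_radial_wave partial_deriv_mult[OF 2 3] 1 partial_deriv_profile
      by (simp add: power2_eq_square)
  qed
  then have "laplacian (radial_wave c) x =
      (\<Sum>b\<in>Basis. 2 * ?p (Suc 0) (x \<bullet> x) + 4 * (of_real (x \<bullet> b))\<^sup>2 * ?p (Suc (Suc 0)) (x \<bullet> x))"
    by (simp add: laplacian_def)
  also have "\<dots> = 4 * ?p (Suc 0) (x \<bullet> x) + 4 * of_real (\<Sum>b\<in>Basis. (x \<bullet> b)\<^sup>2) * ?p (Suc (Suc 0)) (x \<bullet> x)"
    by (simp add: sum.distrib sum_distrib_left sum_distrib_right of_real_sum)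
  also have "(\<Sum>b\<in>Basis. (x \<bullet> b)\<^sup>2) = x \<bullet> x"
    by (rule sum_Basis_inner_square)
  also have "4 * ?p (Suc 0) (x \<bullet> x) + 4 * of_real (x \<bullet> x) * ?p (Suc (Suc 0)) (x \<bullet> x) = - (c * ?p 0 (x \<bullet> x))"
    unfolding bessel_profile_0 bessel_profile_1 bessel_profile_2
    using bessel_E_ode[of "c * of_real (x \<bullet> x)"] by algebra
  finally show ?thesis by (simp add: radial_wave_def[of c x])
qed

text \<open>At |x| = 1 the normal derivative of p(|x|^2) is 2 p'(1), and p' carries the factor k^2
  or k^2 n; this is the origin of the coefficients in the second condition. Both waves are smooth,
  so the weak conditions follow from the classical ones.\<close>

lemma transmission_eigenvalueI:
  fixes n \<eta> :: real and k \<alpha> \<beta> :: complex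
  assumes ab: "\<alpha> \<noteq> 0 \<or> \<beta> \<noteq> 0"
    and dirichlet: "\<beta> * bessel_E (k\<^sup>2 * of_real n) = \<alpha> * bessel_E (k\<^sup>2)"
    and neumann: "2 * \<beta> * k\<^sup>2 * of_real n * bessel_E' (k\<^sup>2 * of_real n) - 2 * \<alpha> * k\<^sup>2 * bessel_E' (k\<^sup>2) =
      of_real \<eta> * \<alpha> * bessel_E (k\<^sup>2)"
  shows "transmission_eigenvalue unit_disk circle_normal circle_measure n \<eta> k"
proof -
  define w :: "real^2 \<Rightarrow> complex" where "w x = \<beta> * radial_wave (k\<^sup>2 * of_real n) x" for x
  define v :: "real^2 \<Rightarrow> complex" where "v x = \<alpha> * radial_wave (k\<^sup>2) x" for x
  have w: "w \<in> smooth_functions" and v: "v \<in> smooth_functions"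
    unfolding w_def[abs_def] v_def[abs_def] by (intro smooth_mult smooth_const radial_wave_smooth)+
  have scaled_laplacian: "laplacian (\<lambda>x. c * f x) x = c * laplacian f x"
    if "f \<in> smooth_functions" for c f and x :: "real^2"
  proof -
    have pd: "partial_deriv b (\<lambda>x. c * g x) = (\<lambda>x. c * partial_deriv b g x)"
      if "g \<in> smooth_functions" for g and b :: "real^2"
      using partial_deriv_mult[of "\<lambda>x. c", OF differentiable_const smooth_differentiable[OF that]]
        partial_deriv_eqI[OF has_derivative_const, of b c] by (simp add: fun_eq_iff)
    show ?thesis using that by (simp add: laplacian_def pd smooth_partial_deriv sum_distrib_left)
  qed
  have Lw: "laplacian w = (\<lambda>x. - (k\<^sup>2 * of_real n * w x))"
    and Lv: "laplacian v = (\<lambda>x. - (k\<^sup>2 * v x))"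
    unfolding w_def[abs_def] v_def[abs_def]
    by (auto simp: fun_eq_iff scaled_laplacian[OF radial_wave_smooth] laplacian_radial_wave)
  define u where "u x = w x - v x" for x
  have "u = (\<lambda>x. w x + (-1) * v x)" by (simp add: u_def fun_eq_iff)
  then have u: "u \<in> smooth_functions" using smooth_add[OF w smooth_mult[OF smooth_const[of "-1"] v]] by (simp only:)
  define U where "U i t = \<beta> * bessel_profile (k\<^sup>2 * of_real n) i t - \<alpha> * bessel_profile (k\<^sup>2) i t" for i t
  have U': "(U i has_vector_derivative U (Suc i) t) (at t)" for i t
    unfolding U_def[abs_def] by (intro derivative_intros bessel_profile_deriv)
  have uU: "u x = U 0 (x \<bullet> x)" for x by (simp add: u_def w_def v_def U_def radial_wave_def)
  have U1: "U 0 1 = 0" using dirichlet by (simp add: U_def bessel_profile_0)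
  have contU: "continuous_on S (U i)" for S i
    by (rule continuous_at_imp_continuous_on) (use U' has_vector_derivative_continuous in blast)
  have "bounded (U (Suc 0) ` {0..1})" by (intro compact_imp_bounded compact_continuous_image contU) simp
  then obtain C where C: "\<And>t. t \<in> {0..1} \<Longrightarrow> norm (U (Suc 0) t) \<le> C" unfolding bounded_iff by blast
  \<comment> \<open>The first boundary condition says that the profile of u vanishes at 1; the mean
    value inequality turns this into the linear decay required by \<open>smooth_H10\<close>.\<close>
  have "norm (u x) \<le> C * (1 - x \<bullet> x)" if "norm x < 1" for x
  proof -
    define t where "t = x \<bullet> x"
    have t: "0 \<le> t" "t < 1" using that by (auto simp: t_def norm_lt_square)
    have "norm (U 0 1 - U 0 t) \<le> C * 1 - C * t"
    proof (rule differentiable_bound_general[where f'="U (Suc 0)" and \<phi>'="\<lambda>s. C"])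
      show "((*) C has_vector_derivative C) (at s)" for s
        by (auto intro!: derivative_eq_intros simp: has_real_derivative_iff_has_vector_derivative[symmetric])
    qed (use t C U' contU in \<open>auto intro!: continuous_intros\<close>)
    then show ?thesis unfolding U1 uU t_def by (simp add: right_diff_distrib)
  qed
  then have H10: "u \<in> H10_space (ball 0 1)" by (rule smooth_H10[OF u])
  define g where "g x = of_real \<eta> * v x" for x
  have g: "g \<in> smooth_functions" unfolding g_def[abs_def] by (intro smooth_mult smooth_const v)
  have "g x = (\<Sum>b\<in>Basis. of_real (x \<bullet> b) * partial_deriv b u x)" if x: "norm x = 1" for x
  proof -
    have xx: "x \<bullet> x = 1" using x by (simp add: dot_square_norm)
    have "partial_deriv b u x = of_real (2 * (x \<bullet> b)) * U (Suc 0) 1" for b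
      using partial_deriv_eqI[OF has_derivative_radial[OF U'], of b 0 x] xx by (simp add: ext[of u, OF uU])
    then have "(\<Sum>b\<in>Basis. of_real (x \<bullet> b) * partial_deriv b u x) = of_real (\<Sum>b\<in>Basis. (x \<bullet> b)\<^sup>2) * (2 * U (Suc 0) 1)"
      by (simp add: power2_eq_square of_real_sum sum_distrib_right sum_distrib_left mult_ac)
    also have "(\<Sum>b\<in>Basis. (x \<bullet> b)\<^sup>2) = x \<bullet> x"
      by (rule sum_Basis_inner_square)
    also have "of_real (x \<bullet> x) * (2 * U (Suc 0) 1) = of_real \<eta> * \<alpha> * bessel_E (k\<^sup>2)"
      unfolding xx using neumann by (simp add: U_def bessel_profile_1 algebra_simps)
    finally show ?thesis using xx by (simp add: g_def v_def radial_wave_def bessel_profile_0)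
  qed
  then have nd: "has_normal_derivative (ball 0 1) circle_normal circle_measure u g"
    by (intro smooth_has_normal_derivative u smooth_L2_circle g)
  have dt: "has_dual_trace (ball 0 1) circle_normal circle_measure g g"
    by (rule smooth_has_dual_trace[OF g])
  have nontriv: "\<not> (AE x in ball_measure. w x = 0 \<and> v x = 0)"
  proof
    assume AE: "AE x in ball_measure. w x = 0 \<and> v x = 0"
    \<comment> \<open>At the origin f equals its amplitude, because E(0) = 1, so f is nonzero on a
      neighbourhood, which is not a null set.\<close>
    define f where "f x = (if \<alpha> \<noteq> 0 then v x else w x)" for x
    have "continuous_on UNIV f"
      unfolding f_def using smooth_continuous[OF w] smooth_continuous[OF v] by (cases "\<alpha> = 0") auto
    then have "open {x. f x \<noteq> 0}" by (intro open_Collect_neq) auto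
    then have op: "open {x \<in> ball 0 1. f x \<noteq> 0}"
      using open_Int[OF open_ball, of "{x. f x \<noteq> 0}" 0 1] by (simp add: Int_def)
    have "f 0 \<noteq> 0" using ab
      by (auto simp: f_def v_def w_def radial_wave_def bessel_profile_0 bessel_E_0)
    then have "0 \<in> {x \<in> ball 0 1. f x \<noteq> 0}" by simp
    then have "\<not> negligible {x \<in> ball 0 1. f x \<noteq> 0}"
      using open_not_negligible[OF op] by blast
    moreover have "AE x in lebesgue. x \<in> ball 0 1 \<longrightarrow> w x = 0 \<and> v x = 0"
      using AE by (subst (asm) AE_restrict_space_iff) auto
    then have "AE x in lebesgue. x \<notin> {x \<in> ball 0 1. f x \<noteq> 0}"
      by (rule eventually_mono) (auto simp: f_def)
    then have "negligible {x \<in> ball 0 1. f x \<noteq> 0}"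
      unfolding negligible_iff_null_sets using op by (subst AE_iff_null_sets) auto
    ultimately show False by blast
  qed
  have eqs: "(\<lambda>x. w x - v x) = u" "(\<lambda>x. of_real \<eta> * v x) = g" by (auto simp: u_def g_def fun_eq_iff)
  show ?thesis
    unfolding transmission_eigenvalue_def unit_disk_def
    by (intro exI[of _ w] exI[of _ v] conjI exI[of _ g], unfold eqs)
      (use nontriv H10 smooth_H2[OF u] has_weak_laplacian_smooth[OF w] has_weak_laplacian_smooth[OF v]
        smooth_L2_ball[OF w] smooth_L2_ball[OF v] nd dt in \<open>auto simp: Lw Lv\<close>)
qed

section \<open>Asymptotics of the Bessel function\<close>

text \<open>The derivative of N lies between - \<kappa> N and \<kappa> N, so N exp (- \<Phi>)
  decreases and N exp \<Phi> increases. The forward estimate bounds solutions; the backward one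
  prevents a nonzero solution from dying out, which later makes the amplitude nonzero.\<close>

lemma energy_gronwall:
  fixes p q p' q' :: "real \<Rightarrow> complex" and \<kappa> \<Phi> :: "real \<Rightarrow> real"
  assumes ab: "a \<le> b"
    and p: "\<And>t. t \<in> {a..b} \<Longrightarrow> (p has_vector_derivative p' t) (at t)"
    and q: "\<And>t. t \<in> {a..b} \<Longrightarrow> (q has_vector_derivative q' t) (at t)"
    and \<Phi>: "\<And>t. t \<in> {a..b} \<Longrightarrow> (\<Phi> has_real_derivative \<kappa> t) (at t)"
    and bound: "\<And>t. t \<in> {a..b} \<Longrightarrow>
      2 * \<bar>p t \<bullet> p' t + q t \<bullet> q' t\<bar> \<le> \<kappa> t * (p t \<bullet> p t + q t \<bullet> q t)"
  defines "N \<equiv> \<lambda>t. p t \<bullet> p t + q t \<bullet> q t"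
  shows "N b \<le> N a * exp (\<Phi> b - \<Phi> a)" "N a \<le> N b * exp (\<Phi> b - \<Phi> a)"
proof -
  have dN: "(N has_real_derivative 2 * (p t \<bullet> p' t + q t \<bullet> q' t)) (at t)" if "t \<in> {a..b}" for t
  proof -
    have "(N has_vector_derivative (p t \<bullet> p' t + p' t \<bullet> p t) + (q t \<bullet> q' t + q' t \<bullet> q t)) (at t)"
      unfolding N_def
      by (intro has_vector_derivative_add bounded_bilinear.has_vector_derivative[OF bounded_bilinear_inner] p q that)
    then show ?thesis
      by (simp add: has_real_derivative_iff_has_vector_derivative inner_commute)
  qed
  have "N b * exp (- \<Phi> b) \<le> N a * exp (- \<Phi> a)"
  proof (rule DERIV_nonpos_imp_nonincreasing[OF ab])
    fix t assume t: "a \<le> t" "t \<le> b"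
    have "((\<lambda>t. N t * exp (- \<Phi> t)) has_real_derivative
        (2 * (p t \<bullet> p' t + q t \<bullet> q' t) - \<kappa> t * N t) * exp (- \<Phi> t)) (at t)"
      using t by (auto intro!: derivative_eq_intros dN \<Phi> simp: algebra_simps)
    moreover have "2 * (p t \<bullet> p' t + q t \<bullet> q' t) - \<kappa> t * N t \<le> 0"
      using bound[of t] t abs_ge_self[of "p t \<bullet> p' t + q t \<bullet> q' t"]
        abs_ge_minus_self[of "p t \<bullet> p' t + q t \<bullet> q' t"]
      unfolding N_def atLeastAtMost_iff by (smt (verit))
    then have "(2 * (p t \<bullet> p' t + q t \<bullet> q' t) - \<kappa> t * N t) * exp (- \<Phi> t) \<le> 0"
      by (intro mult_nonpos_nonneg) auto
    ultimately show "\<exists>y. ((\<lambda>t. N t * exp (- \<Phi> t)) has_real_derivative y) (at t) \<and> y \<le> 0" by blast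
  qed
  then have "N b * exp (- \<Phi> b) * exp (\<Phi> b) \<le> N a * exp (- \<Phi> a) * exp (\<Phi> b)" by (intro mult_right_mono) auto
  then show "N b \<le> N a * exp (\<Phi> b - \<Phi> a)" by (simp add: exp_diff exp_minus field_simps)
  have "N a * exp (\<Phi> a) \<le> N b * exp (\<Phi> b)"
  proof (rule DERIV_nonneg_imp_nondecreasing[OF ab])
    fix t assume t: "a \<le> t" "t \<le> b"
    have "((\<lambda>t. N t * exp (\<Phi> t)) has_real_derivative
        (2 * (p t \<bullet> p' t + q t \<bullet> q' t) + \<kappa> t * N t) * exp (\<Phi> t)) (at t)"
      using t by (auto intro!: derivative_eq_intros dN \<Phi> simp: algebra_simps)
    moreover have "2 * (p t \<bullet> p' t + q t \<bullet> q' t) + \<kappa> t * N t \<ge> 0"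
      using bound[of t] t abs_ge_self[of "p t \<bullet> p' t + q t \<bullet> q' t"]
        abs_ge_minus_self[of "p t \<bullet> p' t + q t \<bullet> q' t"]
      unfolding N_def atLeastAtMost_iff by (smt (verit))
    then have "(2 * (p t \<bullet> p' t + q t \<bullet> q' t) + \<kappa> t * N t) * exp (\<Phi> t) \<ge> 0"
      by (intro mult_nonneg_nonneg) auto
    ultimately show "\<exists>y. ((\<lambda>t. N t * exp (\<Phi> t)) has_real_derivative y) (at t) \<and> 0 \<le> y" by blast
  qed
  then have "N a * exp (\<Phi> a) * exp (- \<Phi> a) \<le> N b * exp (\<Phi> b) * exp (- \<Phi> a)" by (intro mult_right_mono) auto
  then show "N a \<le> N b * exp (\<Phi> b - \<Phi> a)" by (simp add: exp_diff exp_minus field_simps)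
qed

section \<open>Energy bounds for Liouville's form of Bessel's equation\<close>

definition liouville_energy :: "complex \<Rightarrow> real" where
  "liouville_energy z = liouville_Y z \<bullet> liouville_Y z + liouville_Y' z \<bullet> liouville_Y' z"

lemma liouville_energy_eq: "liouville_energy z = (norm (liouville_Y z))\<^sup>2 + (norm (liouville_Y' z))\<^sup>2"
  by (simp add: liouville_energy_def dot_square_norm)

lemma two_inner_le: "2 * \<bar>x \<bullet> y\<bar> \<le> x \<bullet> x + y \<bullet> (y::'a::real_inner)"
proof -
  have "2 * \<bar>x \<bullet> y\<bar> \<le> 2 * (norm x * norm y)" using Cauchy_Schwarz_ineq2[of x y] by simp
  also have "\<dots> \<le> (norm x)\<^sup>2 + (norm y)\<^sup>2"
    using zero_le_power2[of "norm x - norm y"] unfolding power2_diff by linarith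
  finally show ?thesis by (simp add: dot_square_norm)
qed

lemma has_vector_derivative_along_line:
  assumes "(f has_field_derivative f') (at (z + of_real t * d))"
  shows "((\<lambda>t. f (z + of_real t * d)) has_vector_derivative d * f') (at t)"
proof -
  have "((\<lambda>t. z + of_real t * d) has_vector_derivative d) (at t)" by (auto intro!: derivative_eq_intros)
  from field_vector_diff_chain_at[OF this assms] show ?thesis by (simp add: o_def)
qed

text \<open>On the real axis the oscillator part cancels in Y.Y' + Y'.Y'' and leaves - Y.Y' / (4
  t^2). As 1 / (4 t^2) has the finite integral 1 / (4 a) beyond a, the energies at a and at any
  later point are comparable.\<close>

lemma liouville_energy_real_axis:
  assumes "0 < a" "a \<le> b"
  shows "liouville_energy (of_real b) \<le> liouville_energy (of_real a) * exp (1 / (4 * a))"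
    "liouville_energy (of_real a) \<le> liouville_energy (of_real b) * exp (1 / (4 * a))"
proof -
  let ?p = "\<lambda>t. liouville_Y (of_real t)" let ?q = "\<lambda>t. liouville_Y' (of_real t)"
  let ?q' = "\<lambda>t. - (1 + 1 / (4 * t\<^sup>2)) *\<^sub>R liouville_Y (of_real t)"
  have der: "(?p has_vector_derivative ?q t) (at t)" "(?q has_vector_derivative ?q' t) (at t)"
    if "t \<in> {a..b}" for t
  proof -
    have "Re (of_real t) > 0" using that assms by simp
    note d = liouville_Y_deriv[OF this] liouville_Y'_deriv[OF this]
    show "(?p has_vector_derivative ?q t) (at t)"
      using has_vector_derivative_along_line[of liouville_Y _ 0 t 1] d(1) by simp
    show "(?q has_vector_derivative ?q' t) (at t)"
      using has_vector_derivative_along_line[of liouville_Y' _ 0 t 1] d(2)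
      by (simp add: scaleR_conv_of_real)
  qed
  have phi: "((\<lambda>t. - 1 / (4 * t)) has_real_derivative 1 / (4 * t\<^sup>2)) (at t)" if "t \<in> {a..b}" for t
    using that assms by (auto intro!: derivative_eq_intros simp: power2_eq_square)
  have bound: "2 * \<bar>?p t \<bullet> ?q t + ?q t \<bullet> ?q' t\<bar> \<le> 1 / (4 * t\<^sup>2) * (?p t \<bullet> ?p t + ?q t \<bullet> ?q t)"
    if "t \<in> {a..b}" for t
  proof -
    have "?p t \<bullet> ?q t + ?q t \<bullet> ?q' t = - (1 / (4 * t\<^sup>2)) * (?p t \<bullet> ?q t)"
      by (simp add: inner_commute algebra_simps)
    then have "2 * \<bar>?p t \<bullet> ?q t + ?q t \<bullet> ?q' t\<bar> = 1 / (4 * t\<^sup>2) * (2 * \<bar>?p t \<bullet> ?q t\<bar>)"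
      by (simp add: abs_mult)
    also have "\<dots> \<le> 1 / (4 * t\<^sup>2) * (?p t \<bullet> ?p t + ?q t \<bullet> ?q t)"
      by (intro mult_left_mono two_inner_le) simp
    finally show ?thesis .
  qed
  note N = energy_gronwall[of a b ?p ?q ?q ?q' "\<lambda>t. - 1 / (4 * t)" "\<lambda>t. 1 / (4 * t\<^sup>2)", OF assms(2) der phi bound]
  have e: "exp (- 1 / (4 * b) - - 1 / (4 * a)) \<le> exp (1 / (4 * a))" using assms by simp
  have nonneg: "liouville_energy z \<ge> 0" for z by (simp add: liouville_energy_def)
  show "liouville_energy (of_real b) \<le> liouville_energy (of_real a) * exp (1 / (4 * a))"
    using N(1) mult_left_mono[OF e nonneg[of "of_real a"]] by (simp add: liouville_energy_def)
  show "liouville_energy (of_real a) \<le> liouville_energy (of_real b) * exp (1 / (4 * a))"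
    using N(2) mult_left_mono[OF e nonneg[of "of_real b"]] by (simp add: liouville_energy_def)
qed

text \<open>In the imaginary direction nothing cancels, but |1 + 1 / (4 z^2)| \<le> 2 for |z| \<ge>
  1, so the energy grows at most at the rate 1 + 2 = 3. Within a strip this costs a constant
  factor.\<close>

lemma liouville_energy_vertical:
  assumes "x \<ge> 1" "r \<ge> 0" "s = 1 \<or> s = - 1"
  shows "liouville_energy (of_real x + of_real r * (of_real s * \<i>)) \<le> liouville_energy (of_real x) * exp (3 * r)"
proof -
  have inverse_square_le: "norm (1 / (4 * w\<^sup>2)) \<le> 1 / 4" if "1 \<le> norm w" for w :: complex
  proof -
    have "1 / (4 * (norm w)\<^sup>2) \<le> 1 / (4 * 1)" using one_le_power[OF that, of 2] by (intro frac_le) auto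
    then show ?thesis by (simp add: norm_divide norm_mult norm_power)
  qed
  let ?z = "\<lambda>t. complex_of_real x + of_real t * (of_real s * \<i>)"
  let ?p = "\<lambda>t. liouville_Y (?z t)" let ?q = "\<lambda>t. liouville_Y' (?z t)"
  let ?p' = "\<lambda>t. (of_real s * \<i>) * liouville_Y' (?z t)"
  let ?q' = "\<lambda>t. (of_real s * \<i>) * (- (1 + 1 / (4 * (?z t)\<^sup>2)) * liouville_Y (?z t))"
  have "?p r \<bullet> ?p r + ?q r \<bullet> ?q r \<le> (?p 0 \<bullet> ?p 0 + ?q 0 \<bullet> ?q 0) * exp (3 * r - 3 * 0)"
  proof (rule energy_gronwall(1)[where p'="?p'" and q'="?q'" and \<kappa>="\<lambda>t. 3"])
    fix t assume t: "t \<in> {0..r}"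
    have Re: "Re (?z t) > 0" using assms by simp
    show "(?p has_vector_derivative ?p' t) (at t)" "(?q has_vector_derivative ?q' t) (at t)"
      by (intro has_vector_derivative_along_line liouville_Y_deriv liouville_Y'_deriv Re)+
    show "((*) 3 has_real_derivative 3) (at t)" by (auto intro!: derivative_eq_intros)
    have "1 \<le> norm (?z t)" using complex_Re_le_cmod[of "?z t"] assms by simp
    then have "norm (1 / (4 * (?z t)\<^sup>2)) \<le> 1 / 4" by (rule inverse_square_le)
    then have c: "norm (1 + 1 / (4 * (?z t)\<^sup>2)) \<le> 2"
      using norm_triangle_ineq[of 1 "1 / (4 * (?z t)\<^sup>2)"] by simp
    have s: "norm (of_real s * \<i>) = 1" using assms(3) by auto
    have "\<bar>?p t \<bullet> ?p' t\<bar> \<le> norm (?p t) * norm (?q t)"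
      using Cauchy_Schwarz_ineq2[of "?p t" "?p' t"] s by (simp add: norm_mult)
    moreover have "\<bar>?q t \<bullet> ?q' t\<bar> \<le> 2 * (norm (?p t) * norm (?q t))"
    proof -
      have "\<bar>?q t \<bullet> ?q' t\<bar> \<le> norm (?q t) * (norm (1 + 1 / (4 * (?z t)\<^sup>2)) * norm (?p t))"
        using Cauchy_Schwarz_ineq2[of "?q t" "?q' t"] s by (simp add: norm_mult norm_minus_cancel del: minus_add_distrib)
      also have "\<dots> \<le> norm (?q t) * (2 * norm (?p t))" by (intro mult_left_mono mult_right_mono c) auto
      finally show ?thesis by (simp add: mult_ac)
    qed
    moreover have "2 * \<bar>a + b\<bar> \<le> 3 * (2 * c)" if "\<bar>a\<bar> \<le> c" "\<bar>b\<bar> \<le> 2 * c" for a b c :: real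
      using that by auto
    ultimately have "2 * \<bar>?p t \<bullet> ?p' t + ?q t \<bullet> ?q' t\<bar> \<le> 3 * (2 * (norm (?p t) * norm (?q t)))" by blast
    also have "2 * (norm (?p t) * norm (?q t)) \<le> ?p t \<bullet> ?p t + ?q t \<bullet> ?q t"
      using zero_le_power2[of "norm (?p t) - norm (?q t)"] unfolding power2_diff dot_square_norm by linarith
    finally show "2 * \<bar>?p t \<bullet> ?p' t + ?q t \<bullet> ?q' t\<bar> \<le> 3 * (?p t \<bullet> ?p t + ?q t \<bullet> ?q t)" by simp
  qed (use assms in simp)
  then show ?thesis by (simp add: liouville_energy_def)
qed

lemma liouville_bounded:
  obtains B where "B \<ge> 0" "\<And>z. Re z \<ge> 1 \<Longrightarrow> \<bar>Im z\<bar> \<le> R \<Longrightarrow> norm (liouville_Y z) \<le> B \<and> norm (liouville_Y' z) \<le> B"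
proof -
  define M where "M = liouville_energy 1 * exp (1 / 4) * exp (3 * R)"
  have nonneg: "liouville_energy z \<ge> 0" for z by (simp add: liouville_energy_def)
  have M: "M \<ge> 0" using nonneg[of 1] by (simp add: M_def)
  have en: "liouville_energy z \<le> M" if z: "Re z \<ge> 1" "\<bar>Im z\<bar> \<le> R" for z
  proof -
    define s :: real where "s = (if Im z \<ge> 0 then 1 else -1)"
    have zeq: "z = of_real (Re z) + of_real \<bar>Im z\<bar> * (of_real s * \<i>)"
      by (simp add: complex_eq_iff s_def)
    have "liouville_energy z \<le> liouville_energy (of_real (Re z)) * exp (3 * \<bar>Im z\<bar>)"
      by (subst zeq, rule liouville_energy_vertical) (use z in \<open>auto simp: s_def\<close>)
    also have "\<dots> \<le> (liouville_energy (of_real 1) * exp (1 / (4 * 1))) * exp (3 * R)"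
      using z nonneg by (intro mult_mono liouville_energy_real_axis(1)) auto
    finally show ?thesis by (simp add: M_def)
  qed
  show thesis
  proof (rule that[of "sqrt M"])
    fix z assume "Re z \<ge> 1" "\<bar>Im z\<bar> \<le> R"
    from en[OF this] have "(norm (liouville_Y z))\<^sup>2 \<le> M" "(norm (liouville_Y' z))\<^sup>2 \<le> M"
      unfolding liouville_energy_eq
      using zero_le_power2[of "norm (liouville_Y z)"] zero_le_power2[of "norm (liouville_Y' z)"] by linarith+
    then show "norm (liouville_Y z) \<le> sqrt M \<and> norm (liouville_Y' z) \<le> sqrt M"
      using real_le_rsqrt by blast
  qed (use M in simp)
qed

lemma limit_of_integrable_derivative:
  fixes f f' :: "real \<Rightarrow> complex"
  assumes f: "\<And>x. x \<ge> 1 \<Longrightarrow> (f has_vector_derivative f' x) (at x)"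
    and bound: "\<And>x. x \<ge> 1 \<Longrightarrow> norm (f' x) \<le> M / x ^ 3" and M: "M \<ge> 0"
  obtains L where "(\<lambda>j. f (real j + 1)) \<longlonglongrightarrow> L" "\<And>x. x \<ge> 1 \<Longrightarrow> norm (f x - L) \<le> M / x\<^sup>2"
proof -
  have diff: "norm (f b - f a) \<le> M / a\<^sup>2" if ab: "1 \<le> a" "a \<le> b" for a b
  proof (cases "a = b")
    case False
    have "norm (f b - f a) \<le> - (M / 2) / b\<^sup>2 - - (M / 2) / a\<^sup>2"
    proof (rule differentiable_bound_general[where f'=f' and \<phi>'="\<lambda>x. M / x ^ 3"])
      show "continuous_on {a..b} f"
      proof (intro continuous_at_imp_continuous_on ballI)
        fix x assume "x \<in> {a..b}"
        with ab have "x \<ge> 1" by simp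
        from has_vector_derivative_continuous[OF f[OF this]] show "isCont f x" .
      qed
      show "continuous_on {a..b} (\<lambda>x. - (M / 2) / x\<^sup>2)" using ab by (auto intro!: continuous_intros)
      show "((\<lambda>x. - (M / 2) / x\<^sup>2) has_vector_derivative M / x ^ 3) (at x)" if "a < x" for x
        unfolding has_real_derivative_iff_has_vector_derivative[symmetric]
        using that ab by (auto intro!: derivative_eq_intros simp: field_simps power2_eq_square power3_eq_cube)
    qed (use ab False f bound in auto)
    also have "\<dots> \<le> M / a\<^sup>2" using M ab by (simp add: field_simps)
    finally show ?thesis .
  qed (use M in simp)
  have "Cauchy (\<lambda>j. f (real j + 1))"
  proof (rule metric_CauchyI)
    fix e :: real assume e: "e > 0"
    obtain J :: nat where J: "real J > M / e" using reals_Archimedean2 by blast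
    have tail: "dist (f (real i + 1)) (f (real j + 1)) < e" if "J \<le> i" "i \<le> j" for i j
    proof -
      have i1: "real i + 1 \<ge> 1" by simp
      have "norm (f (real j + 1) - f (real i + 1)) \<le> M / (real i + 1)\<^sup>2" using that by (intro diff) auto
      also have "\<dots> \<le> M / (real i + 1)"
        using self_le_power[OF i1, of 2] M by (intro divide_left_mono) auto
      also have "\<dots> < e"
      proof -
        have "M / e < real i + 1" using J that by linarith
        then show ?thesis using e by (simp add: field_simps)
      qed
      finally show ?thesis by (simp add: dist_norm norm_minus_commute)
    qed
    show "\<exists>J. \<forall>i\<ge>J. \<forall>j\<ge>J. dist (f (real i + 1)) (f (real j + 1)) < e"
      by (rule exI[of _ J]) (metis dist_commute nle_le tail)
  qed
  then obtain L where L: "(\<lambda>j. f (real j + 1)) \<longlonglongrightarrow> L" using Cauchy_convergent convergent_def by blast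
  have "norm (f x - L) \<le> M / x\<^sup>2" if "x \<ge> 1" for x
  proof (rule tendsto_upperbound)
    show "(\<lambda>j. norm (f x - f (real j + 1))) \<longlonglongrightarrow> norm (f x - L)" by (intro tendsto_intros L)
    show "\<forall>\<^sub>F j in sequentially. norm (f x - f (real j + 1)) \<le> M / x\<^sup>2"
      using eventually_ge_at_top[of "nat \<lceil>x\<rceil>"]
    proof eventually_elim
      case (elim j)
      then have "x \<le> real j + 1" by linarith
      then have "norm (f (real j + 1) - f x) \<le> M / x\<^sup>2" by (rule diff[OF that])
      then show ?case by (simp add: norm_minus_commute)
    qed
  qed simp
  with L show thesis by (rule that)
qed

text \<open>Approximate solutions of \<open>y'' = -(1 + 1/(4z\<^sup>2)) y\<close> for \<open>c = \<plusminus>\<i>\<close>; the correction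
  \<open>- c/(8z)\<close> makes the defect of order \<open>z\<^sup>-\<^sup>3\<close>.\<close>

definition wkb :: "complex \<Rightarrow> complex \<Rightarrow> complex" where
  "wkb c z = exp (c * z) * (1 - c / (8 * z))"

definition wkb' :: "complex \<Rightarrow> complex \<Rightarrow> complex" where
  "wkb' c z = exp (c * z) * (c + 1 / (8 * z) + c / (8 * z\<^sup>2))"

text \<open>The Wronskian of Y and an approximate solution. It would be constant for an exact
  solution, so its derivative sees only the defect.\<close>

definition liouville_W :: "complex \<Rightarrow> complex \<Rightarrow> complex" where
  "liouville_W c z = liouville_Y z * wkb' c z - liouville_Y' z * wkb c z"

lemma wkb_deriv:
  assumes c: "c\<^sup>2 = - 1" and z: "z \<noteq> 0"
  shows "(wkb c has_field_derivative wkb' c z) (at z)"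
proof -
  have "(wkb c has_field_derivative
      exp (c * z) * c * (1 - c / (8 * z)) + exp (c * z) * (c * 8 / (8 * z)\<^sup>2)) (at z)"
    unfolding wkb_def[abs_def] using z
    by (auto intro!: derivative_eq_intros simp: power2_eq_square field_simps)
  moreover have "exp (c * z) * c * (1 - c / (8 * z)) + exp (c * z) * (c * 8 / (8 * z)\<^sup>2) =
      exp (c * z) * (c - c\<^sup>2 / (8 * z) + c / (8 * z\<^sup>2))"
    using z by (simp add: field_simps power2_eq_square)
  ultimately show ?thesis by (simp add: wkb'_def c)
qed

lemma wkb'_deriv:
  assumes c: "c\<^sup>2 = - 1" and z: "z \<noteq> 0"
  shows "(wkb' c has_field_derivative
    - (1 + 1 / (4 * z\<^sup>2)) * wkb c z - exp (c * z) * (9 * c / 32) / z ^ 3) (at z)"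
proof -
  have "(wkb' c has_field_derivative
      exp (c * z) * c * (c + 1 / (8 * z) + c / (8 * z\<^sup>2)) +
      exp (c * z) * (- 1 / (8 * z\<^sup>2) - c / (4 * z ^ 3))) (at z)"
    unfolding wkb'_def[abs_def] using z
    by (auto intro!: derivative_eq_intros simp: power2_eq_square power3_eq_cube field_simps)
  moreover have "exp (c * z) * c * (c + 1 / (8 * z) + c / (8 * z\<^sup>2)) +
      exp (c * z) * (- 1 / (8 * z\<^sup>2) - c / (4 * z ^ 3)) =
      exp (c * z) * (c\<^sup>2 + c / (8 * z) + c\<^sup>2 / (8 * z\<^sup>2) - 1 / (8 * z\<^sup>2) - c / (4 * z ^ 3))"
    by (simp add: field_simps power2_eq_square)
  moreover have "\<dots> = - (1 + 1 / (4 * z\<^sup>2)) * wkb c z - exp (c * z) * (9 * c / 32) / z ^ 3"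
    unfolding c wkb_def using z by (simp add: field_simps power2_eq_square power3_eq_cube)
  ultimately show ?thesis by simp
qed

text \<open>The common potential 1 + 1 / (4 z^2) cancels and the defect of order z^(-3) remains.
  Being integrable at infinity, it makes the Wronskian converge with error of order z^(-2), one
  order beyond the correction kept in \<open>wkb\<close>.\<close>

lemma liouville_W_deriv:
  assumes c: "c\<^sup>2 = - 1" and z: "Re z > 0"
  shows "(liouville_W c has_field_derivative - liouville_Y z * exp (c * z) * (9 * c / 32) / z ^ 3) (at z)"
proof -
  have nz: "z \<noteq> 0" using z by auto
  note d = DERIV_diff[OF DERIV_mult[OF liouville_Y_deriv[OF z] wkb'_deriv[OF c nz]]
      DERIV_mult[OF liouville_Y'_deriv[OF z] wkb_deriv[OF c nz]]]
  show ?thesis unfolding liouville_W_def[abs_def]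
    by (rule DERIV_cong[OF d]) (simp add: algebra_simps)
qed

lemma norm_exp_strip:
  assumes "c = \<i> \<or> c = - \<i>" "\<bar>Im z\<bar> \<le> R" shows "norm (exp (c * z)) \<le> exp R"
  using assms by auto

lemma norm_sin_le_exp: "norm (sin z) \<le> exp \<bar>Im z\<bar>"
  and norm_cos_le_exp: "norm (cos z) \<le> exp \<bar>Im z\<bar>" for z :: complex
proof -
  have e: "norm (exp (\<i> * z)) \<le> exp \<bar>Im z\<bar>" "norm (exp (- (\<i> * z))) \<le> exp \<bar>Im z\<bar>" by auto
  have "norm (exp (\<i> * z) - exp (- (\<i> * z))) \<le> 2 * exp \<bar>Im z\<bar>"
    "norm (exp (\<i> * z) + exp (- (\<i> * z))) \<le> 2 * exp \<bar>Im z\<bar>"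
    using norm_triangle_ineq4[of "exp (\<i> * z)" "exp (- (\<i> * z))"]
      norm_triangle_ineq[of "exp (\<i> * z)" "exp (- (\<i> * z))"] e by linarith+
  then show "norm (sin z) \<le> exp \<bar>Im z\<bar>" "norm (cos z) \<le> exp \<bar>Im z\<bar>"
    by (simp_all add: sin_exp_eq cos_exp_eq norm_divide norm_mult)
qed

lemma wkb_bound:
  assumes c: "c = \<i> \<or> c = - \<i>" and z: "Re z \<ge> 1" "\<bar>Im z\<bar> \<le> R"
  shows "norm (wkb c z) \<le> 2 * exp R" "norm (wkb' c z) \<le> 2 * exp R"
proof -
  have z1: "1 \<le> norm z" using complex_Re_le_cmod[of z] z by linarith
  have c1: "norm c = 1" using c by auto
  have a: "norm (c / (8 * z)) \<le> 1 / 8" "norm (1 / (8 * z)) \<le> 1 / 8"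
    using z1 frac_le[of 1 1 8 "8 * norm z"] by (simp_all add: norm_divide norm_mult c1)
  have b: "norm (c / (8 * z\<^sup>2)) \<le> 1 / 8"
    using one_le_power[OF z1, of 2] frac_le[of 1 1 8 "8 * (norm z)\<^sup>2"]
    by (simp add: norm_divide norm_mult norm_power c1)
  have "norm (1 - c / (8 * z)) \<le> 2"
    using norm_triangle_ineq4[of 1 "c / (8 * z)"] a(1) by simp
  then show "norm (wkb c z) \<le> 2 * exp R"
    unfolding wkb_def norm_mult mult.commute[of 2] by (intro mult_mono norm_exp_strip[OF c z(2)]) simp_all
  have "norm (c + 1 / (8 * z) + c / (8 * z\<^sup>2)) \<le> 2"
    using norm_triangle_ineq[of "c + 1 / (8 * z)" "c / (8 * z\<^sup>2)"] norm_triangle_ineq[of c "1 / (8 * z)"] a(2) b c1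
    by linarith
  then show "norm (wkb' c z) \<le> 2 * exp R"
    unfolding wkb'_def norm_mult mult.commute[of 2] by (intro mult_mono norm_exp_strip[OF c z(2)]) simp_all
qed

text \<open>The limit is taken along the real axis and then carried over to each strip, where a
  vertical segment of length at most R changes the Wronskian by O(x^(-3)) only. Hence one L works
  for all R.\<close>

lemma liouville_W_limit:
  assumes c: "c = \<i> \<or> c = - \<i>"
  obtains L where "(\<lambda>j. liouville_W c (of_real (real j + 1))) \<longlonglongrightarrow> L"
    "\<And>R. \<exists>C. \<forall>z. Re z \<ge> 1 \<and> \<bar>Im z\<bar> \<le> R \<longrightarrow> norm (liouville_W c z - L) \<le> C / (Re z)\<^sup>2"
proof -
  have c2: "c\<^sup>2 = - 1" and c1: "norm c = 1" using c by auto
  have der_bound: "\<exists>M\<ge>0. \<forall>z. Re z \<ge> 1 \<and> \<bar>Im z\<bar> \<le> R \<longrightarrow>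
      norm (- liouville_Y z * exp (c * z) * (9 * c / 32) / z ^ 3) \<le> M / (Re z) ^ 3" for R
  proof -
    obtain B where B: "B \<ge> 0" "\<And>z. Re z \<ge> 1 \<Longrightarrow> \<bar>Im z\<bar> \<le> R \<Longrightarrow> norm (liouville_Y z) \<le> B"
      using liouville_bounded[of R] by metis
    show ?thesis
    proof (intro exI[of _ "B * exp R"] conjI allI impI)
      fix z assume z: "Re z \<ge> 1 \<and> \<bar>Im z\<bar> \<le> R"
      have "norm (- liouville_Y z * exp (c * z) * (9 * c / 32) / z ^ 3) =
          norm (liouville_Y z) * norm (exp (c * z)) * (9 / 32) / norm z ^ 3"
        by (simp add: norm_mult norm_divide norm_power c1)
      also have "\<dots> \<le> (B * exp R * 1) / (Re z) ^ 3"
        using z B complex_Re_le_cmod[of z] norm_exp_strip[OF c, of z R]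
        by (intro frac_le mult_mono power_mono) auto
      finally show "norm (- liouville_Y z * exp (c * z) * (9 * c / 32) / z ^ 3) \<le> B * exp R / (Re z) ^ 3" by simp
    qed (use B in simp)
  qed
  obtain M0 where M0: "M0 \<ge> 0" "\<And>z. Re z \<ge> 1 \<and> \<bar>Im z\<bar> \<le> 0 \<longrightarrow>
      norm (- liouville_Y z * exp (c * z) * (9 * c / 32) / z ^ 3) \<le> M0 / (Re z) ^ 3"
    using der_bound[of 0] by blast
  define f' where "f' x = - liouville_Y (of_real x) * exp (c * of_real x) * (9 * c / 32) / of_real x ^ 3" for x
  have d: "((\<lambda>x. liouville_W c (of_real x)) has_vector_derivative f' x) (at x)" if "x \<ge> 1" for x
    using has_vector_derivative_along_line[of "liouville_W c" _ 0 x 1, OF liouville_W_deriv[OF c2]] that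
    unfolding f'_def by simp
  have nf: "norm (f' x) \<le> M0 / x ^ 3" if "x \<ge> 1" for x
    using M0(2)[of "of_real x"] that unfolding f'_def by simp
  obtain L where L: "(\<lambda>j. liouville_W c (of_real (real j + 1))) \<longlonglongrightarrow> L"
    "\<And>x. x \<ge> 1 \<Longrightarrow> norm (liouville_W c (of_real x) - L) \<le> M0 / x\<^sup>2"
    using limit_of_integrable_derivative[OF d nf M0(1)] by blast
  have "\<exists>C. \<forall>z. Re z \<ge> 1 \<and> \<bar>Im z\<bar> \<le> R \<longrightarrow> norm (liouville_W c z - L) \<le> C / (Re z)\<^sup>2" for R
  proof -
    obtain M where M: "M \<ge> 0" "\<And>z. Re z \<ge> 1 \<and> \<bar>Im z\<bar> \<le> R \<longrightarrow>
        norm (- liouville_Y z * exp (c * z) * (9 * c / 32) / z ^ 3) \<le> M / (Re z) ^ 3"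
      using der_bound[of R] by blast
    show ?thesis
    proof (intro exI[of _ "M * R + M0"] allI impI)
      fix z assume z: "Re z \<ge> 1 \<and> \<bar>Im z\<bar> \<le> R"
      define x where "x = Re z"
      \<comment> \<open>The vertical segment Re w = x, |Im w| \<le> R, written as an intersection of
        half-planes to have convexity at hand.\<close>
      define S where "S = {w. Re w \<le> x} \<inter> {w. Re w \<ge> x} \<inter> {w. Im w \<le> R} \<inter> {w. Im w \<ge> - R}"
      have "convex S" unfolding S_def
        by (intro convex_Int convex_halfspace_Im_le convex_halfspace_Im_ge convex_halfspace_Re_le convex_halfspace_Re_ge)
      have "norm (liouville_W c z - liouville_W c (of_real x)) \<le> (M / x ^ 3) * norm (z - of_real x)"
      proof (rule field_differentiable_bound[OF \<open>convex S\<close>])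
        fix w assume w: "w \<in> S"
        then have Re: "Re w > 0" using z by (simp add: S_def x_def)
        show "(liouville_W c has_field_derivative - liouville_Y w * exp (c * w) * (9 * c / 32) / w ^ 3) (at w within S)"
          by (rule has_field_derivative_at_within[OF liouville_W_deriv[OF c2 Re]])
        have "Re w \<ge> 1 \<and> \<bar>Im w\<bar> \<le> R" "Re w = x" using w z by (auto simp: S_def x_def)
        then show "norm (- liouville_Y w * exp (c * w) * (9 * c / 32) / w ^ 3) \<le> M / x ^ 3" using M(2)[of w] by simp
      qed (use z in \<open>auto simp: S_def x_def\<close>)
      also have "\<dots> \<le> (M / x\<^sup>2) * R"
      proof (intro mult_mono divide_left_mono)
        show "x\<^sup>2 \<le> x ^ 3" using z by (intro power_increasing) (auto simp: x_def)
        have "z - of_real x = of_real (Im z) * \<i>" by (simp add: complex_eq_iff x_def)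
        then show "norm (z - of_real x) \<le> R" using z by (simp add: norm_mult)
      qed (use z M in \<open>auto simp: x_def\<close>)
      finally have "norm (liouville_W c z - liouville_W c (of_real x)) \<le> M * R / x\<^sup>2" by simp
      moreover have "norm (liouville_W c (of_real x) - L) \<le> M0 / x\<^sup>2" using L(2) z by (simp add: x_def)
      ultimately have "norm ((liouville_W c z - liouville_W c (of_real x)) + (liouville_W c (of_real x) - L))
          \<le> M * R / x\<^sup>2 + M0 / x\<^sup>2" by (rule norm_triangle_mono)
      then show "norm (liouville_W c z - L) \<le> (M * R + M0) / (Re z)\<^sup>2" by (simp add: x_def add_divide_distrib)
    qed
  qed
  with L(1) show thesis by (rule that)
qed

text \<open>The two approximate solutions are independent up to O(z^(-2)), so Y and Y' can be
  recovered from their Wronskians with them.\<close>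

lemma wkb_wronskian:
  assumes "z \<noteq> 0"
  shows "wkb' \<i> z * wkb (- \<i>) z - wkb' (- \<i>) z * wkb \<i> z = 2 * \<i> + 9 * \<i> / 32 / z\<^sup>2"
proof -
  have factor: "p * u * (q * v) - q * u' * (p * v') = u * v - u' * v'"
    if "p * q = 1" for p q u v u' v' :: complex
    using that by algebra
  have "exp (\<i> * z) * exp (- \<i> * z) = 1" by (simp add: exp_add[symmetric])
  from factor[OF this] have "wkb' \<i> z * wkb (- \<i>) z - wkb' (- \<i>) z * wkb \<i> z =
      (\<i> + 1 / (8 * z) + \<i> / (8 * z\<^sup>2)) * (1 - (- \<i>) / (8 * z)) -
      (- \<i> + 1 / (8 * z) + (- \<i>) / (8 * z\<^sup>2)) * (1 - \<i> / (8 * z))"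
    unfolding wkb_def wkb'_def by blast
  also have "\<dots> = 2 * \<i> + 9 * \<i> / 32 / z\<^sup>2"
    using assms by (simp add: field_simps power2_eq_square)
  finally show ?thesis .
qed

lemma liouville_real:
  assumes "x > 0"
  shows "liouville_Y (of_real x) \<in> \<real>" "liouville_Y' (of_real x) \<in> \<real>"
proof -
  have s: "csqrt (of_real x) = of_real (sqrt x)" using assms by simp
  have e: "bessel_E ((of_real x)\<^sup>2) \<in> \<real>" "bessel_E' ((of_real x)\<^sup>2) \<in> \<real>"
    using bessel_E_Reals[of "x\<^sup>2"] by simp_all
  show "liouville_Y (of_real x) \<in> \<real>" "liouville_Y' (of_real x) \<in> \<real>"
    unfolding liouville_Y_def liouville_Y'_def s using e by (auto intro!: Reals_add Reals_mult Reals_divide)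
qed

lemma cnj_wkb_real: "cnj (wkb c (of_real x)) = wkb (cnj c) (of_real x)"
  "cnj (wkb' c (of_real x)) = wkb' (cnj c) (of_real x)"
  by (simp_all add: wkb_def wkb'_def exp_cnj)

text \<open>Since J0(0) = 1, Y is nonzero at some small a > 0, and the backward energy estimate
  propagates this to infinity.\<close>

lemma liouville_energy_lower:
  obtains m X where "m > 0" "\<And>x. x \<ge> X \<Longrightarrow> m \<le> liouville_energy (of_real x)"
proof -
  have "((\<lambda>x. bessel_E ((of_real x)\<^sup>2)) \<longlongrightarrow> bessel_E ((of_real 0)\<^sup>2)) (at_right (0::real))"
    by (intro isCont_tendsto_compose[of _ bessel_E] tendsto_intros) (use DERIV_isCont[OF bessel_E_deriv] in auto)
  then have "((\<lambda>x. bessel_E ((of_real x)\<^sup>2)) \<longlongrightarrow> 1) (at_right (0::real))" by (simp add: bessel_E_0)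
  then have "\<forall>\<^sub>F x in at_right (0::real). bessel_E ((of_real x)\<^sup>2) \<noteq> 0"
    by (rule tendsto_imp_eventually_ne) simp
  then have "\<forall>\<^sub>F x in at_right (0::real). bessel_E ((of_real x)\<^sup>2) \<noteq> 0 \<and> x > 0"
    using eventually_at_right_less by (rule eventually_conj)
  then obtain a :: real where a: "bessel_E ((of_real a)\<^sup>2) \<noteq> 0" "a > 0"
    using eventually_happens trivial_limit_at_right_real by blast
  have "liouville_Y (of_real a) \<noteq> 0" using a by (simp add: liouville_Y_def)
  then have pos: "liouville_energy (of_real a) > 0"
    unfolding liouville_energy_eq by (intro add_pos_nonneg) auto
  show thesis
  proof (rule that[of "liouville_energy (of_real a) / exp (1 / (4 * a))" a])
    fix x assume "x \<ge> a"
    from liouville_energy_real_axis(2)[OF a(2) this]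
    show "liouville_energy (of_real a) / exp (1 / (4 * a)) \<le> liouville_energy (of_real x)"
      by (simp add: pos_divide_le_eq)
  qed (use pos in simp)
qed

lemma liouville_asymptotics:
  obtains A \<delta> :: real where "A \<noteq> 0"
    "\<And>R. \<exists>C. \<forall>z. Re z \<ge> 1 \<and> \<bar>Im z\<bar> \<le> R \<longrightarrow>
      norm (liouville_Y z - of_real A * (cos (z - of_real \<delta>) + sin (z - of_real \<delta>) / (8 * z))) \<le> C / (Re z)\<^sup>2 \<and>
      norm (liouville_Y' z - of_real A * (cos (z - of_real \<delta>) / (8 * z) - sin (z - of_real \<delta>))) \<le> C / (Re z)\<^sup>2"
proof -
  obtain L1 where L1: "(\<lambda>j. liouville_W \<i> (of_real (real j + 1))) \<longlonglongrightarrow> L1"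
    "\<And>R. \<exists>C. \<forall>z. Re z \<ge> 1 \<and> \<bar>Im z\<bar> \<le> R \<longrightarrow> norm (liouville_W \<i> z - L1) \<le> C / (Re z)\<^sup>2"
    using liouville_W_limit[of \<i>] by blast
  obtain L2 where L2: "(\<lambda>j. liouville_W (- \<i>) (of_real (real j + 1))) \<longlonglongrightarrow> L2"
    "\<And>R. \<exists>C. \<forall>z. Re z \<ge> 1 \<and> \<bar>Im z\<bar> \<le> R \<longrightarrow> norm (liouville_W (- \<i>) z - L2) \<le> C / (Re z)\<^sup>2"
    using liouville_W_limit[of "- \<i>"] by blast
  \<comment> \<open>Y and Y' are real on the positive axis, so the Wronskians with the two
    exponentials are conjugate there, and so are their limits. This is what makes the amplitude A
    and the phase \<delta> real.\<close>
  have "liouville_W (- \<i>) (of_real (real j + 1)) = cnj (liouville_W \<i> (of_real (real j + 1)))" for j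
    using liouville_real[of "real j + 1"]
    unfolding liouville_W_def complex_cnj_diff complex_cnj_mult cnj_wkb_real Reals_cnj_iff by simp
  then have "(\<lambda>j. liouville_W (- \<i>) (of_real (real j + 1))) \<longlonglongrightarrow> cnj L1"
    using tendsto_cnj[OF L1(1)] by simp
  with L2(1) have L21: "L2 = cnj L1" by (rule LIMSEQ_unique)
  \<comment> \<open>If Y were exactly \<open>a * wkb \<i> z + cnj a * wkb (- \<i>) z\<close> with
    exact Wronskian 2 \<i> between the exponentials, the limits would be L2 = - 2 \<i> a and L1 = 2
    \<i> \<open>cnj a\<close>. Modulus and argument of a then give A and \<delta>.\<close>
  define a where "a = - L2 / (2 * \<i>)"
  have L2a: "L2 = - (2 * \<i>) * a" and L1a: "L1 = 2 * \<i> * cnj a"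
    using L21 by (simp_all add: a_def)
  define A where "A = 2 * norm a"
  define \<delta> where "\<delta> = - Arg a"
  have aA: "a = of_real (A / 2) * exp (- \<i> * of_real \<delta>)"
    using Arg_eq[of a] by (cases "a = 0") (simp_all add: A_def \<delta>_def mult_ac)
  have cA: "cnj a = of_real (A / 2) * exp (\<i> * of_real \<delta>)"
    by (subst aA) (simp add: exp_cnj)
  have YA: "a * wkb \<i> z + cnj a * wkb (- \<i>) z =
      of_real A * (cos (z - of_real \<delta>) + sin (z - of_real \<delta>) / (8 * z))" if "z \<noteq> 0" for z
  proof -
    define p where "p = exp (\<i> * (z - of_real \<delta>))" define q where "q = exp (- (\<i> * (z - of_real \<delta>)))"
    have cs: "cos (z - of_real \<delta>) = (p + q) / 2" "sin (z - of_real \<delta>) = (p - q) / (2 * \<i>)"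
      by (simp_all add: p_def q_def cos_exp_eq sin_exp_eq)
    have p: "exp (- \<i> * of_real \<delta>) * exp (\<i> * z) = p" and q: "exp (\<i> * of_real \<delta>) * exp (- \<i> * z) = q"
      by (simp_all add: p_def q_def exp_add[symmetric] algebra_simps)
    have "a * wkb \<i> z + cnj a * wkb (- \<i>) z = of_real (A / 2) *
        ((exp (- \<i> * of_real \<delta>) * exp (\<i> * z)) * (1 - \<i> / (8 * z)) +
         (exp (\<i> * of_real \<delta>) * exp (- \<i> * z)) * (1 + \<i> / (8 * z)))"
      unfolding cA by (subst aA) (simp add: wkb_def algebra_simps)
    also have "\<dots> = of_real (A / 2) * (p * (1 - \<i> / (8 * z)) + q * (1 + \<i> / (8 * z)))" by (simp only: p q)
    also have "\<dots> = of_real A * (cos (z - of_real \<delta>) + sin (z - of_real \<delta>) / (8 * z))"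
      unfolding cs using that by (simp add: field_simps)
    finally show ?thesis .
  qed
  have YA': "a * wkb' \<i> z + cnj a * wkb' (- \<i>) z =
      of_real A * (cos (z - of_real \<delta>) / (8 * z) - sin (z - of_real \<delta>)) -
      of_real A * sin (z - of_real \<delta>) / (8 * z\<^sup>2)" if "z \<noteq> 0" for z
  proof -
    define p where "p = exp (\<i> * (z - of_real \<delta>))" define q where "q = exp (- (\<i> * (z - of_real \<delta>)))"
    have cs: "cos (z - of_real \<delta>) = (p + q) / 2" "sin (z - of_real \<delta>) = (p - q) / (2 * \<i>)"
      by (simp_all add: p_def q_def cos_exp_eq sin_exp_eq)
    have p: "exp (- \<i> * of_real \<delta>) * exp (\<i> * z) = p" and q: "exp (\<i> * of_real \<delta>) * exp (- \<i> * z) = q"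
      by (simp_all add: p_def q_def exp_add[symmetric] algebra_simps)
    have "a * wkb' \<i> z + cnj a * wkb' (- \<i>) z = of_real (A / 2) *
        ((exp (- \<i> * of_real \<delta>) * exp (\<i> * z)) * (\<i> + 1 / (8 * z) + \<i> / (8 * z\<^sup>2)) +
         (exp (\<i> * of_real \<delta>) * exp (- \<i> * z)) * (- \<i> + 1 / (8 * z) - \<i> / (8 * z\<^sup>2)))"
      unfolding cA by (subst aA) (simp add: wkb'_def algebra_simps)
    also have "\<dots> = of_real (A / 2) * (p * (\<i> + 1 / (8 * z) + \<i> / (8 * z\<^sup>2)) + q * (- \<i> + 1 / (8 * z) - \<i> / (8 * z\<^sup>2)))"
      by (simp only: p q)
    also have "\<dots> = of_real A * (cos (z - of_real \<delta>) / (8 * z) - sin (z - of_real \<delta>)) -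
      of_real A * sin (z - of_real \<delta>) / (8 * z\<^sup>2)"
      unfolding cs using that by (simp add: field_simps power2_eq_square)
    finally show ?thesis .
  qed
  have main: "\<exists>C. \<forall>z. Re z \<ge> 1 \<and> \<bar>Im z\<bar> \<le> R \<longrightarrow>
      norm (liouville_Y z - of_real A * (cos (z - of_real \<delta>) + sin (z - of_real \<delta>) / (8 * z))) \<le> C / (Re z)\<^sup>2 \<and>
      norm (liouville_Y' z - of_real A * (cos (z - of_real \<delta>) / (8 * z) - sin (z - of_real \<delta>))) \<le> C / (Re z)\<^sup>2" for R
  proof -
    obtain C1 where C1: "\<And>z. Re z \<ge> 1 \<and> \<bar>Im z\<bar> \<le> R \<longrightarrow> norm (liouville_W \<i> z - L1) \<le> C1 / (Re z)\<^sup>2"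
      using L1(2)[of R] by blast
    obtain C2 where C2: "\<And>z. Re z \<ge> 1 \<and> \<bar>Im z\<bar> \<le> R \<longrightarrow> norm (liouville_W (- \<i>) z - L2) \<le> C2 / (Re z)\<^sup>2"
      using L2(2)[of R] by blast
    obtain B where B: "B \<ge> 0" "\<And>z. Re z \<ge> 1 \<Longrightarrow> \<bar>Im z\<bar> \<le> R \<Longrightarrow> norm (liouville_Y z) \<le> B \<and> norm (liouville_Y' z) \<le> B"
      using liouville_bounded[of R] by metis
    define C where "C = (C1 * (2 * exp R) + C2 * (2 * exp R) + B + \<bar>A\<bar> * exp R)"
    show ?thesis
    proof (intro exI[of _ C] allI impI)
      fix z assume z: "Re z \<ge> 1 \<and> \<bar>Im z\<bar> \<le> R"
      then have z0: "z \<noteq> 0" by auto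
      define X where "X = (Re z)\<^sup>2"
      have X: "X > 0" "X \<le> (norm z)\<^sup>2"
        using z complex_Re_le_cmod[of z] by (auto simp: X_def intro!: power_mono)
      have w0: "norm (9 * \<i> / 32 / z\<^sup>2) \<le> 1 / X"
      proof -
        have "(9 / 32) / (norm z)\<^sup>2 \<le> 1 / X" using X by (intro frac_le) auto
        then show ?thesis by (simp add: norm_divide norm_power norm_mult)
      qed
      \<comment> \<open>Cramer's rule, for y = Y and for y = Y': y is a combination of the two
        Wronskians over the denominator 2 \<i> + O(z^(-2)). Replacing the Wronskians by their limits
        and the denominator by 2 \<i> costs O((Re z)^(-2)).\<close>
      have est: "norm (y - (a * f + cnj a * g)) \<le> (C1 * (2 * exp R) + C2 * (2 * exp R) + B) / X"
        if eq: "y * (2 * \<i> + 9 * \<i> / 32 / z\<^sup>2) = liouville_W \<i> z * g - liouville_W (- \<i>) z * f"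
          and y: "norm y \<le> B" and fg: "norm f \<le> 2 * exp R" "norm g \<le> 2 * exp R" for y f g
      proof -
        have "2 * \<i> * (y - (a * f + cnj a * g)) =
            (liouville_W \<i> z - L1) * g - (liouville_W (- \<i>) z - L2) * f - y * (9 * \<i> / 32 / z\<^sup>2)"
          unfolding L1a L2a using eq by (simp add: algebra_simps)
        then have "norm (2 * \<i> * (y - (a * f + cnj a * g))) =
            norm ((liouville_W \<i> z - L1) * g - (liouville_W (- \<i>) z - L2) * f - y * (9 * \<i> / 32 / z\<^sup>2))"
          by (simp only:)
        then have "2 * norm (y - (a * f + cnj a * g)) =
            norm ((liouville_W \<i> z - L1) * g - (liouville_W (- \<i>) z - L2) * f - y * (9 * \<i> / 32 / z\<^sup>2))"
          by (simp only: norm_mult norm_ii norm_numeral mult_1_right)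
        also have "\<dots> \<le> norm ((liouville_W \<i> z - L1) * g) + norm ((liouville_W (- \<i>) z - L2) * f) + norm (y * (9 * \<i> / 32 / z\<^sup>2))"
          by (rule order_trans[OF norm_triangle_ineq4 add_right_mono[OF norm_triangle_ineq4]])
        also have "\<dots> \<le> C1 / X * (2 * exp R) + C2 / X * (2 * exp R) + B * (1 / X)"
          unfolding norm_mult[of "liouville_W _ _ - _"] norm_mult[of y]
        proof (intro add_mono mult_mono)
          show W1: "norm (liouville_W \<i> z - L1) \<le> C1 / X" and W2: "norm (liouville_W (- \<i>) z - L2) \<le> C2 / X"
            using C1[of z] C2[of z] z by (simp_all add: X_def)
          show "0 \<le> C1 / X" "0 \<le> C2 / X" using W1 W2 norm_ge_zero order_trans by blast+
        qed (use y fg B w0 in auto)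
        finally have "2 * norm (y - (a * f + cnj a * g)) \<le> (C1 * (2 * exp R) + C2 * (2 * exp R) + B) / X"
          by (simp add: add_divide_distrib)
        then show ?thesis using norm_ge_zero[of "y - (a * f + cnj a * g)"] by linarith
      qed
      \<comment> \<open>The z^(-2) term left over in \<open>YA'\<close> is moved into the
        remainder.\<close>
      have s: "norm (of_real A * sin (z - of_real \<delta>) / (8 * z\<^sup>2)) \<le> \<bar>A\<bar> * exp R / X"
      proof -
        have "norm (sin (z - of_real \<delta>)) \<le> exp R"
        proof -
          have "norm (sin (z - of_real \<delta>)) \<le> exp \<bar>Im (z - of_real \<delta>)\<bar>" by (rule norm_sin_le_exp)
          also have "\<dots> \<le> exp R" using z by simp
          finally show ?thesis .
        qed
        then have "\<bar>A\<bar> * norm (sin (z - of_real \<delta>)) / (8 * (norm z)\<^sup>2) \<le> \<bar>A\<bar> * exp R / X"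
          using X by (intro frac_le mult_left_mono) auto
        then show ?thesis by (simp add: norm_mult norm_divide norm_power)
      qed
      have fg: "norm (wkb \<i> z) \<le> 2 * exp R" "norm (wkb (- \<i>) z) \<le> 2 * exp R"
        "norm (wkb' \<i> z) \<le> 2 * exp R" "norm (wkb' (- \<i>) z) \<le> 2 * exp R"
        using z by (auto intro!: wkb_bound)
      have 1: "norm (liouville_Y z - of_real A * (cos (z - of_real \<delta>) + sin (z - of_real \<delta>) / (8 * z)))
          \<le> (C1 * (2 * exp R) + C2 * (2 * exp R) + B) / X"
        unfolding YA[OF z0, symmetric]
      proof (rule est)
        show "liouville_Y z * (2 * \<i> + 9 * \<i> / 32 / z\<^sup>2) = liouville_W \<i> z * wkb (- \<i>) z - liouville_W (- \<i>) z * wkb \<i> z"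
          unfolding wkb_wronskian[OF z0, symmetric] liouville_W_def by (simp add: algebra_simps)
      qed (use B z fg in auto)
      have 2: "norm (liouville_Y' z - (of_real A * (cos (z - of_real \<delta>) / (8 * z) - sin (z - of_real \<delta>)) -
          of_real A * sin (z - of_real \<delta>) / (8 * z\<^sup>2)))
          \<le> (C1 * (2 * exp R) + C2 * (2 * exp R) + B) / X"
        unfolding YA'[OF z0, symmetric]
      proof (rule est)
        show "liouville_Y' z * (2 * \<i> + 9 * \<i> / 32 / z\<^sup>2) = liouville_W \<i> z * wkb' (- \<i>) z - liouville_W (- \<i>) z * wkb' \<i> z"
          unfolding wkb_wronskian[OF z0, symmetric] liouville_W_def by (simp add: algebra_simps)
      qed (use B z fg in auto)
      have Csplit: "C / X = (C1 * (2 * exp R) + C2 * (2 * exp R) + B) / X + \<bar>A\<bar> * exp R / X"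
        by (simp add: C_def add_divide_distrib)
      have "0 \<le> \<bar>A\<bar> * exp R / X" using X by simp
      with 1 Csplit have "norm (liouville_Y z - of_real A * (cos (z - of_real \<delta>) + sin (z - of_real \<delta>) / (8 * z))) \<le> C / X"
        by linarith
      moreover have "norm (liouville_Y' z - of_real A * (cos (z - of_real \<delta>) / (8 * z) - sin (z - of_real \<delta>))) \<le> C / X"
      proof -
        have tri: "norm (y - p) \<le> c + d" if "norm (y - (p - r)) \<le> c" "norm r \<le> d" for y p r :: complex and c d
          using norm_triangle_mono[OF that(1), of "- r" d] that(2) by (simp add: algebra_simps)
        show ?thesis unfolding Csplit by (rule tri[OF 2 s])
      qed
      ultimately show "norm (liouville_Y z - of_real A * (cos (z - of_real \<delta>) + sin (z - of_real \<delta>) / (8 * z))) \<le> C / (Re z)\<^sup>2 \<and>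
          norm (liouville_Y' z - of_real A * (cos (z - of_real \<delta>) / (8 * z) - sin (z - of_real \<delta>))) \<le> C / (Re z)\<^sup>2"
        by (simp add: X_def)
    qed
  qed
  \<comment> \<open>For A = 0 both Y and Y' would be O(x^(-2)) on the real axis, against the
    positive lower bound for the energy.\<close>
  have "A \<noteq> 0"
  proof
    assume A0: "A = 0"
    obtain C where C: "\<And>z. Re z \<ge> 1 \<and> \<bar>Im z\<bar> \<le> 0 \<longrightarrow> norm (liouville_Y z) \<le> C / (Re z)\<^sup>2 \<and> norm (liouville_Y' z) \<le> C / (Re z)\<^sup>2"
      using main[of 0] unfolding A0 by auto
    obtain m X where m: "m > 0" "\<And>x. x \<ge> X \<Longrightarrow> m \<le> liouville_energy (of_real x)"
      using liouville_energy_lower by blast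
    have "((\<lambda>x. 2 * (C / x\<^sup>2)\<^sup>2) \<longlongrightarrow> 2 * 0\<^sup>2) at_top"
      by (intro tendsto_intros tendsto_divide_0[OF tendsto_const] filterlim_at_top_imp_at_infinity
          filterlim_pow_at_top filterlim_ident) simp
    then have "\<forall>\<^sub>F x in at_top. 2 * (C / x\<^sup>2)\<^sup>2 < m" using m(1) by (intro order_tendstoD(2)) auto
    then have "\<forall>\<^sub>F x in at_top. 2 * (C / x\<^sup>2)\<^sup>2 < m \<and> x \<ge> X \<and> x \<ge> 1"
      by (intro eventually_conj eventually_ge_at_top)
    then obtain x where x: "2 * (C / x\<^sup>2)\<^sup>2 < m" "x \<ge> X" "x \<ge> 1"
      using eventually_happens[of _ at_top] trivial_limit_at_top_linorder by blast
    have "liouville_energy (of_real x) \<le> (C / x\<^sup>2)\<^sup>2 + (C / x\<^sup>2)\<^sup>2"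
      unfolding liouville_energy_eq using C[of "of_real x"] x by (intro add_mono power_mono) auto
    with m(2)[OF x(2)] x(1) show False by simp
  qed
  then show thesis using that main by blast
qed

section \<open>Nonreal zeros of the leading phase\<close>

text \<open>If infinitely many members had no zero in the ball, Hurwitz's theorem along that
  subsequence would make g zero-free or constant. The zero of g with nonzero derivative excludes
  both.\<close>

lemma hurwitz_zero_persists:
  fixes F :: "nat \<Rightarrow> complex \<Rightarrow> complex"
  assumes r: "r > 0" and hol: "\<forall>\<^sub>F j in sequentially. F j holomorphic_on ball z0 r"
    and g: "g holomorphic_on ball z0 r" and lim: "uniform_limit (ball z0 r) F g sequentially"
    and zero: "g z0 = 0" and deriv: "(g has_field_derivative d) (at z0)" "d \<noteq> 0"
  shows "\<forall>\<^sub>F j in sequentially. \<exists>z\<in>ball z0 r. F j z = 0"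
proof (rule ccontr)
  assume "\<not> ?thesis"
  then have "\<exists>\<^sub>F j in sequentially. (\<forall>z\<in>ball z0 r. F j z \<noteq> 0) \<and> F j holomorphic_on ball z0 r"
    unfolding not_eventually using hol by (auto elim: frequently_rev_mp eventually_mono)
  then have "infinite {j. (\<forall>z\<in>ball z0 r. F j z \<noteq> 0) \<and> F j holomorphic_on ball z0 r}"
    unfolding cofinite_eq_sequentially[symmetric] frequently_cofinite .
  from infinite_enumerate[OF this] obtain s :: "nat \<Rightarrow> nat" where mono: "strict_mono s"
    and mem: "\<forall>j. s j \<in> {j. (\<forall>z\<in>ball z0 r. F j z \<noteq> 0) \<and> F j holomorphic_on ball z0 r}"
    by blast
  then have s: "strict_mono s" "\<And>j z. z \<in> ball z0 r \<Longrightarrow> F (s j) z \<noteq> 0"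
    "\<And>j. F (s j) holomorphic_on ball z0 r" by blast+
  have "g z0 \<noteq> 0"
  proof (rule Hurwitz_no_zeros[where S="ball z0 r" and \<F>="\<lambda>j. F (s j)" and g=g])
    show "uniform_limit K (\<lambda>j. F (s j)) g sequentially" if "K \<subseteq> ball z0 r" for K
    proof -
      have "uniform_limit K F g sequentially" using uniform_limit_on_subset[OF lim that] .
      then have "filterlim F (uniformly_on K g) sequentially" .
      from filterlim_compose[OF this filterlim_subseq[OF s(1)]] show ?thesis by (simp add: o_def)
    qed
    show "\<not> g constant_on ball z0 r"
    proof
      assume "g constant_on ball z0 r"
      then obtain c where c: "\<And>z. z \<in> ball z0 r \<Longrightarrow> g z = c" unfolding constant_on_def by blast
      have "(g has_field_derivative 0) (at z0)"
        by (rule has_field_derivative_transform_within_open[where S="ball z0 r", OF DERIV_const[of c]])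
          (use r c in auto)
      then show False using deriv DERIV_unique by blast
    qed
  qed (use r g s in auto)
  with zero show False by simp
qed

lemma uniform_limit_scalar:
  fixes c :: "nat \<Rightarrow> 'a::metric_space"
  assumes "c \<longlonglongrightarrow> l" shows "uniform_limit X (\<lambda>j w. c j) (\<lambda>w. l) sequentially"
  unfolding uniform_limit_iff
proof (intro allI impI)
  fix e :: real assume "e > 0"
  from tendstoD[OF assms this] show "\<forall>\<^sub>F j in sequentially. \<forall>x\<in>X. dist (c j) l < e"
    by (rule eventually_mono) simp
qed

lemma bounded_image_ball:
  fixes f :: "complex \<Rightarrow> complex"
  assumes "continuous_on UNIV f" shows "bounded (f ` ball z r)"
proof -
  have "bounded (f ` cball z r)"
    by (intro compact_imp_bounded compact_continuous_image continuous_on_subset[OF assms]) auto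
  then show ?thesis by (rule bounded_subset) auto
qed

text \<open>The leading part of the determinant, recentred by w = k - \<delta>; there the phase is b
  = a \<delta> - \<delta>. Detaching b from this value provides the parameter of the
  deformation.\<close>

definition phase_det :: "real \<Rightarrow> real \<Rightarrow> complex \<Rightarrow> complex" where
  "phase_det a b w = sin w * cos (of_real a * w + of_real b) - of_real a * cos w * sin (of_real a * w + of_real b)"

text \<open>The products of sines cancel. For 0 < a < 1 the critical points are therefore real,
  because cosine has real zeros only, and each nonreal zero is simple.\<close>

lemma phase_det_deriv:
  "(phase_det a b has_field_derivative of_real (1 - a\<^sup>2) * cos w * cos (of_real a * w + of_real b)) (at w)"
  unfolding phase_det_def[abs_def]
  by (auto intro!: derivative_eq_intros simp: algebra_simps power2_eq_square)

lemma phase_det_holomorphic: "phase_det a b holomorphic_on S"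
  unfolding phase_det_def[abs_def] by (intro holomorphic_intros)

lemma cos_nonreal_nonzero: "Im z \<noteq> 0 \<Longrightarrow> cos z \<noteq> 0"
  by (auto simp: cos_eq_0)

lemma phase_det_deriv_nonzero:
  assumes "0 < a" "a < 1" "Im w \<noteq> 0"
  shows "of_real (1 - a\<^sup>2) * cos w * cos (of_real a * w + of_real b) \<noteq> 0"
proof -
  have "a\<^sup>2 < 1" using assms by (simp add: power_less_one_iff abs_square_less_1)
  moreover have "cos (of_real a * w + of_real b) \<noteq> 0" using assms by (intro cos_nonreal_nonzero) simp
  moreover have "cos w \<noteq> 0" using assms by (intro cos_nonreal_nonzero)
  ultimately show ?thesis
    by (metis diff_gt_0_iff_gt less_irrefl mult_eq_0_iff of_real_eq_0_iff)
qed

text \<open>Here b enters only through the scalars cos b and sin b, so convergence of phases gives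
  convergence of the functions, uniformly on balls.\<close>

lemma phase_det_split:
  "phase_det a b w = of_real (cos b) * (sin w * cos (of_real a * w) - of_real a * cos w * sin (of_real a * w))
    - of_real (sin b) * (sin w * sin (of_real a * w) + of_real a * cos w * cos (of_real a * w))"
  unfolding phase_det_def cos_add sin_add by (simp add: algebra_simps cos_of_real sin_of_real)

text \<open>Splits the function into the frequencies 1 + a and 1 - a. Away from the real axis the
  faster one dominates; on the imaginary axis with b = \<pi> / 2 both sines become real hyperbolic
  cosines.\<close>

lemma phase_det_sum:
  "2 * phase_det a b w = of_real (1 - a) * sin (of_real (1 + a) * w + of_real b)
     + of_real (1 + a) * sin (of_real (1 - a) * w - of_real b)"
proof -
  define u where "u = of_real a * w + of_real b"
  have "of_real (1 + a) * w + of_real b = w + u" "of_real (1 - a) * w - of_real b = w - u"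
    by (simp_all add: u_def algebra_simps)
  then show ?thesis
    unfolding phase_det_def u_def[symmetric] by (simp only: sin_add sin_diff) (simp add: algebra_simps)
qed

lemma norm_sin_ge: "Im z \<ge> 0 \<Longrightarrow> (exp (Im z) - 1) / 2 \<le> norm (sin z)"
proof -
  assume z: "Im z \<ge> 0"
  have "norm (exp (- (\<i> * z))) - norm (exp (\<i> * z)) \<le> norm (exp (\<i> * z) - exp (- (\<i> * z)))"
    using norm_triangle_ineq2[of "exp (- (\<i> * z))" "exp (\<i> * z)"] by (simp add: norm_minus_commute)
  moreover have "norm (exp (- (\<i> * z))) = exp (Im z)" "norm (exp (\<i> * z)) \<le> 1" using z by auto
  ultimately have "exp (Im z) - 1 \<le> norm (exp (\<i> * z) - exp (- (\<i> * z)))" by linarith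
  then show ?thesis by (simp add: sin_exp_eq norm_divide norm_mult)
qed

text \<open>At a zero the two summands of \<open>phase_det_sum\<close> have equal modulus, yet the
  first grows like exp ((1 + a) y) and the second at most like exp ((1 - a) y). The bound does not
  depend on b, which supplies the compactness for the deformation.\<close>

lemma phase_det_zero_Im_bound:
  assumes a: "0 < a" "a < 1" and w: "Im w > 0" and zero: "phase_det a b w = 0"
  shows "Im w \<le> (2 * (1 + a) / (1 - a) + 1) / (2 * a)"
proof -
  define y where "y = Im w"
  have "of_real (1 - a) * sin (of_real (1 + a) * w + of_real b) =
      - (of_real (1 + a) * sin (of_real (1 - a) * w - of_real b))"
    using phase_det_sum[of a b w] zero by (simp add: eq_neg_iff_add_eq_0)
  then have "norm (of_real (1 - a) * sin (of_real (1 + a) * w + of_real b)) =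
      norm (of_real (1 + a) * sin (of_real (1 - a) * w - of_real b))" by (simp only: norm_minus_cancel)
  then have eq: "(1 - a) * norm (sin (of_real (1 + a) * w + of_real b)) =
      (1 + a) * norm (sin (of_real (1 - a) * w - of_real b))"
    using a unfolding norm_mult norm_of_real by simp
  have "(1 - a) * ((exp ((1 + a) * y) - 1) / 2) \<le> (1 - a) * norm (sin (of_real (1 + a) * w + of_real b))"
    using norm_sin_ge[of "of_real (1 + a) * w + of_real b"] a w by (intro mult_left_mono) (auto simp: y_def)
  also have "\<dots> \<le> (1 + a) * exp ((1 - a) * y)"
    unfolding eq using norm_sin_le_exp[of "of_real (1 - a) * w - of_real b"] a w
    by (intro mult_left_mono) (auto simp: y_def abs_mult)
  finally have "exp ((1 + a) * y) - 1 \<le> 2 * (1 + a) / (1 - a) * exp ((1 - a) * y)" using a by (simp add: field_simps)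
  moreover have "exp ((1 + a) * y) = exp (2 * a * y) * exp ((1 - a) * y)"
    by (simp add: exp_add[symmetric] algebra_simps)
  moreover have "1 \<le> exp ((1 - a) * y)" using a w by (simp add: y_def)
  ultimately have "exp (2 * a * y) * exp ((1 - a) * y) \<le> (2 * (1 + a) / (1 - a) + 1) * exp ((1 - a) * y)"
    unfolding distrib_right by linarith
  then have "exp (2 * a * y) \<le> 2 * (1 + a) / (1 - a) + 1" by simp
  moreover have "2 * a * y \<le> exp (2 * a * y)" using exp_ge_add_one_self[of "2 * a * y"] by linarith
  ultimately have "2 * a * y \<le> 2 * (1 + a) / (1 - a) + 1" by linarith
  then show ?thesis using a by (simp add: y_def pos_le_divide_eq mult_ac)
qed

text \<open>The window for b says that a x + b passes \<pi> / 2 at a point c strictly inside (-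
  \<pi> / 2, \<pi> / 2). The derivative is nonnegative before c and nonpositive after it, and the
  maximal value - a cos c is negative.\<close>

lemma phase_det_real_neg:
  assumes a: "0 < a" "a < 1" and b: "\<bar>b - pi / 2\<bar> < a * pi / 2" and x: "\<bar>x\<bar> \<le> pi / 2"
  shows "sin x * cos (a * x + b) - a * cos x * sin (a * x + b) < 0"
proof -
  define f where "f x = sin x * cos (a * x + b) - a * cos x * sin (a * x + b)" for x
  have f': "(f has_real_derivative (1 - a\<^sup>2) * cos t * cos (a * t + b)) (at t)" for t
    unfolding f_def by (auto intro!: derivative_eq_intros simp: algebra_simps power2_eq_square)
  define c where "c = (pi / 2 - b) / a"
  have ac: "a * c + b = pi / 2" using a by (simp add: c_def)
  have "\<bar>c\<bar> * a < pi / 2 * a" using b a by (simp add: c_def abs_divide abs_minus_commute mult.commute)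
  then have c: "\<bar>c\<bar> < pi / 2" using a by simp
  have fc: "f c < 0" unfolding f_def ac using a c cos_gt_zero_pi[of c] by auto
  have a2: "1 - a\<^sup>2 \<ge> 0" using a by (simp add: power_le_one)
  have api: "a * pi < pi" using a by simp
  have b1: "pi / 2 - a * pi / 2 < b" "b < pi / 2 + a * pi / 2" using b unfolding abs_less_iff by linarith+
  have "f x \<le> f c"
  proof (cases "x \<le> c")
    case True
    show ?thesis
    proof (rule DERIV_nonneg_imp_nondecreasing[OF True])
      fix t assume t: "x \<le> t" "t \<le> c"
      have "a * t \<le> a * c" "a * (- (pi / 2)) \<le> a * t" using t x a by (intro mult_left_mono; simp)+
      then have "cos (a * t + b) \<ge> 0"
        using ac b1 api by (intro cos_ge_zero) linarith+
      moreover have "cos t \<ge> 0" using t x c by (intro cos_ge_zero) auto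
      ultimately have "(1 - a\<^sup>2) * cos t * cos (a * t + b) \<ge> 0" using a2 by simp
      then show "\<exists>y. (f has_real_derivative y) (at t) \<and> 0 \<le> y" using f' by blast
    qed
  next
    case False
    show ?thesis
    proof (rule DERIV_nonpos_imp_nonincreasing[of c x])
      fix t assume t: "c \<le> t" "t \<le> x"
      have "a * c \<le> a * t" "a * t \<le> a * (pi / 2)" using t x a by (intro mult_left_mono; simp)+
      then have "0 \<le> cos (a * t + b - pi)"
        using ac b1 api by (intro cos_ge_zero) linarith+
      then have "cos (a * t + b) \<le> 0" by (simp add: cos_diff)
      moreover have "cos t \<ge> 0" using t x c by (intro cos_ge_zero) auto
      ultimately have "(1 - a\<^sup>2) * cos t * cos (a * t + b) \<le> 0" using a2 by (simp add: mult_nonneg_nonpos)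
      then show "\<exists>y. (f has_real_derivative y) (at t) \<and> y \<le> 0" using f' by blast
    qed (use False in simp)
  qed
  then show ?thesis using fc by (simp add: f_def)
qed

text \<open>On the sides cos (Re w) = 0, and for w = \<plusminus>\<pi> / 2 + i y the real part is
  \<plusminus>cos X (cosh y cosh (a y) - a sinh y sinh (a y)), where X is the real part of a w + b.
  The bracket is positive because a < 1, and the strict inequality for b makes cos X
  nonzero.\<close>

lemma phase_det_side_nonzero:
  assumes a: "0 < a" "a < 1" and b: "\<bar>b - pi / 2\<bar> < a * pi / 2"
    and w: "Re w = s * (pi / 2)" "s = 1 \<or> s = - 1" "Im w \<ge> 0"
  shows "phase_det a b w \<noteq> 0"
proof
  assume zero: "phase_det a b w = 0"
  define y where "y = Im w" define X where "X = s * (a * pi / 2) + b"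
  have api: "a * pi < pi" using a by simp
  have b1: "pi / 2 - a * pi / 2 < b" "b < pi / 2 + a * pi / 2" using b unfolding abs_less_iff by linarith+
  have cX: "cos X \<noteq> 0"
  proof (cases "s = 1")
    case True
    have "cos (X - pi) > 0" unfolding X_def True mult_1_left using b1 api by (intro cos_gt_zero_pi) linarith+
    then show ?thesis by (simp add: cos_diff)
  next
    case False
    then have "s = - 1" using w(2) by simp
    then have "X = b - a * pi / 2" by (simp add: X_def)
    then have "cos X > 0" using b1 api by (intro cos_gt_zero_pi) linarith+
    then show ?thesis by simp
  qed
  define u where "u = of_real a * w + of_real b"
  have u: "Re u = X" "Im u = a * y" using w by (simp_all add: X_def y_def u_def)
  have sw: "sin (Re w) = s" "cos (Re w) = 0" using w(2) by (auto simp: w(1))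
  let ?c = "\<lambda>t::real. (exp t + exp (- t)) / 2" let ?s = "\<lambda>t::real. (exp t - exp (- t)) / 2"
  have "Re (phase_det a b w) = s * cos X * (?c y * ?c (a * y) - a * (?s y * ?s (a * y)))"
    unfolding phase_det_def u_def[symmetric]
    by (simp add: Re_sin Im_sin Re_cos Im_cos sw u y_def[symmetric] field_simps)
  moreover have "?c y * ?c (a * y) - a * (?s y * ?s (a * y)) > 0"
  proof -
    have "0 \<le> a * y" using a w by (simp add: y_def)
    have s0: "0 \<le> ?s y" "0 \<le> ?s (a * y)" using w \<open>0 \<le> a * y\<close> by (auto simp: y_def)
    have "a * (?s y * ?s (a * y)) \<le> 1 * (?s y * ?s (a * y))" using a s0 by (intro mult_right_mono) auto
    also have "\<dots> < ?c y * ?c (a * y)"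
      unfolding mult_1_left using s0 by (intro mult_strict_mono) (auto intro: add_pos_pos)
    finally show ?thesis by simp
  qed
  ultimately show False using zero cX w(2) by auto
qed

lemma phase_det_zero_interior:
  assumes a: "0 < a" "a < 1" and b: "\<bar>b - pi / 2\<bar> < a * pi / 2"
    and w: "\<bar>Re w\<bar> \<le> pi / 2" "Im w \<ge> 0" and zero: "phase_det a b w = 0"
  shows "\<bar>Re w\<bar> < pi / 2 \<and> Im w > 0"
proof -
  have "Re w \<noteq> s * (pi / 2)" if "s = 1 \<or> s = - 1" for s
    using phase_det_side_nonzero[OF a b _ that w(2)] zero by blast
  from this[of 1] this[of "- 1"] have "\<bar>Re w\<bar> \<noteq> pi / 2" by auto
  moreover have "Im w \<noteq> 0"
  proof
    assume "Im w = 0"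
    then have weq: "w = of_real (Re w)" by (simp add: complex_eq_iff)
    have "phase_det a b (of_real x) = of_real (sin x * cos (a * x + b) - a * cos x * sin (a * x + b))" for x
      unfolding phase_det_def by (simp add: cos_of_real[symmetric] sin_of_real[symmetric])
    then have "phase_det a b w \<noteq> 0"
      using phase_det_real_neg[OF a b w(1)] by (subst weq) (metis less_irrefl of_real_eq_0_iff)
    with zero show False by simp
  qed
  ultimately show ?thesis using w by linarith
qed

lemma cos_i_times_real: "cos (\<i> * of_real t) = complex_of_real (cosh t)"
  by (simp add: complex_eq_iff Re_cos Im_cos cosh_def)

text \<open>In this symmetric position twice the function on the imaginary axis is the real q(y) =
  (1 - a) cosh ((1 + a) y) - (1 + a) cosh ((1 - a) y). It starts at - 2 a and the faster cosh wins
  eventually.\<close>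

lemma phase_det_base:
  assumes a: "0 < a" "a < 1"
  shows "\<exists>y>0. phase_det a (pi / 2) (\<i> * of_real y) = 0"
proof -
  define q where "q y = (1 - a) * cosh ((1 + a) * y) - (1 + a) * cosh ((1 - a) * y)" for y :: real
  have eq: "2 * phase_det a (pi / 2) (\<i> * of_real y) = of_real (q y)" for y
  proof -
    have 1: "sin (of_real (1 + a) * (\<i> * of_real y) + of_real (pi / 2)) = complex_of_real (cosh ((1 + a) * y))"
    proof -
      have "sin (of_real (1 + a) * (\<i> * of_real y) + of_real (pi / 2)) = cos (\<i> * of_real ((1 + a) * y))"
        by (simp add: sin_add sin_of_real cos_of_real mult_ac del: of_real_add)
      also have "\<dots> = of_real (cosh ((1 + a) * y))" by (rule cos_i_times_real)
      finally show ?thesis .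
    qed
    have 2: "sin (of_real (1 - a) * (\<i> * of_real y) - of_real (pi / 2)) = - complex_of_real (cosh ((1 - a) * y))"
    proof -
      have "sin (of_real (1 - a) * (\<i> * of_real y) - of_real (pi / 2)) = - cos (\<i> * of_real ((1 - a) * y))"
        by (simp add: sin_diff sin_of_real cos_of_real mult_ac del: of_real_diff)
      also have "cos (\<i> * of_real ((1 - a) * y)) = of_real (cosh ((1 - a) * y))"
        by (rule cos_i_times_real)
      finally show ?thesis .
    qed
    show ?thesis unfolding phase_det_sum 1 2 by (simp add: q_def)
  qed
  \<comment> \<open>Makes 2 a y1 equal to 2 (1 + a) / (1 - a), so exp (2 a y1) exceeds this by exp t
    \<ge> 1 + t; that is the ratio at which the faster cosh has taken over.\<close>
  define y1 where "y1 = (1 + a) / (1 - a) / a"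
  have y1: "y1 > 0" using a by (simp add: y1_def)
  have q0: "q 0 \<le> 0" using a by (simp add: q_def)
  have q1: "q y1 \<ge> 0"
  proof -
    have "(1 + a) / (1 - a) * 2 \<le> exp (2 * a * y1)"
    proof -
      have "2 * a * y1 = (1 + a) / (1 - a) * 2" using a by (simp add: y1_def)
      then show ?thesis using exp_ge_add_one_self[of "2 * a * y1"] by linarith
    qed
    then have "(1 + a) * (2 * exp ((1 - a) * y1)) \<le> (1 - a) * (exp (2 * a * y1) * exp ((1 - a) * y1))"
    proof -
      have "(1 - a) * ((1 + a) / (1 - a) * 2) * exp ((1 - a) * y1) \<le> (1 - a) * exp (2 * a * y1) * exp ((1 - a) * y1)"
        using a \<open>_ \<le> exp (2 * a * y1)\<close> by (intro mult_right_mono mult_left_mono) auto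
      then show ?thesis using a by (simp add: mult_ac)
    qed
    also have "exp (2 * a * y1) * exp ((1 - a) * y1) = exp ((1 + a) * y1)" by (simp add: exp_add[symmetric] algebra_simps)
    finally have A: "(1 + a) * (2 * exp ((1 - a) * y1)) \<le> (1 - a) * exp ((1 + a) * y1)" .
    have "cosh ((1 - a) * y1) \<le> exp ((1 - a) * y1)" using a y1 by (simp add: cosh_def)
    then have "(1 + a) * cosh ((1 - a) * y1) \<le> (1 + a) * exp ((1 - a) * y1)" using a by (intro mult_left_mono) auto
    moreover have "exp ((1 + a) * y1) / 2 \<le> cosh ((1 + a) * y1)" by (simp add: cosh_def)
    then have "(1 - a) * (exp ((1 + a) * y1) / 2) \<le> (1 - a) * cosh ((1 + a) * y1)" using a by (intro mult_left_mono) auto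
    ultimately show ?thesis using A by (simp add: q_def)
  qed
  have "\<exists>y\<ge>0. y \<le> y1 \<and> q y = 0"
    by (rule IVT'[of q 0 0 y1]) (use y1 q0 q1 in \<open>auto simp: q_def intro!: continuous_intros\<close>)
  then obtain y where y: "y \<ge> 0" "q y = 0" by blast
  moreover have "q 0 \<noteq> 0" using a by (simp add: q_def)
  ultimately have "y > 0" by (cases "y = 0") auto
  then show ?thesis using eq[of y] y by auto
qed

text \<open>The set of phases \<open>b\<close> with a zero in the half strip \<open>|Re w| < \<pi>/2\<close>, \<open>Im w > 0\<close> is open by Hurwitz's theorem and
  closed because zeros cannot reach the boundary of the half strip or escape to infinity.\<close>

lemma phase_det_nonreal_zero:
  assumes a: "0 < a" "a < 1" and b: "\<bar>b - pi / 2\<bar> < a * pi / 2"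
  shows "\<exists>w. Im w > 0 \<and> phase_det a b w = 0"
proof -
  define I where "I = ball (pi / 2) (a * pi / 2)"
  define H where "H = {w. \<bar>Re w\<bar> < pi / 2 \<and> Im w > 0}"
  define S where "S = {b \<in> I. \<exists>w\<in>H. phase_det a b w = 0}"
  have I: "b \<in> I \<longleftrightarrow> \<bar>b - pi / 2\<bar> < a * pi / 2" for b by (auto simp: I_def dist_real_def abs_minus_commute)
  have "open H"
  proof -
    have "H = {w. - (pi / 2) < Re w} \<inter> {w. Re w < pi / 2} \<inter> {w. 0 < Im w}" by (auto simp: H_def)
    then show ?thesis
      using open_Int[OF open_Int[OF open_halfspace_Re_gt open_halfspace_Re_lt] open_halfspace_Im_gt] by (simp only:)
  qed
  have closed1: "l \<in> S" if x: "\<And>j. x j \<in> S" "x \<longlonglongrightarrow> l" and l: "l \<in> I" for x l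
  proof -
    obtain w where w: "\<And>j. w j \<in> H" "\<And>j. phase_det a (x j) (w j) = 0"
      using x(1) unfolding S_def by (auto, metis)
    define Y0 where "Y0 = (2 * (1 + a) / (1 - a) + 1) / (2 * a)"
    define K where "K = cbox (Complex (- (pi / 2)) 0) (Complex (pi / 2) Y0)"
    have "w j \<in> K" for j
      using w(1)[of j] phase_det_zero_Im_bound[OF a _ w(2), of j] unfolding H_def K_def in_cbox_complex_iff Y0_def
      by auto
    then obtain w0 r where r: "w0 \<in> K" "strict_mono r" "(w \<circ> r) \<longlonglongrightarrow> w0"
      using compact_cbox[of "Complex (- (pi / 2)) 0" "Complex (pi / 2) Y0"] unfolding compact_def K_def by metis
    have xr: "(\<lambda>j. x (r j)) \<longlonglongrightarrow> l" using LIMSEQ_subseq_LIMSEQ[OF x(2) r(2)] by (simp add: o_def)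
    have wr: "(\<lambda>j. w (r j)) \<longlonglongrightarrow> w0" using r(3) by (simp add: o_def)
    have "(\<lambda>j. phase_det a (x (r j)) (w (r j))) \<longlonglongrightarrow> phase_det a l w0"
      unfolding phase_det_def by (intro tendsto_intros xr wr)
    then have "phase_det a l w0 = 0" using w(2) LIMSEQ_unique[OF _ tendsto_const] by simp
    moreover from this have "w0 \<in> H"
      using phase_det_zero_interior[OF a, of l w0] l r(1) unfolding I K_def in_cbox_complex_iff H_def by auto
    ultimately show ?thesis using l by (auto simp: S_def)
  qed
  have closed2: "l \<in> I - S" if x: "\<And>j. x j \<in> I - S" "x \<longlonglongrightarrow> l" and l: "l \<in> I" for x l
  proof (rule ccontr)
    assume "l \<notin> I - S"
    with l obtain w0 where w0: "w0 \<in> H" "phase_det a l w0 = 0" unfolding S_def by auto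
    obtain r where r: "r > 0" "ball w0 r \<subseteq> H" using \<open>open H\<close> w0(1) open_contains_ball by blast
    have Im: "Im w0 \<noteq> 0" using w0 by (simp add: H_def)
    have "uniform_limit (ball w0 r) (\<lambda>j. phase_det a (x j)) (phase_det a l) sequentially"
      unfolding phase_det_split[abs_def]
      by (intro uniform_limit_minus uniform_lim_mult uniform_limit_scalar uniform_limit_const tendsto_of_real
          tendsto_cos tendsto_sin x bounded_image_ball continuous_intros)
    then have "\<forall>\<^sub>F j in sequentially. \<exists>z\<in>ball w0 r. phase_det a (x j) z = 0"
      by (intro hurwitz_zero_persists[OF r(1) _ _ _ w0(2) phase_det_deriv phase_det_deriv_nonzero[OF a Im]])
        (auto intro: phase_det_holomorphic always_eventually)
    from eventually_happens'[OF sequentially_bot this]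
    obtain j where "\<exists>z\<in>ball w0 r. phase_det a (x j) z = 0" by (rule exE)
    then have "x j \<in> S" using x(1)[of j] r(2) by (auto simp: S_def)
    with x(1) show False by blast
  qed
  have cl: "closedin (top_of_set I) T"
    if "T \<subseteq> I" and seq: "\<And>x l. (\<And>j. x j \<in> T) \<Longrightarrow> x \<longlonglongrightarrow> l \<Longrightarrow> l \<in> I \<Longrightarrow> l \<in> T" for T
  proof -
    have "T = I \<inter> closure T"
    proof (intro equalityI subsetI IntI)
      fix l assume "l \<in> I \<inter> closure T"
      then have "l \<in> closure T" and l: "l \<in> I" by auto
      then obtain x where x: "\<forall>j. x j \<in> T" "x \<longlonglongrightarrow> l" unfolding closure_sequential by auto
      show "l \<in> T" by (rule seq[OF _ x(2) l]) (use x(1) in auto)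
    qed (use that closure_subset[of T] in auto)
    then show ?thesis using closedin_closed_Int[OF closed_closure, of I T] by simp
  qed
  have "closedin (top_of_set I) S" using closed1 by (intro cl) (auto simp: S_def)
  moreover have "closedin (top_of_set I) (I - S)" using closed2 by (intro cl) auto
  moreover have "connected I" unfolding I_def by (rule connected_ball)
  moreover have "pi / 2 \<in> S"
  proof -
    obtain y where "y > 0" "phase_det a (pi / 2) (\<i> * of_real y) = 0" using phase_det_base[OF a] by blast
    moreover from this have "\<i> * of_real y \<in> H" by (simp add: H_def)
    moreover have "pi / 2 \<in> I" using a by (simp add: I)
    ultimately show ?thesis unfolding S_def by blast
  qed
  moreover have "S \<union> (I - S) = I" "S \<inter> (I - S) = {}" by (auto simp: S_def)
  ultimately have "I - S = {}" unfolding connected_closedin_eq by (metis empty_iff)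
  then have "b \<in> S" using b I by blast
  then show ?thesis by (auto simp: S_def H_def)
qed

section \<open>Expansion of the determinant\<close>

definition strip_O :: "real \<Rightarrow> real \<Rightarrow> nat \<Rightarrow> (complex \<Rightarrow> complex) \<Rightarrow> bool" where
  "strip_O X R m f \<longleftrightarrow> (\<exists>C. \<forall>k. Re k \<ge> X \<and> \<bar>Im k\<bar> \<le> R \<longrightarrow> norm (f k) \<le> C / (Re k) ^ m)"

lemma strip_OE:
  assumes "strip_O X R m f" "X \<ge> 1"
  obtains C where "C \<ge> 0" "\<And>k. Re k \<ge> X \<Longrightarrow> \<bar>Im k\<bar> \<le> R \<Longrightarrow> norm (f k) \<le> C / (Re k) ^ m"
proof -
  obtain C where C: "\<forall>k. Re k \<ge> X \<and> \<bar>Im k\<bar> \<le> R \<longrightarrow> norm (f k) \<le> C / (Re k) ^ m"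
    using assms(1) unfolding strip_O_def by blast
  show thesis
  proof (rule that[of "\<bar>C\<bar>"])
    fix k assume k: "Re k \<ge> X" "\<bar>Im k\<bar> \<le> R"
    then have "norm (f k) \<le> C / (Re k) ^ m" using C by blast
    also have "\<dots> \<le> \<bar>C\<bar> / (Re k) ^ m" using k assms(2) by (intro divide_right_mono) auto
    finally show "norm (f k) \<le> \<bar>C\<bar> / (Re k) ^ m" .
  qed simp
qed

lemma strip_O_mult:
  assumes X: "X \<ge> 1" and f: "strip_O X R m f" and g: "strip_O X R n g"
  shows "strip_O X R (m + n) (\<lambda>k. f k * g k)"
proof -
  obtain C where C: "C \<ge> 0" "\<And>k. Re k \<ge> X \<Longrightarrow> \<bar>Im k\<bar> \<le> R \<Longrightarrow> norm (f k) \<le> C / (Re k) ^ m"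
    using strip_OE[OF f X] by metis
  obtain D where D: "D \<ge> 0" "\<And>k. Re k \<ge> X \<Longrightarrow> \<bar>Im k\<bar> \<le> R \<Longrightarrow> norm (g k) \<le> D / (Re k) ^ n"
    using strip_OE[OF g X] by metis
  show ?thesis unfolding strip_O_def
  proof (intro exI[of _ "C * D"] allI impI)
    fix k assume k: "Re k \<ge> X \<and> \<bar>Im k\<bar> \<le> R"
    have "norm (f k * g k) \<le> (C / (Re k) ^ m) * (D / (Re k) ^ n)"
      unfolding norm_mult using C D k X by (intro mult_mono) auto
    then show "norm (f k * g k) \<le> C * D / (Re k) ^ (m + n)" by (simp add: power_add)
  qed
qed

lemma strip_O_add:
  assumes X: "X \<ge> 1" and f: "strip_O X R m f" and g: "strip_O X R m g"
  shows "strip_O X R m (\<lambda>k. f k + g k)"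
proof -
  obtain C where C: "\<And>k. Re k \<ge> X \<Longrightarrow> \<bar>Im k\<bar> \<le> R \<Longrightarrow> norm (f k) \<le> C / (Re k) ^ m"
    using strip_OE[OF f X] by metis
  obtain D where D: "\<And>k. Re k \<ge> X \<Longrightarrow> \<bar>Im k\<bar> \<le> R \<Longrightarrow> norm (g k) \<le> D / (Re k) ^ m"
    using strip_OE[OF g X] by metis
  show ?thesis unfolding strip_O_def
  proof (intro exI[of _ "C + D"] allI impI)
    fix k assume "Re k \<ge> X \<and> \<bar>Im k\<bar> \<le> R"
    then have "norm (f k + g k) \<le> C / (Re k) ^ m + D / (Re k) ^ m"
      using C[of k] D[of k] by (intro norm_triangle_mono) auto
    then show "norm (f k + g k) \<le> (C + D) / (Re k) ^ m" by (simp add: add_divide_distrib)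
  qed
qed

lemma strip_O_weaken:
  assumes X: "X \<ge> 1" and f: "strip_O X R m f" and "n \<le> m"
  shows "strip_O X R n f"
proof -
  obtain C where C: "C \<ge> 0" "\<And>k. Re k \<ge> X \<Longrightarrow> \<bar>Im k\<bar> \<le> R \<Longrightarrow> norm (f k) \<le> C / (Re k) ^ m"
    using strip_OE[OF f X] by metis
  show ?thesis unfolding strip_O_def
  proof (intro exI[of _ C] allI impI)
    fix k assume k: "Re k \<ge> X \<and> \<bar>Im k\<bar> \<le> R"
    then have "norm (f k) \<le> C / (Re k) ^ m" using C by blast
    also have "\<dots> \<le> C / (Re k) ^ n" using C k X assms(3) by (intro divide_left_mono power_increasing) auto
    finally show "norm (f k) \<le> C / (Re k) ^ n" .
  qed
qed

lemma strip_O_const: "strip_O X R 0 (\<lambda>k. c)"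
  unfolding strip_O_def by auto

lemma strip_O_inverse: "X \<ge> 1 \<Longrightarrow> strip_O X R 1 inverse"
  unfolding strip_O_def
proof (intro exI[of _ 1] allI impI)
  fix k assume "X \<ge> 1" "Re k \<ge> X \<and> \<bar>Im k\<bar> \<le> R"
  then show "norm (inverse k) \<le> 1 / (Re k) ^ 1"
    using complex_Re_le_cmod[of k] frac_le[of 1 1 "Re k" "norm k"] by (simp add: norm_divide inverse_eq_divide)
qed

lemma strip_O_trig:
  assumes "0 < a" "a \<le> 1"
  shows "strip_O X R 0 (\<lambda>k. sin (of_real a * k - of_real d))" "strip_O X R 0 (\<lambda>k. cos (of_real a * k - of_real d))"
proof -
  have e: "exp \<bar>Im (of_real a * k - of_real d)\<bar> \<le> exp R" if "\<bar>Im k\<bar> \<le> R" for k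
    using that assms mult_right_mono[of a 1 "\<bar>Im k\<bar>"] by (simp add: abs_mult)
  show "strip_O X R 0 (\<lambda>k. sin (of_real a * k - of_real d))" "strip_O X R 0 (\<lambda>k. cos (of_real a * k - of_real d))"
    unfolding strip_O_def
    by (intro exI[of _ "exp R"] allI impI, use order_trans[OF norm_sin_le_exp e] in simp)
      (intro exI[of _ "exp R"] allI impI, use order_trans[OF norm_cos_le_exp e] in simp)
qed

text \<open>The determinant of the boundary conditions in terms of Y, whose amplitude neither grows
  nor decays along the real axis; this is the form to which the asymptotics apply.\<close>

definition liouville_det :: "real \<Rightarrow> real \<Rightarrow> complex \<Rightarrow> complex" where
  "liouville_det a \<eta> k = of_real a * liouville_Y k * liouville_Y' (of_real a * k)
     - liouville_Y (of_real a * k) * liouville_Y' k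
     - of_real \<eta> * inverse k * (liouville_Y k * liouville_Y (of_real a * k))"

text \<open>The two conditions of \<open>transmission_eigenvalueI\<close> for n = a^2, as a
  determinant in the two amplitudes.\<close>

definition bessel_det :: "real \<Rightarrow> real \<Rightarrow> complex \<Rightarrow> complex" where
  "bessel_det a \<eta> k =
     bessel_E (k\<^sup>2) * (2 * (of_real a * k)\<^sup>2 * bessel_E' ((of_real a * k)\<^sup>2))
     - bessel_E ((of_real a * k)\<^sup>2) * (2 * k\<^sup>2 * bessel_E' (k\<^sup>2))
     - of_real \<eta> * (bessel_E (k\<^sup>2) * bessel_E ((of_real a * k)\<^sup>2))"

text \<open>Y' differs from sqrt z J0' by Y / (2 z). These extra terms cancel in the determinant,
  because a / (2 a k) = 1 / (2 k), so k times \<open>liouville_det\<close> is sqrt k sqrt (a k)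
  times \<open>bessel_det\<close>.\<close>

lemma liouville_det_zero_imp:
  assumes "0 < a" "Re k > 0" "liouville_det a \<eta> k = 0" shows "bessel_det a \<eta> k = 0"
proof -
  define s where "s = csqrt k" define t where "t = csqrt (of_real a * k)"
  have k0: "k \<noteq> 0" and s0: "s \<noteq> 0" and t0: "t \<noteq> 0" using assms by (auto simp: s_def t_def)
  have s2: "s\<^sup>2 = k" and t2: "t\<^sup>2 = of_real a * k" by (simp_all add: s_def t_def)
  have "k * liouville_det a \<eta> k = s * t * bessel_det a \<eta> k"
  proof -
    have 1: "k / s = s" using s2 s0 by (simp add: field_simps power2_eq_square)
    have 2: "of_real a * k / t = t" using t2 t0 by (simp add: field_simps power2_eq_square)
    have "k * liouville_det a \<eta> k =
      s * bessel_E (k\<^sup>2) * (of_real a * k / t * bessel_E ((of_real a * k)\<^sup>2) / 2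
         + 2 * t * (of_real a * k)\<^sup>2 * bessel_E' ((of_real a * k)\<^sup>2))
      - t * bessel_E ((of_real a * k)\<^sup>2) * (k / s * bessel_E (k\<^sup>2) / 2 + 2 * s * k\<^sup>2 * bessel_E' (k\<^sup>2))
      - of_real \<eta> * (s * bessel_E (k\<^sup>2) * (t * bessel_E ((of_real a * k)\<^sup>2)))"
      unfolding liouville_det_def liouville_Y_def liouville_Y'_def s_def[symmetric] t_def[symmetric]
      using k0 s0 t0 by (simp add: field_simps power2_eq_square)
    then show ?thesis unfolding 1 2 bessel_det_def by (simp add: algebra_simps)
  qed
  then show ?thesis using assms(3) s0 t0 by simp
qed

lemma liouville_det_holomorphic:
  assumes "0 < a" "\<And>k. k \<in> S \<Longrightarrow> Re k > 0" shows "liouville_det a \<eta> holomorphic_on S"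
proof -
  define H where "H = {z. Re z > 0}"
  have "open H" unfolding H_def by (rule open_halfspace_Re_gt)
  have Y: "liouville_Y holomorphic_on H" "liouville_Y' holomorphic_on H"
    unfolding holomorphic_on_open[OF \<open>open H\<close>]
    using liouville_Y_deriv liouville_Y'_deriv by (auto simp: H_def)
  have id: "(\<lambda>k. k) ` S \<subseteq> H" "(\<lambda>k. of_real a * k) ` S \<subseteq> H" using assms by (auto simp: H_def)
  have "(\<lambda>k. liouville_Y k) holomorphic_on S" "(\<lambda>k. liouville_Y' k) holomorphic_on S"
    using Y id(1) holomorphic_on_subset by auto
  moreover have "(\<lambda>k. liouville_Y (of_real a * k)) holomorphic_on S" "(\<lambda>k. liouville_Y' (of_real a * k)) holomorphic_on S"
    using holomorphic_on_compose_gen[of "\<lambda>k. of_real a * k" S, OF _ Y(1) id(2)]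
      holomorphic_on_compose_gen[of "\<lambda>k. of_real a * k" S, OF _ Y(2) id(2)]
    by (auto simp: o_def intro!: holomorphic_intros)
  moreover have "k \<noteq> 0" if "k \<in> S" for k using assms(2)[OF that] by auto
  ultimately show ?thesis unfolding liouville_det_def[abs_def] by (intro holomorphic_intros) auto
qed

text \<open>Among the products of order 1/k, those with two cosines have coefficients 1/8 and - 1/8
  and cancel. Those with two sines have coefficients - a / 8 and 1 / (8 a), which do not cancel as a
  < 1; their sum will split the triple zeros. Beyond Re k = 1 / a both k and a k are in the range of
  the expansion of Y.\<close>

lemma liouville_det_asymptotics:
  fixes a \<eta> :: real
  assumes a: "0 < a" "a < 1"
  obtains A \<delta> :: real where "A \<noteq> 0"
    "\<And>R. strip_O (1 / a) R 2 (\<lambda>k. liouville_det a \<eta> k - of_real (A\<^sup>2) * (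
       sin (k - of_real \<delta>) * cos (of_real a * k - of_real \<delta>) - of_real a * cos (k - of_real \<delta>) * sin (of_real a * k - of_real \<delta>)
       + of_real ((1 / a - a) / 8) * inverse k * (sin (k - of_real \<delta>) * sin (of_real a * k - of_real \<delta>))
       - of_real \<eta> * inverse k * (cos (k - of_real \<delta>) * cos (of_real a * k - of_real \<delta>))))"
proof -
  obtain A \<delta> :: real where A: "A \<noteq> 0" and asym:
    "\<And>R. \<exists>C. \<forall>z. Re z \<ge> 1 \<and> \<bar>Im z\<bar> \<le> R \<longrightarrow>
      norm (liouville_Y z - of_real A * (cos (z - of_real \<delta>) + sin (z - of_real \<delta>) / (8 * z))) \<le> C / (Re z)\<^sup>2 \<and>
      norm (liouville_Y' z - of_real A * (cos (z - of_real \<delta>) / (8 * z) - sin (z - of_real \<delta>))) \<le> C / (Re z)\<^sup>2"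
    using liouville_asymptotics by blast
  \<comment> \<open>Division by a is written as multiplication by r, which makes the expansion a
    polynomial identity modulo a r = 1.\<close>
  define r where "r = 1 / a"
  have ar: "of_real a * complex_of_real r = 1" using a by (simp add: r_def)
  have X: "1 / a \<ge> 1" using a by simp
  have quot: "s * inverse z / 8 = s / (8 * z)" for s z :: complex
    by (cases "z = 0") (auto simp: field_simps)
  have quot': "s * (of_real r * inverse z) / 8 = s / (8 * (of_real a * z))" for s z :: complex
    using a by (cases "z = 0") (auto simp: field_simps r_def)
  define c1 :: "complex \<Rightarrow> complex" where "c1 k = cos (k - of_real \<delta>)" for k
  define s1 :: "complex \<Rightarrow> complex" where "s1 k = sin (k - of_real \<delta>)" for k
  define c2 :: "complex \<Rightarrow> complex" where "c2 k = cos (of_real a * k - of_real \<delta>)" for k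
  define s2 :: "complex \<Rightarrow> complex" where "s2 k = sin (of_real a * k - of_real \<delta>)" for k
  define e1 where "e1 k = liouville_Y k - of_real A * (c1 k + s1 k * inverse k / 8)" for k
  define e1' where "e1' k = liouville_Y' k - of_real A * (c1 k * inverse k / 8 - s1 k)" for k
  define e2 where "e2 k = liouville_Y (of_real a * k) - of_real A * (c2 k + s2 k * (of_real r * inverse k) / 8)" for k
  define e2' where "e2' k = liouville_Y' (of_real a * k) - of_real A * (c2 k * (of_real r * inverse k) / 8 - s2 k)" for k
  let ?Q = "\<lambda>k. of_real (A\<^sup>2) * (s1 k * c2 k - of_real a * c1 k * s2 k
       + of_real ((1 / a - a) / 8) * inverse k * (s1 k * s2 k) - of_real \<eta> * inverse k * (c1 k * c2 k))"
  have "strip_O (1 / a) R 2 (\<lambda>k. liouville_det a \<eta> k - ?Q k)" for R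
  proof -
    let ?O = "strip_O (1 / a) R"
    have trig: "?O 0 c1" "?O 0 s1" "?O 0 c2" "?O 0 s2"
      unfolding c1_def[abs_def] s1_def[abs_def] c2_def[abs_def] s2_def[abs_def]
      using strip_O_trig[of 1 "1 / a" R \<delta>] strip_O_trig[of a "1 / a" R \<delta>] a by auto
    have inv: "?O 1 inverse" by (rule strip_O_inverse[OF X])
    obtain C where C: "\<And>z. Re z \<ge> 1 \<Longrightarrow> \<bar>Im z\<bar> \<le> R \<Longrightarrow>
      norm (liouville_Y z - of_real A * (cos (z - of_real \<delta>) + sin (z - of_real \<delta>) / (8 * z))) \<le> C / (Re z)\<^sup>2 \<and>
      norm (liouville_Y' z - of_real A * (cos (z - of_real \<delta>) / (8 * z) - sin (z - of_real \<delta>))) \<le> C / (Re z)\<^sup>2"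
      using asym[of R] by blast
    have "?O 2 e1 \<and> ?O 2 e1'"
      unfolding strip_O_def
    proof (intro conjI exI[of _ C] allI impI)
      fix k assume "Re k \<ge> 1 / a \<and> \<bar>Im k\<bar> \<le> R"
      then have k: "Re k \<ge> 1" "\<bar>Im k\<bar> \<le> R" using X by auto
      show "norm (e1 k) \<le> C / (Re k)\<^sup>2" "norm (e1' k) \<le> C / (Re k)\<^sup>2"
        using C[OF k] by (simp_all add: e1_def e1'_def c1_def s1_def quot)
    qed
    then have e: "?O 2 e1" "?O 2 e1'" by auto
    have "?O 2 e2 \<and> ?O 2 e2'"
      unfolding strip_O_def
    proof (intro conjI exI[of _ "C / a\<^sup>2"] allI impI)
      fix k assume k: "Re k \<ge> 1 / a \<and> \<bar>Im k\<bar> \<le> R"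
      have "Re (of_real a * k) \<ge> 1" using k a by (simp add: field_simps)
      moreover have "\<bar>Im (of_real a * k)\<bar> \<le> R"
        using k a mult_right_mono[of a 1 "\<bar>Im k\<bar>"] by (simp add: abs_mult)
      ultimately have "norm (e2 k) \<le> C / (Re (of_real a * k))\<^sup>2 \<and> norm (e2' k) \<le> C / (Re (of_real a * k))\<^sup>2"
        using C[of "of_real a * k"] by (simp add: e2_def e2'_def c2_def s2_def quot')
      then show "norm (e2 k) \<le> C / a\<^sup>2 / (Re k)\<^sup>2" "norm (e2' k) \<le> C / a\<^sup>2 / (Re k)\<^sup>2"
        by (auto simp: power_mult_distrib)
    qed
    then have e': "?O 2 e2" "?O 2 e2'" by auto
    have mult: "?O m f \<Longrightarrow> ?O n g \<Longrightarrow> l \<le> m + n \<Longrightarrow> ?O l (\<lambda>k. f k * g k)" for m n l f g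
      using strip_O_weaken[OF X strip_O_mult[OF X]] by blast
    have cst: "?O m f \<Longrightarrow> ?O m (\<lambda>k. c * f k)" for m f c
      using mult[OF strip_O_const, of m f m c] by simp
    note add = strip_O_add[OF X]
    have p1: "?O 0 (\<lambda>k. c1 k + s1 k * inverse k * of_real (1/8))"
      and p2: "?O 0 (\<lambda>k. c2 k + s2 k * inverse k * of_real (r/8))"
      by (intro add trig mult[OF mult[OF trig(2) inv, of 1] strip_O_const] mult[OF mult[OF trig(4) inv, of 1] strip_O_const]; simp)+
    have p1': "?O 0 (\<lambda>k. c1 k * inverse k * of_real (1/8) + (-1) * s1 k)"
      and p2': "?O 0 (\<lambda>k. c2 k * inverse k * of_real (r/8) + (-1) * s2 k)"
      by (intro add cst trig mult[OF mult[OF trig(1) inv, of 1] strip_O_const] mult[OF mult[OF trig(3) inv, of 1] strip_O_const]; simp)+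
    have Y: "?O 0 (\<lambda>k. of_real A * (c1 k * inverse k * of_real (1/8) + (-1) * s1 k) + e1' k)"
      "?O 0 (\<lambda>k. of_real A * (c2 k * inverse k * of_real (r/8) + (-1) * s2 k) + e2' k)"
      "?O 0 (\<lambda>k. of_real A * (c2 k + s2 k * inverse k * of_real (r/8)) + e2 k)"
      by (intro add cst p1' p2' p2 strip_O_weaken[OF X e(2)] strip_O_weaken[OF X e'(2)] strip_O_weaken[OF X e'(1)]; simp)+
    have inv2: "?O 2 (\<lambda>k. inverse k * inverse k)" using mult[OF inv inv, of 2] by simp
    \<comment> \<open>Every summand contains a factor of order k^(-2): either two inverses of k or
      one of the remainders \<open>e1\<close>, \<open>e1'\<close>, \<open>e2\<close>,
      \<open>e2'\<close>.\<close>
    define err where "err k =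
        of_real (A\<^sup>2) * ((inverse k * inverse k) * (of_real (1/64) * (s1 k * c2 k) + of_real (- r/64) * (s2 k * c1 k)))
      + of_real (- \<eta> * A\<^sup>2) * ((inverse k * inverse k) * (of_real (r/8) * (c1 k * s2 k) + of_real (1/8) * (s1 k * c2 k)
          + of_real (r/64) * (s1 k * s2 k * inverse k)))
      + (-1) * (e2 k * (of_real A * (c1 k * inverse k * of_real (1/8) + (-1) * s1 k) + e1' k))
      + of_real (- A) * ((c2 k + s2 k * inverse k * of_real (r/8)) * e1' k)
      + of_real a * (e1 k * (of_real A * (c2 k * inverse k * of_real (r/8) + (-1) * s2 k) + e2' k))
      + of_real (a * A) * ((c1 k + s1 k * inverse k * of_real (1/8)) * e2' k)
      + of_real (- \<eta>) * (inverse k * (e1 k * (of_real A * (c2 k + s2 k * inverse k * of_real (r/8)) + e2 k)))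
      + of_real (- \<eta> * A) * (inverse k * ((c1 k + s1 k * inverse k * of_real (1/8)) * e2 k))" for k
    have t2: "?O 0 (\<lambda>k. s1 k * c2 k)" "?O 0 (\<lambda>k. s2 k * c1 k)" "?O 0 (\<lambda>k. c1 k * s2 k)" "?O 0 (\<lambda>k. s1 k * s2 k)"
      using trig by (auto intro: mult)
    have t3: "?O 0 (\<lambda>k. s1 k * s2 k * inverse k)" using mult[OF t2(4) inv, of 0] by simp
    have b1: "?O 0 (\<lambda>k. of_real (1/64) * (s1 k * c2 k) + of_real (- r/64) * (s2 k * c1 k))"
      by (intro add cst t2)
    have b2: "?O 0 (\<lambda>k. of_real (r/8) * (c1 k * s2 k) + of_real (1/8) * (s1 k * c2 k) + of_real (r/64) * (s1 k * s2 k * inverse k))"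
      by (intro add cst t2 t3)
    have "?O 2 err"
      unfolding err_def
      by (intro add cst mult[OF inv2 b1] mult[OF inv2 b2] mult[OF e'(1) Y(1)] mult[OF p2 e(2)] mult[OF e(1) Y(2)]
          mult[OF p1 e'(2)] mult[OF inv mult[OF e(1) Y(3), of 2]] mult[OF inv mult[OF p1 e'(1), of 2]]) simp_all
    moreover have "liouville_det a \<eta> k - ?Q k = err k" for k
    proof -
      have Y1: "liouville_Y k = of_real A * (c1 k + s1 k * inverse k / 8) + e1 k"
        and Y1': "liouville_Y' k = of_real A * (c1 k * inverse k / 8 - s1 k) + e1' k"
        and Y2: "liouville_Y (of_real a * k) = of_real A * (c2 k + s2 k * (of_real r * inverse k) / 8) + e2 k"
        and Y2': "liouville_Y' (of_real a * k) = of_real A * (c2 k * (of_real r * inverse k) / 8 - s2 k) + e2' k"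
        by (simp_all add: e1_def e1'_def e2_def e2'_def)
      have ra: "1 / a = r" by (simp add: r_def)
      have gen: "aa * (AA * (C1 + S1 * i / 8) + E1) * (AA * (C2 * (rr * i) / 8 - S2) + E2')
          - (AA * (C2 + S2 * (rr * i) / 8) + E2) * (AA * (C1 * i / 8 - S1) + E1')
          - h * i * ((AA * (C1 + S1 * i / 8) + E1) * (AA * (C2 + S2 * (rr * i) / 8) + E2))
          - AA * AA * (S1 * C2 - aa * C1 * S2 + (rr - aa) / 8 * i * (S1 * S2) - h * i * (C1 * C2)) =
          AA * AA * ((i * i) * ((1/64) * (S1 * C2) + (- rr/64) * (S2 * C1)))
          + (- h * (AA * AA)) * ((i * i) * ((rr/8) * (C1 * S2) + (1/8) * (S1 * C2) + (rr/64) * (S1 * S2 * i)))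
          + (-1) * (E2 * (AA * (C1 * i * (1/8) + (-1) * S1) + E1'))
          + (- AA) * ((C2 + S2 * i * (rr/8)) * E1')
          + aa * (E1 * (AA * (C2 * i * (rr/8) + (-1) * S2) + E2'))
          + (aa * AA) * ((C1 + S1 * i * (1/8)) * E2')
          + (- h) * (i * (E1 * (AA * (C2 + S2 * i * (rr/8)) + E2)))
          + (- h * AA) * (i * ((C1 + S1 * i * (1/8)) * E2))"
        if "aa * rr = 1" for aa rr AA C1 S1 C2 S2 i E1 E1' E2 E2' h :: complex
      proof -
        have "aa * (AA * (C1 + S1 * i / 8)) * (AA * (C2 * (rr * i) / 8)) =
            (aa * rr) * (AA * AA * (C1 + S1 * i / 8) * (C2 * i / 8))" by (simp add: algebra_simps)
        then have k1: "aa * (AA * (C1 + S1 * i / 8)) * (AA * (C2 * (rr * i) / 8)) =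
            AA * AA * (C1 + S1 * i / 8) * (C2 * i / 8)" by (simp add: that)
        show ?thesis using k1 by (simp add: field_simps)
      qed
      show ?thesis
        unfolding liouville_det_def Y1 Y1' Y2 Y2' err_def ra
        using gen[OF ar, of "of_real A" "c1 k" "s1 k" "inverse k" "e1 k" "c2 k" "s2 k" "e2' k" "e2 k" "e1' k" "of_real \<eta>"]
        by (simp add: power2_eq_square)
    qed
    ultimately show ?thesis by (simp only:)
  qed
  with A show thesis unfolding c1_def s1_def c2_def s2_def by (rule that)
qed

section \<open>Nonreal zeros far to the right\<close>

lemma uniform_limit_bound:
  fixes f :: "nat \<Rightarrow> 'a \<Rightarrow> complex"
  assumes b: "\<forall>\<^sub>F j in sequentially. \<forall>x\<in>X. norm (f j x - l x) \<le> e j" and e: "e \<longlonglongrightarrow> 0"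
  shows "uniform_limit X f l sequentially"
  unfolding uniform_limit_iff
proof (intro allI impI)
  fix d :: real assume "d > 0"
  then have "\<forall>\<^sub>F j in sequentially. e j < d" using e by (intro order_tendstoD)
  with b show "\<forall>\<^sub>F j in sequentially. \<forall>x\<in>X. dist (f j x) (l x) < d"
    by eventually_elim (force simp: dist_norm)
qed

text \<open>By compactness of the circle the powers converge along a subsequence r. Quotients of two
  of its terms then tend to 1, and the index difference r(2j) - r(j) is at least j.\<close>

lemma cis_recurrence:
  obtains N :: "nat \<Rightarrow> nat" where "\<And>j. j \<le> N j" "(\<lambda>j. cis (\<theta> * real (N j))) \<longlonglongrightarrow> 1"
proof -
  have "\<forall>n. cis (\<theta> * real n) \<in> sphere 0 1" by simp
  then obtain l r where l: "l \<in> sphere 0 1" and r: "strict_mono (r :: nat \<Rightarrow> nat)"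
    and lim: "((\<lambda>n. cis (\<theta> * real n)) \<circ> r) \<longlonglongrightarrow> l"
    using compact_sphere[of "0::complex" 1] unfolding compact_def by metis
  have gap: "r j + i \<le> r (j + i)" for i j
  proof (induction i)
    case (Suc i)
    have "r (j + i) < r (j + Suc i)" using r by (simp add: strict_mono_def)
    with Suc show ?case by simp
  qed simp
  define N where "N j = r (j + j) - r j" for j
  have N: "real (N j) = real (r (j + j)) - real (r j)" "j \<le> N j" for j
    using gap[of j j] by (auto simp: N_def of_nat_diff)
  have lim1: "(\<lambda>j. cis (\<theta> * real (r j))) \<longlonglongrightarrow> l" using lim by (simp add: o_def)
  have "strict_mono (\<lambda>j::nat. j + j)" by (simp add: strict_mono_def)
  from LIMSEQ_subseq_LIMSEQ[OF lim1 this]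
  have lim2: "(\<lambda>j. cis (\<theta> * real (r (j + j)))) \<longlonglongrightarrow> l" by (simp add: o_def)
  have "(\<lambda>j. cis (\<theta> * real (r (j + j))) / cis (\<theta> * real (r j))) \<longlonglongrightarrow> l / l"
    using l by (intro tendsto_divide lim1 lim2) auto
  moreover have "cis (\<theta> * real (r (j + j))) / cis (\<theta> * real (r j)) = cis (\<theta> * real (N j))" for j
    by (simp add: cis_divide N right_diff_distrib)
  moreover have "l / l = 1" using l by auto
  ultimately have "(\<lambda>j. cis (\<theta> * real (N j))) \<longlonglongrightarrow> 1" by (simp only:)
  with N(2) show thesis by (rule that)
qed

definition leading_phase :: "real \<Rightarrow> real \<Rightarrow> complex \<Rightarrow> complex" where
  "leading_phase a \<delta> k = sin (k - of_real \<delta>) * cos (of_real a * k - of_real \<delta>)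
     - of_real a * cos (k - of_real \<delta>) * sin (of_real a * k - of_real \<delta>)"

lemma leading_phase_eq: "leading_phase a \<delta> k = phase_det a (a * \<delta> - \<delta>) (k - of_real \<delta>)"
proof -
  have "of_real a * (k - of_real \<delta>) + of_real (a * \<delta> - \<delta>) = of_real a * k - of_real \<delta>"
    by (simp add: algebra_simps)
  then show ?thesis unfolding leading_phase_def phase_det_def by (simp only:)
qed

text \<open>The translations T_j = 2 \<pi> N_j / a are exact periods of the second phase and, by
  recurrence, asymptotic periods of the first. Since T_j tends to infinity the remainder disappears,
  so the translates of D converge uniformly near z0 to A^2 times the leading phase.\<close>

lemma nonreal_zeros_recurrent:
  fixes D :: "complex \<Rightarrow> complex" and A :: real
  assumes a: "0 < a" "a < 1" and A: "A \<noteq> 0"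
    and D: "\<And>S. (\<And>k. k \<in> S \<Longrightarrow> Re k > 0) \<Longrightarrow> D holomorphic_on S"
    and asym: "\<And>R. strip_O (1 / a) R 1 (\<lambda>k. D k - of_real (A\<^sup>2) * leading_phase a \<delta> k)"
    and z0: "leading_phase a \<delta> z0 = 0" "Im z0 > 0"
  shows "\<exists>k. Re k > B \<and> Im k > 0 \<and> D k = 0"
proof -
  obtain N where N: "\<And>j. j \<le> N j" "(\<lambda>j. cis (2 * pi / a * real (N j))) \<longlonglongrightarrow> 1"
    using cis_recurrence by blast
  define T where "T j = 2 * pi / a * real (N j)" for j
  have "filterlim (\<lambda>j. 2 * pi / a * real j) at_top sequentially"
    using a by (intro filterlim_tendsto_pos_mult_at_top[OF tendsto_const] filterlim_real_sequentially) auto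
  then have Tinf: "filterlim T at_top sequentially"
    by (rule filterlim_at_top_mono) (use a N(1) in \<open>auto simp: T_def intro!: always_eventually mult_left_mono divide_right_mono\<close>)
  have cT: "(\<lambda>j. cos (T j)) \<longlonglongrightarrow> 1" and sT: "(\<lambda>j. sin (T j)) \<longlonglongrightarrow> 0"
    using tendsto_Re[OF N(2)] tendsto_Im[OF N(2)] by (simp_all add: T_def)
  \<comment> \<open>The ball of this radius around z0 stays in the open upper half-plane, so the
    zeros found in it are nonreal.\<close>
  define r where "r = Im z0"
  define M where "M = norm z0 + r"
  define X where "X = ball z0 r"
  have zX: "norm z \<le> M" "\<bar>Im z\<bar> \<le> M" "Im z > 0" "Re z \<ge> - M" if "z \<in> X" for z
  proof -
    have d: "norm (z - z0) < r" using that by (simp add: X_def dist_norm norm_minus_commute)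
    show nz: "norm z \<le> M" using norm_triangle_sub[of z z0] d by (simp add: M_def)
    show "\<bar>Im z\<bar> \<le> M" using abs_Im_le_cmod[of z] nz by linarith
    show "Re z \<ge> - M" using abs_Re_le_cmod[of z] nz by linarith
    have "\<bar>Im (z - z0)\<bar> < r" using abs_Im_le_cmod[of "z - z0"] d by linarith
    then show "Im z > 0" by (simp add: r_def)
  qed
  have X1: "1 / a \<ge> 1" using a by simp
  obtain C where C: "C \<ge> 0" "\<And>k. Re k \<ge> 1 / a \<Longrightarrow> \<bar>Im k\<bar> \<le> M \<Longrightarrow>
      norm (D k - of_real (A\<^sup>2) * leading_phase a \<delta> k) \<le> C / Re k ^ 1"
    using strip_OE[OF asym X1] by metis
  \<comment> \<open>The companion of the leading phase under translation: the addition theorems give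
    it the coefficient sin T_j, which tends to 0.\<close>
  define G :: "complex \<Rightarrow> complex" where "G k = cos (k - of_real \<delta>) * cos (of_real a * k - of_real \<delta>)
     + of_real a * sin (k - of_real \<delta>) * sin (of_real a * k - of_real \<delta>)" for k
  have shift: "leading_phase a \<delta> (z + of_real (T j)) = of_real (cos (T j)) * leading_phase a \<delta> z + of_real (sin (T j)) * G z" for z j
  proof -
    have aT: "a * T j = 2 * real (N j) * pi" using a by (simp add: T_def)
    have 1: "of_real a * (z + of_real (T j)) - of_real \<delta> = (of_real a * z - of_real \<delta>) + of_real (a * T j)"
      by (simp add: algebra_simps)
    have 2: "z + of_real (T j) - of_real \<delta> = (z - of_real \<delta>) + of_real (T j)" by simp
    have cs: "cos (complex_of_real (a * T j)) = 1" "sin (complex_of_real (a * T j)) = 0"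
      unfolding aT cos_of_real sin_of_real cos_2npi sin_2npi by simp_all
    show ?thesis unfolding leading_phase_def G_def 1 2 cos_add sin_add cs
      by (simp add: cos_of_real sin_of_real algebra_simps)
  qed
  have ev: "\<forall>\<^sub>F j in sequentially. T j > M + 1 / a + \<bar>B\<bar>"
    using Tinf unfolding filterlim_at_top_dense by blast
  have u1: "uniform_limit X (\<lambda>j z. D (z + of_real (T j)) - of_real (A\<^sup>2) * leading_phase a \<delta> (z + of_real (T j))) (\<lambda>z. 0) sequentially"
  proof (rule uniform_limit_bound)
    show "\<forall>\<^sub>F j in sequentially. \<forall>z\<in>X. norm (D (z + of_real (T j)) - of_real (A\<^sup>2) * leading_phase a \<delta> (z + of_real (T j)) - 0) \<le> C / (T j - M)"
      using ev
    proof eventually_elim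
      case (elim j)
      show ?case
      proof
        fix z assume z: "z \<in> X"
        have R: "Re (z + of_real (T j)) \<ge> T j - M" using zX(4)[OF z] by simp
        have "1 / a \<le> T j - M" using elim by linarith
        then have "norm (D (z + of_real (T j)) - of_real (A\<^sup>2) * leading_phase a \<delta> (z + of_real (T j))) \<le> C / Re (z + of_real (T j)) ^ 1"
          using R zX(2)[OF z] by (intro C(2)) auto
        also have "\<dots> \<le> C / (T j - M)"
          using R C(1) \<open>1 / a \<le> T j - M\<close> X1 by (auto intro!: divide_left_mono mult_pos_pos)
        finally show "norm (D (z + of_real (T j)) - of_real (A\<^sup>2) * leading_phase a \<delta> (z + of_real (T j)) - 0) \<le> C / (T j - M)" by simp
      qed
    qed
    have "filterlim (\<lambda>j. - M + T j) at_top sequentially"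
      by (rule filterlim_tendsto_add_at_top[OF tendsto_const Tinf])
    then show "(\<lambda>j. C / (T j - M)) \<longlonglongrightarrow> 0"
      by (intro tendsto_divide_0[OF tendsto_const] filterlim_at_top_imp_at_infinity) simp
  qed
  have cont: "continuous_on UNIV (leading_phase a \<delta>)" "continuous_on UNIV G"
    unfolding leading_phase_def[abs_def] G_def[abs_def] by (intro continuous_intros)+
  have bd: "bounded (leading_phase a \<delta> ` X)" "bounded (G ` X)"
    unfolding X_def using cont by (auto intro: bounded_image_ball)
  have bc: "bounded ((\<lambda>z. c) ` X)" for c :: complex
    by (rule bounded_subset[of "{c}"]) auto
  have "uniform_limit X (\<lambda>j z. of_real (cos (T j)) * leading_phase a \<delta> z + of_real (sin (T j)) * G z)
      (\<lambda>z. of_real 1 * leading_phase a \<delta> z + of_real 0 * G z) sequentially"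
    by (intro uniform_limit_add uniform_lim_mult uniform_limit_scalar tendsto_of_real uniform_limit_const cT sT bd bc)
  then have u2: "uniform_limit X (\<lambda>j z. of_real (A\<^sup>2) * leading_phase a \<delta> (z + of_real (T j)))
      (\<lambda>z. of_real (A\<^sup>2) * leading_phase a \<delta> z) sequentially"
    unfolding shift by (intro uniform_lim_mult uniform_limit_const bd bc) simp
  have ul: "uniform_limit X (\<lambda>j z. D (z + of_real (T j))) (\<lambda>z. of_real (A\<^sup>2) * leading_phase a \<delta> z) sequentially"
    using uniform_limit_add[OF u1 u2] by simp
  have hol: "\<forall>\<^sub>F j in sequentially. (\<lambda>z. D (z + of_real (T j))) holomorphic_on X"
    using ev
  proof eventually_elim
    case (elim j)
    have "D holomorphic_on ((\<lambda>z. z + of_real (T j)) ` X)"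
    proof (rule D)
      fix k assume "k \<in> (\<lambda>z. z + of_real (T j)) ` X"
      then obtain z where z: "z \<in> X" "k = z + of_real (T j)" by blast
      have "0 < 1 / a" using a by simp
      then show "Re k > 0" using zX(4)[OF z(1)] elim unfolding z(2) plus_complex.sel Re_complex_of_real by linarith
    qed
    then have "(D \<circ> (\<lambda>z. z + of_real (T j))) holomorphic_on X"
      by (intro holomorphic_on_compose) (auto intro!: holomorphic_intros)
    then show ?case by (simp add: o_def)
  qed
  define d where "d = of_real (A\<^sup>2) * (of_real (1 - a\<^sup>2) * cos (z0 - of_real \<delta>) * cos (of_real a * (z0 - of_real \<delta>) + of_real (a * \<delta> - \<delta>)))"
  have "((\<lambda>z. of_real (A\<^sup>2) * phase_det a (a * \<delta> - \<delta>) (z - of_real \<delta>)) has_field_derivative d) (at z0)"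
  proof -
    have "((\<lambda>z. z - of_real \<delta>) has_field_derivative 1) (at z0)" by (auto intro!: derivative_eq_intros)
    from DERIV_cmult[OF DERIV_chain2[OF phase_det_deriv this]] show ?thesis unfolding d_def by (simp only: mult_1_right)
  qed
  then have deriv: "((\<lambda>z. of_real (A\<^sup>2) * leading_phase a \<delta> z) has_field_derivative d) (at z0)"
    by (simp add: leading_phase_eq[abs_def])
  have d0: "d \<noteq> 0"
    using phase_det_deriv_nonzero[OF a, of "z0 - of_real \<delta>" "a * \<delta> - \<delta>"] z0(2) A unfolding d_def by simp
  have "\<forall>\<^sub>F j in sequentially. \<exists>z\<in>ball z0 r. D (z + of_real (T j)) = 0"
    by (rule hurwitz_zero_persists[OF _ hol[unfolded X_def] _ ul[unfolded X_def] _ deriv d0])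
      (use z0 in \<open>auto simp: r_def leading_phase_def[abs_def] intro!: holomorphic_intros\<close>)
  with ev have "\<forall>\<^sub>F j in sequentially. T j > M + 1 / a + \<bar>B\<bar> \<and> (\<exists>z\<in>ball z0 r. D (z + of_real (T j)) = 0)"
    by (rule eventually_conj)
  from eventually_happens'[OF sequentially_bot this] obtain j z where
    j: "T j > M + 1 / a + \<bar>B\<bar>" and z: "z \<in> X" "D (z + of_real (T j)) = 0" unfolding X_def by auto
  have "0 < 1 / a" using a by simp
  then have "Re (z + of_real (T j)) > B"
    using zX(4)[OF z(1)] j unfolding plus_complex.sel Re_complex_of_real by linarith
  moreover have "Im (z + of_real (T j)) > 0" using zX(3)[OF z(1)] by simp
  ultimately show ?thesis using z(2) by blast
qed

section \<open>The degenerate case: splitting triple zeros of the leading phase\<close>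

lemma sin_cos_small:
  fixes z :: complex assumes z: "norm z \<le> 1"
  shows "norm (cos z - 1) \<le> 3 * norm z" "norm (sin z) \<le> 3 * norm z" "norm (sin z - z) \<le> 3 * (norm z)\<^sup>2"
proof -
  define S where "S = cball (0::complex) (norm z)"
  have S: "convex S" "0 \<in> S" "z \<in> S" by (auto simp: S_def)
  have e3: "exp \<bar>Im w\<bar> \<le> 3" if "w \<in> S" for w
  proof -
    have "\<bar>Im w\<bar> \<le> 1" using abs_Im_le_cmod[of w] that z by (simp add: S_def)
    then have "exp \<bar>Im w\<bar> \<le> exp 1" by simp
    also have "exp 1 \<le> (3::real)" by (rule exp_le)
    finally show ?thesis .
  qed
  have c: "norm (cos w - 1) \<le> 3 * norm w" if "w \<in> S" for w
  proof -
    have "norm (cos w - cos 0) \<le> 3 * norm (w - 0)"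
    proof (rule field_differentiable_bound[OF S(1), where f'="\<lambda>w. - sin w"])
      show "(cos has_field_derivative - sin x) (at x within S)" for x by (auto intro!: derivative_eq_intros)
      show "norm (- sin x) \<le> 3" if "x \<in> S" for x using order_trans[OF norm_sin_le_exp e3[OF that]] by simp
    qed (use that S in auto)
    then show ?thesis by simp
  qed
  show "norm (cos z - 1) \<le> 3 * norm z" using c[OF S(3)] .
  have "norm (sin z - sin 0) \<le> 3 * norm (z - 0)"
  proof (rule field_differentiable_bound[OF S(1), where f'=cos])
    show "(sin has_field_derivative cos x) (at x within S)" for x by (auto intro!: derivative_eq_intros)
    show "norm (cos x) \<le> 3" if "x \<in> S" for x using order_trans[OF norm_cos_le_exp e3[OF that]] .
  qed (use S in auto)
  then show "norm (sin z) \<le> 3 * norm z" by simp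
  have "norm ((sin z - z) - (sin 0 - 0)) \<le> (3 * norm z) * norm (z - 0)"
  proof (rule field_differentiable_bound[OF S(1), where f'="\<lambda>w. cos w - 1" and f="\<lambda>w. sin w - w"])
    show "((\<lambda>w. sin w - w) has_field_derivative cos x - 1) (at x within S)" for x by (auto intro!: derivative_eq_intros)
    show "norm (cos x - 1) \<le> 3 * norm z" if "x \<in> S" for x
    proof -
      have "norm x \<le> norm z" using that by (simp add: S_def)
      then show ?thesis using c[OF that] by linarith
    qed
  qed (use S in auto)
  then show "norm (sin z - z) \<le> 3 * (norm z)\<^sup>2" by (simp add: power2_eq_square)
qed

text \<open>In the derivative the products of cosines cancel and (1 - a^2) sin w sin (a w) remains,
  with leading term (1 - a^2) a w^2; integrating gives the cubic coefficient. A crude cubic bound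
  for the error of the derivative is enough for the fourth power here.\<close>

lemma cubic_expansion:
  fixes z :: complex
  assumes a: "0 < a" "a < 1" and z: "norm z \<le> 1"
  shows "norm (of_real a * sin z * cos (of_real a * z) - cos z * sin (of_real a * z) - of_real (a * (1 - a\<^sup>2) / 3) * z ^ 3) \<le> 12 * norm z ^ 4"
proof -
  define S where "S = cball (0::complex) (norm z)"
  have S: "convex S" "0 \<in> S" "z \<in> S" by (auto simp: S_def)
  define f :: "complex \<Rightarrow> complex" where "f w = of_real a * sin w * cos (of_real a * w) - cos w * sin (of_real a * w) - of_real (a * (1 - a\<^sup>2) / 3) * w ^ 3" for w
  define f' :: "complex \<Rightarrow> complex" where "f' w = of_real (1 - a\<^sup>2) * (sin w * sin (of_real a * w) - of_real a * w\<^sup>2)" for w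
  have "norm (f z - f 0) \<le> (12 * norm z ^ 3) * norm (z - 0)"
  proof (rule field_differentiable_bound[OF S(1), where f'=f'])
    fix w assume w: "w \<in> S"
    show "(f has_field_derivative f' w) (at w within S)"
      unfolding f_def[abs_def] f'_def
      by (auto intro!: derivative_eq_intros simp: field_simps power2_eq_square)
    have wz: "norm w \<le> norm z" using w by (simp add: S_def)
    then have w1: "norm w \<le> 1" using z by linarith
    have aw: "norm (of_real a * w) \<le> norm w" using a mult_right_mono[of a 1 "norm w"] by (simp add: norm_mult)
    then have aw1: "norm (of_real a * w) \<le> 1" using w1 by linarith
    have "sin w * sin (of_real a * w) - of_real a * w\<^sup>2 =
        (sin w - w) * sin (of_real a * w) + w * (sin (of_real a * w) - of_real a * w)"
      by (simp add: algebra_simps power2_eq_square)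
    then have "norm (sin w * sin (of_real a * w) - of_real a * w\<^sup>2) \<le>
        norm (sin w - w) * norm (sin (of_real a * w)) + norm w * norm (sin (of_real a * w) - of_real a * w)"
      by (metis norm_mult norm_triangle_ineq)
    also have "\<dots> \<le> (3 * (norm w)\<^sup>2) * (3 * norm w) + norm w * (3 * (norm w)\<^sup>2)"
    proof (intro add_mono mult_mono)
      show "norm (sin (of_real a * w)) \<le> 3 * norm w" using sin_cos_small(2)[OF aw1] aw by linarith
      have "(norm (of_real a * w))\<^sup>2 \<le> (norm w)\<^sup>2" using aw by (intro power_mono) auto
      then show "norm (sin (of_real a * w) - of_real a * w) \<le> 3 * (norm w)\<^sup>2"
        using sin_cos_small(3)[OF aw1] by linarith
    qed (use sin_cos_small[OF w1] in auto)
    also have "\<dots> = 12 * norm w ^ 3" by (simp add: power2_eq_square power3_eq_cube)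
    also have "\<dots> \<le> 12 * norm z ^ 3" using wz by (intro mult_left_mono power_mono) auto
    finally have b: "norm (sin w * sin (of_real a * w) - of_real a * w\<^sup>2) \<le> 12 * norm z ^ 3" .
    have a2: "0 \<le> 1 - a\<^sup>2" "1 - a\<^sup>2 \<le> 1" using a by (auto simp: power_le_one)
    have "norm (f' w) = (1 - a\<^sup>2) * norm (sin w * sin (of_real a * w) - of_real a * w\<^sup>2)"
      unfolding f'_def norm_mult norm_of_real using a2 by simp
    also have "\<dots> \<le> 1 * (12 * norm z ^ 3)" using a2 b by (intro mult_mono) auto
    finally show "norm (f' w) \<le> 12 * norm z ^ 3" by simp
  qed (use S in auto)
  then show ?thesis by (simp add: f_def power_def numeral_eq_Suc mult_ac)
qed

text \<open>At distance h from \<kappa> the leading phase has size h^3 and the correction size 1 /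
  \<kappa>; they balance at h = \<kappa>^(-1/3). After multiplication by \<kappa> the \<eta> term
  still contains two sines of arguments of order h, and the remainder is of order 1 / \<kappa>, so
  both vanish in the limit.\<close>

lemma nonreal_zeros_triple:
  fixes D :: "complex \<Rightarrow> complex" and A :: real
  assumes a: "0 < a" "a < 1" and A: "A \<noteq> 0"
    and D: "\<And>S. (\<And>k. k \<in> S \<Longrightarrow> Re k > 0) \<Longrightarrow> D holomorphic_on S"
    and asym: "\<And>R. strip_O (1 / a) R 2 (\<lambda>k. D k - of_real (A\<^sup>2) * (leading_phase a \<delta> k
       + of_real ((1 / a - a) / 8) * inverse k * (sin (k - of_real \<delta>) * sin (of_real a * k - of_real \<delta>))
       - of_real \<eta> * inverse k * (cos (k - of_real \<delta>) * cos (of_real a * k - of_real \<delta>))))"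
    and \<kappa>: "filterlim \<kappa> at_top sequentially" "\<And>j::nat. cos (\<kappa> j - \<delta>) = 0" "\<And>j. cos (a * \<kappa> j - \<delta>) = 0"
  shows "\<exists>k. Re k > B \<and> Im k > 0 \<and> D k = 0"
proof -
  define e where "e = (1 / a - a) / 8"
  define c where "c = a * (1 - a\<^sup>2) / 3"
  have a2: "a\<^sup>2 < 1" using a by (simp add: abs_square_less_1)
  have e: "e > 0" using a a2 by (simp add: e_def field_simps power2_eq_square)
  have c: "c > 0" using a a2 by (simp add: c_def)
  \<comment> \<open>The cube root of - e / c in the upper half-plane. As it is nonzero, it is a
    simple root of the cubic, as Hurwitz's theorem is applied here.\<close>
  define \<zeta>0 where "\<zeta>0 = of_real (root 3 (e / c)) * cis (pi / 3)"
  have "\<zeta>0 ^ 3 = of_real ((root 3 (e / c)) ^ 3) * cis (3 * (pi / 3))"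
    by (simp add: \<zeta>0_def power_mult_distrib Complex.DeMoivre)
  also have "\<dots> = - of_real (e / c)" using e c by (simp add: real_root_pow_pos)
  finally have \<zeta>0_cube: "of_real c * \<zeta>0 ^ 3 + of_real e = 0" using c by simp
  have Im0: "Im \<zeta>0 > 0" using e c by (simp add: \<zeta>0_def sin_60)
  define r where "r = Im \<zeta>0"
  define M where "M = norm \<zeta>0 + r"
  have M: "M > 0" using Im0 by (simp add: M_def r_def add_nonneg_pos)
  define X where "X = ball \<zeta>0 r"
  have zX: "norm z \<le> M" "Im z > 0" if "z \<in> X" for z
  proof -
    have d: "norm (z - \<zeta>0) < r" using that by (simp add: X_def dist_norm norm_minus_commute)
    show nz: "norm z \<le> M" using norm_triangle_sub[of z \<zeta>0] d by (simp add: M_def)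
    have "\<bar>Im (z - \<zeta>0)\<bar> < r" using abs_Im_le_cmod[of "z - \<zeta>0"] d by linarith
    then show "Im z > 0" by (simp add: r_def)
  qed
  define h where "h j = 1 / root 3 (\<kappa> j)" for j
  have "filterlim (\<lambda>j. root 3 (\<kappa> j)) at_top sequentially"
    unfolding filterlim_at_top_dense
  proof
    fix Z :: real
    have "\<forall>\<^sub>F j in sequentially. \<kappa> j > (max Z 0) ^ 3" using \<kappa>(1) unfolding filterlim_at_top_dense by blast
    then show "\<forall>\<^sub>F j in sequentially. root 3 (\<kappa> j) > Z"
    proof eventually_elim
      case (elim j)
      then have "root 3 ((max Z 0) ^ 3) < root 3 (\<kappa> j)" by simp
      then show ?case by (simp add: real_root_power_cancel)
    qed
  qed
  then have h0: "h \<longlonglongrightarrow> 0" unfolding h_def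
    by (intro tendsto_divide_0[OF tendsto_const] filterlim_at_top_imp_at_infinity)
  have ev: "\<forall>\<^sub>F j in sequentially. \<kappa> j > 2 + 1 / a + \<bar>B\<bar> \<and> h j < 1 / M"
    using \<kappa>(1) order_tendstoD(2)[OF h0, of "1 / M"] M unfolding filterlim_at_top_dense
    by (intro eventually_conj) auto
  have hk: "h j > 0" "\<kappa> j * h j ^ 3 = 1" if "\<kappa> j > 2 + 1 / a + \<bar>B\<bar>" for j
  proof -
    have k: "\<kappa> j > 0" using that a by (smt (verit) divide_pos_pos)
    then show "h j > 0" by (simp add: h_def)
    show "\<kappa> j * h j ^ 3 = 1" using k by (simp add: h_def power_divide real_root_pow_pos)
  qed
  have small: "norm (of_real (h j) * z) \<le> M * h j" "norm (of_real (h j) * z) \<le> 1"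
    if "\<kappa> j > 2 + 1 / a + \<bar>B\<bar> \<and> h j < 1 / M" "z \<in> X" for j z
  proof -
    show le: "norm (of_real (h j) * z) \<le> M * h j"
      using hk(1)[of j] that zX(1)[OF that(2)] mult_right_mono[of "norm z" M "h j"] by (simp add: norm_mult mult.commute)
    have "M * h j \<le> 1" using that M by (simp add: field_simps)
    with le show "norm (of_real (h j) * z) \<le> 1" by linarith
  qed
  have Mh: "(\<lambda>j. K * (M * h j)) \<longlonglongrightarrow> 0" for K
    using tendsto_mult[OF tendsto_const tendsto_mult[OF tendsto_const h0], of K M] by simp
  have uc: "uniform_limit X (\<lambda>j z. cos (of_real (h j) * z)) (\<lambda>z. 1) sequentially"
    "uniform_limit X (\<lambda>j z. cos (of_real a * (of_real (h j) * z))) (\<lambda>z. 1) sequentially"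
    "uniform_limit X (\<lambda>j z. sin (of_real (h j) * z)) (\<lambda>z. 0) sequentially"
    "uniform_limit X (\<lambda>j z. sin (of_real a * (of_real (h j) * z))) (\<lambda>z. 0) sequentially"
  proof -
    have sa: "norm (of_real a * (of_real (h j) * z)) \<le> M * h j" "norm (of_real a * (of_real (h j) * z)) \<le> 1"
      if "\<kappa> j > 2 + 1 / a + \<bar>B\<bar> \<and> h j < 1 / M" "z \<in> X" for j z
    proof -
      have "norm (of_real a * (of_real (h j) * z)) \<le> norm (of_real (h j) * z)"
        using a mult_right_mono[of a 1 "norm (of_real (h j) * z)"] by (simp add: norm_mult)
      then show "norm (of_real a * (of_real (h j) * z)) \<le> M * h j" "norm (of_real a * (of_real (h j) * z)) \<le> 1"
        using small[OF that] by linarith+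
    qed
    show "uniform_limit X (\<lambda>j z. cos (of_real (h j) * z)) (\<lambda>z. 1) sequentially"
      by (rule uniform_limit_bound[OF eventually_mono[OF ev] Mh[of 3]])
        (use sin_cos_small(1)[OF small(2)] small(1) in \<open>fastforce\<close>)
    show "uniform_limit X (\<lambda>j z. cos (of_real a * (of_real (h j) * z))) (\<lambda>z. 1) sequentially"
      by (rule uniform_limit_bound[OF eventually_mono[OF ev] Mh[of 3]])
        (use sin_cos_small(1)[OF sa(2)] sa(1) in \<open>fastforce\<close>)
    show "uniform_limit X (\<lambda>j z. sin (of_real (h j) * z)) (\<lambda>z. 0) sequentially"
      by (rule uniform_limit_bound[OF eventually_mono[OF ev] Mh[of 3]])
        (use sin_cos_small(2)[OF small(2)] small(1) in \<open>fastforce\<close>)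
    show "uniform_limit X (\<lambda>j z. sin (of_real a * (of_real (h j) * z))) (\<lambda>z. 0) sequentially"
      by (rule uniform_limit_bound[OF eventually_mono[OF ev] Mh[of 3]])
        (use sin_cos_small(2)[OF sa(2)] sa(1) in \<open>fastforce\<close>)
  qed
  define k :: "nat \<Rightarrow> complex \<Rightarrow> complex" where "k j z = of_real (\<kappa> j) + of_real (h j) * z" for j z
  have Rek: "Re (k j z) \<ge> \<kappa> j - 1" "\<bar>Im (k j z)\<bar> \<le> 1"
    if "\<kappa> j > 2 + 1 / a + \<bar>B\<bar> \<and> h j < 1 / M" "z \<in> X" for j z
    using abs_Re_le_cmod[of "of_real (h j) * z"] abs_Im_le_cmod[of "of_real (h j) * z"] small(2)[OF that]
    by (auto simp: k_def)
  have uu: "uniform_limit X (\<lambda>j z. of_real (\<kappa> j) * inverse (k j z)) (\<lambda>z. 1) sequentially"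
  proof (rule uniform_limit_bound[OF eventually_mono[OF ev] Mh[of 1]], intro ballI)
    fix j z assume j: "\<kappa> j > 2 + 1 / a + \<bar>B\<bar> \<and> h j < 1 / M" and z: "z \<in> X"
    have "0 < 1 / a" using a by simp
    then have k1: "\<kappa> j - 1 \<ge> 1" using j by linarith
    then have n1: "norm (k j z) \<ge> 1" using Rek(1)[OF j z] complex_Re_le_cmod[of "k j z"] by linarith
    then have "k j z \<noteq> 0" by auto
    then have "of_real (\<kappa> j) * inverse (k j z) - 1 = - (of_real (h j) * z) / k j z"
      by (simp add: k_def field_simps)
    then have "norm (of_real (\<kappa> j) * inverse (k j z) - 1) = norm (of_real (h j) * z) / norm (k j z)"
      by (simp add: norm_divide)
    also have "\<dots> \<le> M * h j / 1" using n1 small(1)[OF j z] M hk(1)[of j] j by (intro frac_le) auto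
    finally show "norm (of_real (\<kappa> j) * inverse (k j z) - 1) \<le> 1 * (M * h j)" by simp
  qed
  \<comment> \<open>The leading phase near \<open>\<kappa> j\<close> up to sign: around common zeros
    of the two cosines the addition theorems exchange sines and cosines.\<close>
  define f where "f w = of_real a * sin w * cos (of_real a * w) - cos w * sin (of_real a * w)" for w :: complex
  have uf: "uniform_limit X (\<lambda>j z. of_real (\<kappa> j) * f (of_real (h j) * z)) (\<lambda>z. of_real c * z ^ 3) sequentially"
  proof (rule uniform_limit_bound[OF eventually_mono[OF ev] Mh[of "12 * M ^ 3"]], intro ballI)
    fix j z assume j: "\<kappa> j > 2 + 1 / a + \<bar>B\<bar> \<and> h j < 1 / M" and z: "z \<in> X"
    have hp: "h j > 0" "\<kappa> j * h j ^ 3 = 1" using hk[of j] j by auto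
    have kp: "\<kappa> j > 0" using hp by (metis zero_less_mult_pos2 zero_less_one zero_less_power)
    have "of_real (\<kappa> j) * f (of_real (h j) * z) - of_real c * z ^ 3 =
        of_real (\<kappa> j) * (f (of_real (h j) * z) - of_real c * (of_real (h j) * z) ^ 3)"
    proof -
      have "of_real (\<kappa> j) * (of_real c * (of_real (h j) * z) ^ 3) = of_real (\<kappa> j * h j ^ 3) * (of_real c * z ^ 3)"
        by (simp add: power_mult_distrib mult_ac)
      then show ?thesis unfolding hp(2) by (simp only: right_diff_distrib of_real_1 mult_1_left)
    qed
    then have "norm (of_real (\<kappa> j) * f (of_real (h j) * z) - of_real c * z ^ 3) =
        \<kappa> j * norm (f (of_real (h j) * z) - of_real c * (of_real (h j) * z) ^ 3)"
      using kp by (simp add: norm_mult)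
    also have "\<dots> \<le> \<kappa> j * (12 * norm (of_real (h j) * z) ^ 4)"
      using cubic_expansion[OF a small(2)[OF j z]] kp unfolding f_def c_def by (intro mult_left_mono) auto
    also have "\<dots> \<le> \<kappa> j * (12 * (M * h j) ^ 4)"
      using small(1)[OF j z] kp by (intro mult_left_mono power_mono) auto
    also have "\<dots> = (\<kappa> j * h j ^ 3) * (12 * M ^ 4 * h j)"
      by (simp add: power_mult_distrib numeral_eq_Suc mult_ac)
    also have "\<dots> = 12 * M ^ 3 * (M * h j)" unfolding hp(2) by (simp add: numeral_eq_Suc mult_ac)
    finally show "norm (of_real (\<kappa> j) * f (of_real (h j) * z) - of_real c * z ^ 3) \<le> 12 * M ^ 3 * (M * h j)" .
  qed
  \<comment> \<open>Where both cosines vanish both sines are \<plusminus>1. The sign of their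
    product may vary with j, so it is divided out before passing to the limit.\<close>
  define \<sigma> where "\<sigma> j = sin (\<kappa> j - \<delta>) * sin (a * \<kappa> j - \<delta>)" for j
  have \<sigma>: "\<sigma> j * \<sigma> j = 1" for j
  proof -
    have "(sin (\<kappa> j - \<delta>))\<^sup>2 = 1" "(sin (a * \<kappa> j - \<delta>))\<^sup>2 = 1"
      using sin_cos_squared_add[of "\<kappa> j - \<delta>"] sin_cos_squared_add[of "a * \<kappa> j - \<delta>"] \<kappa>(2,3)[of j] by simp_all
    moreover have "\<sigma> j * \<sigma> j = (sin (\<kappa> j - \<delta>))\<^sup>2 * (sin (a * \<kappa> j - \<delta>))\<^sup>2"
      by (simp add: \<sigma>_def power2_eq_square mult_ac)
    ultimately show ?thesis by simp
  qed
  then have \<sigma>abs: "\<bar>\<sigma> j\<bar> = 1" for j using square_eq_1_iff[of "\<sigma> j"] by auto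
  let ?Q = "\<lambda>k. leading_phase a \<delta> k
       + of_real e * inverse k * (sin (k - of_real \<delta>) * sin (of_real a * k - of_real \<delta>))
       - of_real \<eta> * inverse k * (cos (k - of_real \<delta>) * cos (of_real a * k - of_real \<delta>))"
  have X1: "1 / a \<ge> 1" using a by simp
  obtain C where C: "C \<ge> 0" "\<And>k. Re k \<ge> 1 / a \<Longrightarrow> \<bar>Im k\<bar> \<le> 1 \<Longrightarrow> norm (D k - of_real (A\<^sup>2) * ?Q k) \<le> C / Re k ^ 2"
    using strip_OE[OF asym X1, of 1] unfolding e_def by metis
  define H :: "nat \<Rightarrow> complex \<Rightarrow> complex" where "H j z = of_real (\<sigma> j * \<kappa> j / A\<^sup>2) * D (k j z)" for j z
  have Qk: "of_real (\<sigma> j * \<kappa> j) * ?Q (k j z) = of_real (\<kappa> j) * f (of_real (h j) * z)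
      + of_real e * ((of_real (\<kappa> j) * inverse (k j z)) * (cos (of_real (h j) * z) * cos (of_real a * (of_real (h j) * z))))
      - of_real \<eta> * ((of_real (\<kappa> j) * inverse (k j z)) * (sin (of_real (h j) * z) * sin (of_real a * (of_real (h j) * z))))" for j z
  proof -
    define w where "w = of_real (h j) * z"
    define s1 where "s1 = complex_of_real (sin (\<kappa> j - \<delta>))" define s2 where "s2 = complex_of_real (sin (a * \<kappa> j - \<delta>))"
    have 1: "k j z - of_real \<delta> = of_real (\<kappa> j - \<delta>) + w" by (simp add: k_def w_def)
    have 2: "of_real a * k j z - of_real \<delta> = of_real (a * \<kappa> j - \<delta>) + of_real a * w" by (simp add: k_def w_def algebra_simps)
    have t: "sin (k j z - of_real \<delta>) = s1 * cos w" "cos (k j z - of_real \<delta>) = - s1 * sin w"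
      "sin (of_real a * k j z - of_real \<delta>) = s2 * cos (of_real a * w)" "cos (of_real a * k j z - of_real \<delta>) = - s2 * sin (of_real a * w)"
      unfolding 1 2 sin_add cos_add cos_of_real sin_of_real \<kappa>(2,3) s1_def s2_def by simp_all
    have ss: "of_real (\<sigma> j) = s1 * s2" by (simp add: \<sigma>_def s1_def s2_def)
    have ss1: "s1 * s2 * (s1 * s2) = 1" using \<sigma>[of j] unfolding ss[symmetric] by (metis of_real_1 of_real_mult)
    \<comment> \<open>A polynomial identity in which the signs enter only through (S1 S2)^2 =
      1.\<close>
    have gen: "(S1 * S2) * K * ((S1 * cw) * (- S2 * saw) - aa * (- S1 * sw) * (S2 * caw) + ee * i * ((S1 * cw) * (S2 * caw))
        - h * i * ((- S1 * sw) * (- S2 * saw))) =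
        K * (aa * sw * caw - cw * saw) + ee * ((K * i) * (cw * caw)) - h * ((K * i) * (sw * saw))"
      if "S1 * S2 * (S1 * S2) = 1" for S1 S2 K cw sw caw saw aa ee i h :: complex
    proof -
      have "(S1 * S2) * K * ((S1 * cw) * (- S2 * saw) - aa * (- S1 * sw) * (S2 * caw) + ee * i * ((S1 * cw) * (S2 * caw))
        - h * i * ((- S1 * sw) * (- S2 * saw))) = (S1 * S2 * (S1 * S2)) *
        (K * (aa * sw * caw - cw * saw) + ee * ((K * i) * (cw * caw)) - h * ((K * i) * (sw * saw)))"
        by (simp add: algebra_simps)
      then show ?thesis by (simp add: that)
    qed
    show ?thesis
      unfolding leading_phase_def t of_real_mult ss f_def w_def[symmetric] by (rule gen[OF ss1])
  qed
  have bc: "bounded ((\<lambda>z. d) ` X)" for d :: complex by (rule bounded_subset[of "{d}"]) auto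
  have uQ: "uniform_limit X (\<lambda>j z. of_real (\<sigma> j * \<kappa> j) * ?Q (k j z))
      (\<lambda>z. of_real c * z ^ 3 + of_real e * (1 * (1 * 1)) - of_real \<eta> * (1 * (0 * 0))) sequentially"
    unfolding Qk
    by (intro uniform_limit_add uniform_limit_minus uf uniform_lim_mult uniform_limit_const uc uu bc)
  have uE: "uniform_limit X (\<lambda>j z. of_real (\<sigma> j * \<kappa> j / A\<^sup>2) * (D (k j z) - of_real (A\<^sup>2) * ?Q (k j z))) (\<lambda>z. 0) sequentially"
  proof (rule uniform_limit_bound[OF eventually_mono[OF ev]], intro ballI)
    fix j z assume j: "\<kappa> j > 2 + 1 / a + \<bar>B\<bar> \<and> h j < 1 / M" and z: "z \<in> X"
    have "0 < 1 / a" using a by simp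
    then have k2: "\<kappa> j \<ge> 2" "1 / a \<le> \<kappa> j - 1" using j by linarith+
    note R = Rek[OF j z]
    have half: "\<kappa> j / 2 \<le> Re (k j z)" using R(1) k2 by simp
    have "norm (D (k j z) - of_real (A\<^sup>2) * ?Q (k j z)) \<le> C / Re (k j z) ^ 2" using R k2 by (intro C(2)) linarith+
    also have "\<dots> \<le> C / (\<kappa> j / 2) ^ 2" using half k2 C(1) by (intro divide_left_mono power_mono) auto
    finally have b: "norm (D (k j z) - of_real (A\<^sup>2) * ?Q (k j z)) \<le> C / (\<kappa> j / 2) ^ 2" .
    have "norm (of_real (\<sigma> j * \<kappa> j / A\<^sup>2) * (D (k j z) - of_real (A\<^sup>2) * ?Q (k j z)) - 0) =
        \<kappa> j / A\<^sup>2 * norm (D (k j z) - of_real (A\<^sup>2) * ?Q (k j z))"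
      using k2 unfolding norm_mult diff_0_right norm_of_real abs_divide abs_mult \<sigma>abs by simp
    also have "\<dots> \<le> \<kappa> j / A\<^sup>2 * (C / (\<kappa> j / 2) ^ 2)" using k2 by (intro mult_left_mono b) auto
    also have "\<dots> = (4 * C / A\<^sup>2) / \<kappa> j" using k2 A by (simp add: field_simps power2_eq_square)
    finally show "norm (of_real (\<sigma> j * \<kappa> j / A\<^sup>2) * (D (k j z) - of_real (A\<^sup>2) * ?Q (k j z)) - 0) \<le> (4 * C / A\<^sup>2) / \<kappa> j" .
  next
    show "(\<lambda>j. (4 * C / A\<^sup>2) / \<kappa> j) \<longlonglongrightarrow> 0"
      by (intro tendsto_divide_0[OF tendsto_const] filterlim_at_top_imp_at_infinity \<kappa>(1))
  qed
  have "of_real (\<sigma> j * \<kappa> j / A\<^sup>2) * (D (k j z) - of_real (A\<^sup>2) * ?Q (k j z)) + of_real (\<sigma> j * \<kappa> j) * ?Q (k j z) = H j z" for j z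
    using A unfolding H_def by (simp add: field_simps)
  then have ul: "uniform_limit X H (\<lambda>z. of_real c * z ^ 3 + of_real e) sequentially"
    using uniform_limit_add[OF uE uQ] by simp
  have hol: "\<forall>\<^sub>F j in sequentially. H j holomorphic_on X"
    using ev
  proof eventually_elim
    case (elim j)
    have "D holomorphic_on (k j ` X)"
    proof (rule D)
      fix w assume "w \<in> k j ` X"
      then obtain z where z: "z \<in> X" "w = k j z" by blast
      have "0 < 1 / a" using a by simp
      then show "Re w > 0" using Rek(1)[OF elim z(1)] elim unfolding z(2) by linarith
    qed
    moreover have "k j holomorphic_on X" unfolding k_def[abs_def] by (intro holomorphic_intros)
    ultimately have "(D \<circ> k j) holomorphic_on X" by (intro holomorphic_on_compose)
    then show ?case unfolding H_def[abs_def] o_def by (intro holomorphic_intros)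
  qed
  have "\<forall>\<^sub>F j in sequentially. \<exists>z\<in>ball \<zeta>0 r. H j z = 0"
  proof (rule hurwitz_zero_persists[OF _ hol[unfolded X_def] _ ul[unfolded X_def] \<zeta>0_cube])
    show "((\<lambda>z. of_real c * z ^ 3 + of_real e) has_field_derivative of_real c * (3 * \<zeta>0\<^sup>2)) (at \<zeta>0)"
      by (auto intro!: derivative_eq_intros)
    show "of_real c * (3 * \<zeta>0\<^sup>2) \<noteq> 0" using c Im0 by auto
  qed (use Im0 in \<open>auto simp: r_def intro!: holomorphic_intros\<close>)
  with ev have "\<forall>\<^sub>F j in sequentially. (\<kappa> j > 2 + 1 / a + \<bar>B\<bar> \<and> h j < 1 / M) \<and> (\<exists>z\<in>ball \<zeta>0 r. H j z = 0)"
    by (rule eventually_conj)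
  from eventually_happens'[OF sequentially_bot this] obtain j z where
    j: "\<kappa> j > 2 + 1 / a + \<bar>B\<bar> \<and> h j < 1 / M" and z: "z \<in> X" "H j z = 0" unfolding X_def by auto
  have "0 < 1 / a" using a by simp
  then have "Re (k j z) > B" using Rek(1)[OF j z(1)] j by linarith
  moreover have "Im (k j z) > 0" using zX(2)[OF z(1)] hk(1)[of j] j by (simp add: k_def)
  moreover have "D (k j z) = 0"
  proof -
    have "\<kappa> j \<noteq> 0" "\<sigma> j \<noteq> 0" using hk(2)[of j] j \<sigma>[of j] by auto
    then show ?thesis using z(2) A by (simp add: H_def)
  qed
  ultimately show ?thesis by blast
qed

section \<open>Combining the two cases and returning to eigenvalues\<close>

lemma phase_det_shift: "phase_det a b (w + of_real (pi * of_int t)) = of_real (cos (pi * of_int t)) * phase_det a (b + a * (pi * of_int t)) w"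
proof -
  have 1: "of_real a * (w + of_real (pi * of_int t)) + of_real b = of_real a * w + of_real (b + a * (pi * of_int t))"
    by (simp add: algebra_simps)
  have 2: "sin (w + of_real (pi * of_int t)) = of_real (cos (pi * of_int t)) * sin w"
    "cos (w + of_real (pi * of_int t)) = of_real (cos (pi * of_int t)) * cos w"
    unfolding sin_add cos_add sin_of_real cos_of_real sin_npi_int by simp_all
  show ?thesis unfolding phase_det_def 1 2 by (simp add: algebra_simps)
qed

lemma phase_det_phase_shift: "phase_det a (b - pi * of_int s) w = of_real (cos (pi * of_int s)) * phase_det a b w"
proof -
  have 1: "of_real a * w + of_real (b - pi * of_int s) = (of_real a * w + of_real b) - of_real (pi * of_int s)"
    by (simp add: algebra_simps)
  have 2: "sin ((of_real a * w + of_real b) - of_real (pi * of_int s)) = of_real (cos (pi * of_int s)) * sin (of_real a * w + of_real b)"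
    "cos ((of_real a * w + of_real b) - of_real (pi * of_int s)) = of_real (cos (pi * of_int s)) * cos (of_real a * w + of_real b)"
    unfolding sin_diff cos_diff sin_of_real cos_of_real sin_npi_int by simp_all
  show ?thesis unfolding phase_det_def 1 2 by (simp add: algebra_simps)
qed

text \<open>Translating w by \<pi> t and the phase by \<pi> s changes \<open>phase_det\<close> only
  by a sign, so it suffices to bring some b + a \<pi> t - \<pi> s into the window of
  \<open>phase_det_nonreal_zero\<close>. This succeeds if and only if some zero of the second cosine
  lies strictly between neighbouring zeros of the first; otherwise all of them are common
  zeros.\<close>

lemma bessel_det_nonreal_zeros:
  assumes a: "0 < a" "a < 1"
  shows "\<exists>k. Re k > B \<and> Im k > 0 \<and> bessel_det a \<eta> k = 0"
proof -
  obtain A \<delta> :: real where A: "A \<noteq> 0" and asym0: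
    "\<And>R. strip_O (1 / a) R 2 (\<lambda>k. liouville_det a \<eta> k - of_real (A\<^sup>2) * (
       sin (k - of_real \<delta>) * cos (of_real a * k - of_real \<delta>) - of_real a * cos (k - of_real \<delta>) * sin (of_real a * k - of_real \<delta>)
       + of_real ((1 / a - a) / 8) * inverse k * (sin (k - of_real \<delta>) * sin (of_real a * k - of_real \<delta>))
       - of_real \<eta> * inverse k * (cos (k - of_real \<delta>) * cos (of_real a * k - of_real \<delta>))))"
    using liouville_det_asymptotics[OF a, of \<eta>] by blast
  have asym: "strip_O (1 / a) R 2 (\<lambda>k. liouville_det a \<eta> k - of_real (A\<^sup>2) * (leading_phase a \<delta> k
       + of_real ((1 / a - a) / 8) * inverse k * (sin (k - of_real \<delta>) * sin (of_real a * k - of_real \<delta>))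
       - of_real \<eta> * inverse k * (cos (k - of_real \<delta>) * cos (of_real a * k - of_real \<delta>))))" for R
    unfolding leading_phase_def by (rule asym0)
  have hol: "liouville_det a \<eta> holomorphic_on S" if "\<And>k. k \<in> S \<Longrightarrow> Re k > 0" for S
    using liouville_det_holomorphic[OF a(1) that] .
  define b where "b = a * \<delta> - \<delta>"
  \<comment> \<open>The absolute value forces Re k > 0, where zeros of \<open>liouville_det\<close>
    are zeros of \<open>bessel_det\<close>.\<close>
  have "\<exists>k. Re k > \<bar>B\<bar> \<and> Im k > 0 \<and> liouville_det a \<eta> k = 0"
  proof (cases "\<exists>t s :: int. \<bar>(b + a * (pi * of_int t) - pi * of_int s) - pi / 2\<bar> < a * pi / 2")
    case True
    then obtain t s :: int where ts: "\<bar>(b + a * (pi * of_int t) - pi * of_int s) - pi / 2\<bar> < a * pi / 2" by blast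
    obtain w where w: "Im w > 0" "phase_det a (b + a * (pi * of_int t) - pi * of_int s) w = 0"
      using phase_det_nonreal_zero[OF a ts] by blast
    have "phase_det a (b + a * (pi * of_int t)) w = 0"
      using w(2) unfolding phase_det_phase_shift by (simp add: cos_npi_int split: if_splits)
    then have "phase_det a b (w + of_real (pi * of_int t)) = 0" unfolding phase_det_shift by simp
    then have zero: "leading_phase a \<delta> (w + of_real (pi * of_int t) + of_real \<delta>) = 0"
      unfolding leading_phase_eq b_def by simp
    have asym1: "strip_O (1 / a) R 1 (\<lambda>k. liouville_det a \<eta> k - of_real (A\<^sup>2) * leading_phase a \<delta> k)" for R
    proof -
      have X: "1 / a \<ge> 1" using a by simp
      let ?O = "strip_O (1 / a) R"
      have trig: "?O 0 (\<lambda>k. cos (k - of_real \<delta>))" "?O 0 (\<lambda>k. sin (k - of_real \<delta>))"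
        "?O 0 (\<lambda>k. cos (of_real a * k - of_real \<delta>))" "?O 0 (\<lambda>k. sin (of_real a * k - of_real \<delta>))"
        using strip_O_trig[of 1 "1 / a" R \<delta>] strip_O_trig[of a "1 / a" R \<delta>] a by auto
      note m = strip_O_mult[OF X]
      have p: "?O (0 + ((0 + 1) + (0 + 0))) (\<lambda>k. of_real (A\<^sup>2) * (of_real ((1 / a - a) / 8) * inverse k * (sin (k - of_real \<delta>) * sin (of_real a * k - of_real \<delta>))))"
        by (rule m[OF strip_O_const m[OF m[OF strip_O_const strip_O_inverse[OF X]] m[OF trig(2) trig(4)]]])
      have q: "?O (0 + ((0 + 1) + (0 + 0))) (\<lambda>k. of_real (- (A\<^sup>2)) * (of_real \<eta> * inverse k * (cos (k - of_real \<delta>) * cos (of_real a * k - of_real \<delta>))))"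
        by (rule m[OF strip_O_const m[OF m[OF strip_O_const strip_O_inverse[OF X]] m[OF trig(1) trig(3)]]])
      from strip_O_add[OF X strip_O_add[OF X strip_O_weaken[OF X asym[of R], of "0 + ((0 + 1) + (0 + 0))"] p] q]
      show ?thesis by (simp add: algebra_simps)
    qed
    show ?thesis
      by (rule nonreal_zeros_recurrent[OF a A hol asym1 zero]) (use w in auto)
  next
    case False
    define \<kappa> where "\<kappa> j = (pi / 2 + pi * real j + \<delta>) / a" for j :: nat
    have "filterlim (\<lambda>j. (pi / 2 + \<delta>) / a + pi / a * real j) at_top sequentially"
      using a by (intro filterlim_tendsto_add_at_top[OF tendsto_const]
          filterlim_tendsto_pos_mult_at_top[OF tendsto_const] filterlim_real_sequentially) auto
    then have inf: "filterlim \<kappa> at_top sequentially"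
      by (simp add: \<kappa>_def[abs_def] add_divide_distrib algebra_simps)
    have c2: "cos (a * \<kappa> j - \<delta>) = 0" for j
      using a sin_npi_int[of "int j"] by (simp add: \<kappa>_def cos_add)
    have c1: "cos (\<kappa> j - \<delta>) = 0" for j
    proof -
      define x where "x = (pi / 2 + pi * real j - b) / (a * pi)"
      have \<kappa>x: "\<kappa> j - \<delta> = pi * x" using a by (simp add: \<kappa>_def x_def b_def field_simps)
      \<comment> \<open>In units of \<pi> the point \<open>\<kappa> j\<close> - \<delta> is x.
        Rounding puts it at distance at most 1/2 from an integer, while the failure of the window
        condition demands at least 1/2; so x is a half-integer, a zero of the first cosine.\<close>
      define t where "t = round x"
      have t1: "\<bar>of_int t - x\<bar> \<le> 1 / 2" unfolding t_def by (rule of_int_round_abs_le)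
      have "\<not> \<bar>(b + a * (pi * of_int t) - pi * of_int (int j)) - pi / 2\<bar> < a * pi / 2" using False by blast
      moreover have "(b + a * (pi * of_int t) - pi * of_int (int j)) - pi / 2 = a * pi * (of_int t - x)"
        using a by (simp add: x_def field_simps)
      ultimately have "a * pi * (1 / 2) \<le> a * pi * \<bar>of_int t - x\<bar>" using a by (simp add: abs_mult)
      then have "1 / 2 \<le> \<bar>of_int t - x\<bar>" using a by (simp only: mult_le_cancel_left_pos mult_pos_pos pi_gt_zero)
      with t1 have "x = of_int t + 1 / 2 \<or> x = of_int t - 1 / 2" by linarith
      then have "pi * x = pi * of_int t + pi / 2 \<or> pi * x = pi * of_int t - pi / 2"
        by (elim disjE) (simp_all add: distrib_left right_diff_distrib)
      then show ?thesis unfolding \<kappa>x by (auto simp: cos_add cos_diff)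
    qed
    show ?thesis by (rule nonreal_zeros_triple[OF a A hol asym inf c1 c2])
  qed
  then obtain k where k: "Re k > \<bar>B\<bar>" "Im k > 0" "liouville_det a \<eta> k = 0" by blast
  then have "bessel_det a \<eta> k = 0" using liouville_det_zero_imp[OF a(1)] by simp
  then show ?thesis using k by (intro exI[of _ k]) auto
qed

lemma infinite_bessel_det_zeros:
  assumes "0 < a" "a < 1"
  shows "infinite {k. k \<notin> \<real> \<and> bessel_det a \<eta> k = 0}" (is "infinite ?Z")
proof
  assume "finite ?Z"
  then have "bdd_above (Re ` ?Z)" by (intro bdd_above_finite) simp
  then obtain B where B: "\<And>k. k \<in> ?Z \<Longrightarrow> Re k \<le> B" unfolding bdd_above_def by auto
  obtain k where k: "Re k > B" "Im k > 0" "bessel_det a \<eta> k = 0" using bessel_det_nonreal_zeros[OF assms] by blast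
  then have "k \<in> ?Z" by (auto simp: complex_is_Real_iff)
  with B k(1) show False by force
qed

text \<open>A kernel vector of the singular 2 x 2 system is read off the row of the first boundary
  condition if that row is nonzero. If it vanishes, the \<eta> term vanishes as well and the row of
  derivatives is used; if both rows vanish, any amplitudes will do.\<close>

lemma transmission_eigenvalue_of_det:
  fixes n \<eta> :: real and k :: complex
  assumes "bessel_E (k\<^sup>2) * (2 * (k\<^sup>2 * of_real n) * bessel_E' (k\<^sup>2 * of_real n))
     - bessel_E (k\<^sup>2 * of_real n) * (2 * k\<^sup>2 * bessel_E' (k\<^sup>2))
     - of_real \<eta> * (bessel_E (k\<^sup>2) * bessel_E (k\<^sup>2 * of_real n)) = 0"
  shows "transmission_eigenvalue unit_disk circle_normal circle_measure n \<eta> k"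
proof (cases "bessel_E (k\<^sup>2) = 0 \<and> bessel_E (k\<^sup>2 * of_real n) = 0")
  case False
  show ?thesis
    by (rule transmission_eigenvalueI[of "bessel_E (k\<^sup>2 * of_real n)" "bessel_E (k\<^sup>2)"])
      (use False assms in \<open>auto simp: algebra_simps\<close>)
next
  case True
  show ?thesis
  proof (cases "of_real n * bessel_E' (k\<^sup>2 * of_real n) = 0 \<and> bessel_E' (k\<^sup>2) = 0")
    case True': False
    show ?thesis
      by (rule transmission_eigenvalueI[of "of_real n * bessel_E' (k\<^sup>2 * of_real n)" "bessel_E' (k\<^sup>2)"])
        (use True True' in auto)
  next
    case False': True
    then show ?thesis by (intro transmission_eigenvalueI[of 1 1]) (use True in auto)
  qed
qed

theorem theorem4p2:
  fixes n :: real
  assumes "n > 0" and "n \<noteq> 1"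
  shows "\<exists>\<eta>\<^sub>0>0. \<forall>\<eta>::real. 0 < \<eta> \<and> \<eta> < \<eta>\<^sub>0 \<longrightarrow>
    infinite {k::complex. k \<notin> \<real> \<and>
      transmission_eigenvalue unit_disk circle_normal circle_measure n \<eta> k}"
proof -
  have "infinite {k::complex. k \<notin> \<real> \<and> transmission_eigenvalue unit_disk circle_normal circle_measure n \<eta> k}" for \<eta>
  proof (cases "n < 1")
    case True
    define a where "a = sqrt n"
    have a: "0 < a" "a < 1" "a\<^sup>2 = n" using assms True by (auto simp: a_def)
    have "{k. k \<notin> \<real> \<and> bessel_det a \<eta> k = 0} \<subseteq>
        {k. k \<notin> \<real> \<and> transmission_eigenvalue unit_disk circle_normal circle_measure n \<eta> k}"
    proof clarify
      fix k assume "bessel_det a \<eta> k = 0"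
      moreover have "(of_real a * k)\<^sup>2 = k\<^sup>2 * of_real n" by (simp add: power_mult_distrib a(3)[symmetric])
      ultimately show "transmission_eigenvalue unit_disk circle_normal circle_measure n \<eta> k"
        by (intro transmission_eigenvalue_of_det) (simp add: bessel_det_def mult.assoc)
    qed
    then show ?thesis by (rule infinite_super[OF _ infinite_bessel_det_zeros[OF a(1,2)]])
  next
    case False
    \<comment> \<open>Interchanging the slower and the faster wave negates the part with derivatives
      but not the symmetric \<eta> term, hence \<open>- \<eta>\<close>; this is why the determinant
      results cover real \<eta> of either sign.\<close>
    define a where "a = 1 / sqrt n"
    have a: "0 < a" "a < 1" "a\<^sup>2 * n = 1" using assms False by (auto simp: a_def power_divide)
    have "(\<lambda>k. of_real a * k) ` {k. k \<notin> \<real> \<and> bessel_det a (- \<eta>) k = 0} \<subseteq>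
        {k. k \<notin> \<real> \<and> transmission_eigenvalue unit_disk circle_normal circle_measure n \<eta> k}"
    proof clarify
      fix k :: complex assume k: "k \<notin> \<real>" "bessel_det a (- \<eta>) k = 0"
      define u where "u = (of_real a * k)\<^sup>2"
      have "u * of_real n = of_real (a\<^sup>2 * n) * k\<^sup>2" by (simp add: u_def power_mult_distrib)
      then have un: "u * of_real n = k\<^sup>2" unfolding a(3) by simp
      have "transmission_eigenvalue unit_disk circle_normal circle_measure n \<eta> (of_real a * k)"
        by (rule transmission_eigenvalue_of_det, unfold u_def[symmetric] un)
          (use k(2)[unfolded bessel_det_def, folded u_def] in \<open>simp add: algebra_simps\<close>)
      moreover have "of_real a * k \<notin> \<real>" using k(1) a by (simp add: complex_is_Real_iff)
      ultimately show "of_real a * k \<notin> \<real> \<and>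
          transmission_eigenvalue unit_disk circle_normal circle_measure n \<eta> (of_real a * k)" by blast
    qed
    moreover have "inj_on (\<lambda>k. of_real a * k) {k. k \<notin> \<real> \<and> bessel_det a (- \<eta>) k = 0}"
      using a by (auto simp: inj_on_def)
    then have "infinite ((\<lambda>k. of_real a * k) ` {k. k \<notin> \<real> \<and> bessel_det a (- \<eta>) k = 0})"
      using infinite_bessel_det_zeros[OF a(1,2), of "- \<eta>"] finite_imageD by blast
    ultimately show ?thesis by (rule infinite_super)
  qed
  then show ?thesis by (intro exI[of _ 1]) auto
qed

end
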